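(* Every map $\mathcal{U}\in W^{1,2}(\Omega;\mathbb{R}^{2n+2})$ satisfying $$D\mathcal{U}(x)\in C_{\mathcal{A}}\quad\text{for a.e. }x\in\Omega$$ is smooth in $\Omega$ (i.e. agrees a.e. with a $C^\infty$ map).
   Context: Throughout, $n\ge 1$ is fixed and $\Omega\subset\mathbb{R}^2$ is a bounded, convex, open set. $\|\cdot\|$ denotes the Euclidean (Hilbert–Schmidt) norm on matrices. For $X\in\mathbb{R}^{n\times 2}$, $X^{ab}$ is the $2\times 2$ submatrix of $X$ formed by its $a$-th and $b$-th rows. The area function $\mathcal{A}:\mathbb{R}^{n\times 2}\to\mathbb{R}$ is $$\mathcal{A}(X)=\sqrt{1+\|X\|^2+\sum_{1\le a\le b\le n}\det(X^{ab})^2},$$ and $D\mathcal{A}(X)\in\mathbb{R}^{n\times 2}$ is its gradient. Put $J=\begin{pmatrix}0&1\\ -1&0\end{pmatrix}$, $A(X)=D\mathcal{A}(X)J\in\mathbb{R}^{n\times 2}$, $B(X)=X^TD\mathcal{A}(X)J-\mathcal{A}(X)J\in\mathbb{R}^{2\times 2}$, and $$C_{\mathcal{A}}=\left\{\begin{pmatrix}X\\ A(X)\\ B(X)\end{pmatrix}: X\in\mathbb{R}^{n\times 2}\right\}\subset\mathbb{R}^{(2n+2)\times 2}.$$ *)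

theory Defs
  imports "HOL-Analysis.Analysis"
begin

section \<open>Smooth maps\<close>

text \<open>
  For an open set \<open>S\<close>, a map is of class \<open>C\<^sup>k\<close> on \<open>S\<close> if its iterated directional derivatives up to
  order \<open>k\<close> exist, as Frechet derivatives applied to vectors, and are continuous on \<open>S\<close>.
\<close>

primrec Ck_on :: "nat \<Rightarrow> 'a::euclidean_space set \<Rightarrow> ('a \<Rightarrow> 'b::real_normed_vector) \<Rightarrow> bool" where
  "Ck_on 0 S f \<longleftrightarrow> continuous_on S f"
| "Ck_on (Suc k) S f \<longleftrightarrow>
     (\<forall>x\<in>S. f differentiable (at x)) \<and> (\<forall>v. Ck_on k S (\<lambda>x. frechet_derivative f (at x) v))"

definition smooth_on :: "'a::euclidean_space set \<Rightarrow> ('a \<Rightarrow> 'b::real_normed_vector) \<Rightarrow> bool" where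
  "smooth_on S f \<longleftrightarrow> (\<forall>k. Ck_on k S f)"

section \<open>Weak derivatives and the Sobolev space \<open>W\<^sup>1\<^sup>,\<^sup>2\<close>\<close>

definition test_function :: "'a::euclidean_space set \<Rightarrow> ('a \<Rightarrow> real) \<Rightarrow> bool" where
  "test_function \<Omega> \<phi> \<longleftrightarrow>
     smooth_on UNIV \<phi> \<and> compact (closure {x. \<phi> x \<noteq> 0}) \<and> closure {x. \<phi> x \<noteq> 0} \<subseteq> \<Omega>"

definition locally_integrable_on ::
    "('a::euclidean_space \<Rightarrow> 'b::euclidean_space) \<Rightarrow> 'a set \<Rightarrow> bool" where
  "locally_integrable_on f \<Omega> \<longleftrightarrow> (\<forall>K. compact K \<and> K \<subseteq> \<Omega> \<longrightarrow> f absolutely_integrable_on K)"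

text \<open>
  \<open>G\<close> is a representative of the distributional Jacobian of \<open>U\<close>: row \<open>i\<close> of \<open>G x\<close> is the weak gradient
  of the \<open>i\<close>-th component of \<open>U\<close>.  Local integrability ensures that neither of the two Bochner
  integrals takes the default value of a non-integrable function.
\<close>

definition has_weak_jacobian ::
    "(real^'d) set \<Rightarrow> (real^'d \<Rightarrow> real^'m) \<Rightarrow> (real^'d \<Rightarrow> real^'d^'m) \<Rightarrow> bool" where
  "has_weak_jacobian \<Omega> U G \<longleftrightarrow>
     locally_integrable_on U \<Omega> \<and> locally_integrable_on G \<Omega> \<and>
     (\<forall>\<phi> i j. test_function \<Omega> \<phi> \<longrightarrow>
        (LINT x|lebesgue_on \<Omega>. U x $ i * frechet_derivative \<phi> (at x) (axis j 1))
          = - (LINT x|lebesgue_on \<Omega>. G x $ i $ j * \<phi> x))"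

definition square_integrable_on ::
    "('a::euclidean_space \<Rightarrow> 'b::euclidean_space) \<Rightarrow> 'a set \<Rightarrow> bool" where
  "square_integrable_on f \<Omega> \<longleftrightarrow>
     f \<in> borel_measurable (lebesgue_on \<Omega>) \<and> integrable (lebesgue_on \<Omega>) (\<lambda>x. (norm (f x))\<^sup>2)"

definition W12 :: "(real^'d) set \<Rightarrow> (real^'d \<Rightarrow> real^'m) set" where
  "W12 \<Omega> = {U. square_integrable_on U \<Omega> \<and>
                 (\<exists>G. has_weak_jacobian \<Omega> U G \<and> square_integrable_on G \<Omega>)}"

section \<open>The area function and its differential inclusion\<close>

text \<open>
  An \<open>n \<times> 2\<close> matrix is an element of \<open>real^2^'n\<close>, whose inner product and norm are the
  Hilbert-Schmidt ones.  The order on the row index type \<open>'n\<close> serves only to index the minors.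
\<close>

definition rows_minor :: "real^2^'n \<Rightarrow> 'n \<Rightarrow> 'n \<Rightarrow> real^2^2" where
  "rows_minor X a b = vector [X $ a, X $ b]"

definition area :: "real^2^'n::{finite,linorder} \<Rightarrow> real" where
  "area X = sqrt (1 + (norm X)\<^sup>2 + (\<Sum>a\<in>UNIV. \<Sum>b\<in>{a..}. (det (rows_minor X a b))\<^sup>2))"

definition gradient :: "('a::real_inner \<Rightarrow> real) \<Rightarrow> 'a \<Rightarrow> 'a" where
  "gradient f x = (THE D. GDERIV f x :> D)"

lemma gradient_eqI:
  assumes "GDERIV f x :> D"
  shows "gradient f x = D"
  unfolding gradient_def
proof (rule the_equality)
  fix E assume E: "GDERIV f x :> E"
  have "(\<lambda>h. inner h E) = (\<lambda>h. inner h D)"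
    using has_derivative_unique[OF E[unfolded gderiv_def] assms[unfolded gderiv_def]] .
  then have "inner (E - D) E = inner (E - D) D"
    by metis
  then have "inner (E - D) (E - D) = 0"
    by (simp add: inner_diff_right)
  then show "E = D"
    by simp
qed (rule assms)

lemma GDERIV_gradient:
  fixes f :: "'a::euclidean_space \<Rightarrow> real"
  assumes "f differentiable (at x)"
  shows "GDERIV f x :> gradient f x"
proof -
  obtain f' where f': "(f has_derivative f') (at x)"
    using assms by (auto simp: differentiable_def)
  have "f' h = inner h (\<Sum>b\<in>Basis. f' b *\<^sub>R b)" for h
  proof -
    have lin: "linear f'" using f' by (rule has_derivative_linear)
    have "f' h = f' (\<Sum>b\<in>Basis. inner h b *\<^sub>R b)"
      by (simp only: euclidean_representation)
    also have "\<dots> = (\<Sum>b\<in>Basis. inner h b * f' b)"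
      by (simp only: linear_sum[OF lin] linear_scale[OF lin] real_scaleR_def)
    finally show ?thesis by (simp add: inner_sum_right mult.commute)
  qed
  then have "GDERIV f x :> (\<Sum>b\<in>Basis. f' b *\<^sub>R b)"
    using f' unfolding gderiv_def by (metis (no_types, lifting) ext)
  then show ?thesis by (simp add: gradient_eqI)
qed

lemma area_differentiable:
  fixes X :: "real^2^'n::{finite,linorder}"
  shows "area differentiable (at X)"
proof -
  define P where "P = (\<lambda>X :: real^2^'n::{finite,linorder}. 1 + inner X X
    + (\<Sum>a\<in>UNIV. \<Sum>b\<in>{a..}. (X$a$1 * X$b$2 - X$a$2 * X$b$1)\<^sup>2))"
  have eq: "area = (\<lambda>X. sqrt (P X))"
    by (simp add: fun_eq_iff area_def P_def rows_minor_def det_2 power2_norm_eq_inner)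
  have pos: "0 < P X" for X
    unfolding P_def
    by (intro add_pos_nonneg sum_nonneg) auto
  have bl: "bounded_linear (\<lambda>X :: real^2^'n::{finite,linorder}. X $ a $ i)" for a i
    by (rule bounded_linear_compose[OF bounded_linear_vec_nth bounded_linear_vec_nth])
  have D: "(\<lambda>X :: real^2^'n::{finite,linorder}. X $ a $ i) differentiable (at X)" for a i
    using bl bounded_linear_imp_differentiable by blast
  have "P differentiable (at X)"
    unfolding P_def power2_eq_square
    by (intro differentiable_add differentiable_sum differentiable_mult differentiable_diff
        differentiable_const differentiable_inner differentiable_ident D ballI) auto
  moreover have "sqrt differentiable (at (P X))"
    using DERIV_real_sqrt[OF pos[of X]] by (auto simp: differentiable_def has_field_derivative_def)
  ultimately show ?thesis
    unfolding eq using differentiable_chain_at[of P X sqrt] by (simp add: o_def)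
qed

lemma GDERIV_area: "GDERIV area X :> gradient area X"
  by (rule GDERIV_gradient[OF area_differentiable])

definition J :: "real^2^2" where
  "J = vector [vector [0, 1], vector [-1, 0]]"

definition A_map :: "real^2^'n::{finite,linorder} \<Rightarrow> real^2^'n::{finite,linorder}" where
  "A_map X = gradient area X ** J"

definition B_map :: "real^2^'n::{finite,linorder} \<Rightarrow> real^2^2" where
  "B_map X = transpose X ** gradient area X ** J - area X *\<^sub>R J"

text \<open>Vertical concatenation of three blocks; the row index type \<open>'p + 'q + 'r\<close> is a disjoint union.\<close>

definition stack3 :: "real^2^'p \<Rightarrow> real^2^'q \<Rightarrow> real^2^'r \<Rightarrow> real^2^('p + 'q + 'r)" where
  "stack3 X Y Z = (\<chi> i. case i of
       Inl a \<Rightarrow> X $ a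
     | Inr j \<Rightarrow> (case j of Inl b \<Rightarrow> Y $ b | Inr c \<Rightarrow> Z $ c))"

definition C_area :: "(real^2^('n::{finite,linorder} + 'n + 2)) set" where
  "C_area = range (\<lambda>X :: real^2^'n::{finite,linorder}. stack3 X (A_map X) (B_map X))"

end

theory Submission
  imports Defs "HOL-Complex_Analysis.Great_Picard"
begin

text \<open>
  Write \<open>g = I + X\<^sup>T X\<close> and \<open>h = g / sqrt (det g)\<close>, a positive definite matrix of determinant \<open>1\<close>. If
  \<open>(u, v, w)\<close> are the three blocks of \<open>U\<close>, the inclusion says that \<open>h\<close> is the Jacobian of
  \<open>\<phi> = (w\<^sub>2, - w\<^sub>1)\<close>, a Monge--Ampere equation, and that each pair \<open>u\<^sub>a, v\<^sub>a\<close> is conjugate harmonic with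
  respect to the metric \<open>h\<close>. Lewy's map \<open>id + \<phi>\<close> provides conformal coordinates for \<open>h\<close>: since
  \<open>det h = 1\<close>, the Jacobian of its inverse \<open>p\<close> is symmetric of trace \<open>1\<close>, and \<open>2 p - id\<close> is harmonic. As \<open>\<phi>\<close> is only of
  class \<open>W\<^sup>1\<^sup>,\<^sup>2\<close>, this is done for the mollifications of \<open>\<phi>\<close>, which are monotone; their inverses
  converge uniformly, and the Cauchy--Riemann defects of \<open>2 p - id\<close> tend to \<open>0\<close> in \<open>L\<^sup>1\<close>, so that Weyl's
  lemma applies to the limit. The strong maximum principle and a comparison of areas show that the
  derivative of \<open>p\<close> is invertible, and Minty's argument identifies the inverse of \<open>p\<close> with \<open>id + \<phi>\<close>.
  In the coordinates \<open>p\<close> the functions \<open>u\<^sub>a\<close> and \<open>v\<^sub>a\<close> are conjugate harmonic in the usual sense.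
\<close>

section \<open>Calculus of smooth maps\<close>

text \<open>The exponent 2 is critical in the plane: \<open>\<phi>\<close> need not be Lipschitz,
  and mollification destroys the nonlinear equation for the determinant. Two properties survive.
  Symmetry and positivity of the Jacobian are preserved by averages, so the mollified Lewy maps do
  not decrease distances and their inverses are 1-Lipschitz, with no bound on \<open>h\<close>; this
  gives compactness. And the determinant is quadratic, so it is controlled by the mollified square
  of \<open>norm h\<close>, which converges in L1; hence the mollified determinants tend to 1 in L1,
  and the area formula moves this to the inverse maps without a lower bound for any Jacobian. The
  trace condition is the determinant condition in disguise: the inverse of \<open>I + h\<close> has
  trace \<open>(2 + tr h) / (1 + tr h + det h)\<close>, which is 1 if and only if
  \<open>det h = 1\<close>. Compactness gives no lower bound: the derivative of \<open>p\<close> is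
  nonnegative, at most 1 in norm, and might degenerate. A degenerate direction at one point spreads
  over a ball by harmonicity, so the ball would be squeezed into a line, against the
  equi-integrability of the Jacobians of the mollified maps.\<close>

lemma Ck_on_cong:
  assumes "open S" "\<And>x. x \<in> S \<Longrightarrow> f x = g x"
  shows "Ck_on k S f \<longleftrightarrow> Ck_on k S g"
  using assms(2)
proof (induction k arbitrary: f g)
  case 0
  then show ?case by (auto cong: continuous_on_cong)
next
  case (Suc k)
  have D: "(f has_derivative D) (at x) \<longleftrightarrow> (g has_derivative D) (at x)" if "x \<in> S" for x D
    using that Suc.prems has_derivative_transform_within_open[of f D x UNIV S g]
      has_derivative_transform_within_open[of g D x UNIV S f] \<open>open S\<close> by auto
  then have "frechet_derivative f (at x) = frechet_derivative g (at x)" if "x \<in> S" for x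
    using that by (simp add: frechet_derivative_def)
  then have "Ck_on k S (\<lambda>x. frechet_derivative f (at x) v) \<longleftrightarrow>
      Ck_on k S (\<lambda>x. frechet_derivative g (at x) v)" for v
    by (intro Suc.IH) simp
  with D show ?case by (simp add: differentiable_def)
qed

lemma Ck_on_SucI:
  assumes "open S" "\<And>x. x \<in> S \<Longrightarrow> (f has_derivative f' x) (at x)"
    and "\<And>v. Ck_on k S (\<lambda>x. f' x v)"
  shows "Ck_on (Suc k) S f"
proof -
  have "Ck_on k S (\<lambda>x. frechet_derivative f (at x) v)" for v
    by (rule Ck_on_cong[THEN iffD1, OF assms(1) _ assms(3)[of v]])
      (metis frechet_derivative_at[OF assms(2)])
  then show ?thesis using assms(2) by (auto simp: differentiable_def)
qed

lemma Ck_on_has_derivative: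
  assumes "Ck_on (Suc k) S f" "x \<in> S"
  shows "(f has_derivative frechet_derivative f (at x)) (at x)"
  using assms by (simp add: frechet_derivative_works)

lemma Ck_on_Suc_imp: "Ck_on (Suc k) S f \<Longrightarrow> Ck_on k S f"
proof (induction k arbitrary: f)
  case 0
  then show ?case
    by (auto intro!: continuous_at_imp_continuous_on differentiable_imp_continuous_within)
qed simp

lemma Ck_on_subset: "Ck_on k S f \<Longrightarrow> T \<subseteq> S \<Longrightarrow> Ck_on k T f"
proof (induction k arbitrary: f)
  case (Suc k)
  have "Ck_on k T (\<lambda>x. frechet_derivative f (at x) v)" for v
    using Suc by simp
  with Suc.prems show ?case by auto
qed (auto intro: continuous_on_subset)

text \<open>A class closed under directional differentiation consists of smooth maps, by induction
  on the order. It is applied to classes whose derivatives keep their shape: the identity with the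
  constants, convolutions of one function with all test functions, compositions with one fixed inner
  map.\<close>

lemma smooth_on_coinduct:
  assumes "open S" "P f"
    and "\<And>f. P f \<Longrightarrow> \<exists>f'. (\<forall>x\<in>S. (f has_derivative f' x) (at x)) \<and> (\<forall>v. P (\<lambda>x. f' x v))"
  shows "smooth_on S f"
  unfolding smooth_on_def
proof
  fix k show "Ck_on k S f" using assms(2)
  proof (induction k arbitrary: f)
    case 0
    obtain f' where "\<forall>x\<in>S. (f has_derivative f' x) (at x)"
      using assms(3)[OF 0] by auto
    then have "isCont f x" if "x \<in> S" for x
      using has_derivative_continuous that by blast
    then show ?case by (simp add: continuous_at_imp_continuous_on)
  next
    case (Suc k)
    obtain f' where "\<forall>x\<in>S. (f has_derivative f' x) (at x)" "\<forall>v. P (\<lambda>x. f' x v)"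
      using assms(3)[OF Suc.prems] by auto
    then show ?case using Suc.IH by (intro Ck_on_SucI[OF assms(1)]) auto
  qed
qed

lemma smooth_on_cong:
  "open S \<Longrightarrow> (\<And>x. x \<in> S \<Longrightarrow> f x = g x) \<Longrightarrow> smooth_on S f \<longleftrightarrow> smooth_on S g"
  unfolding smooth_on_def using Ck_on_cong by blast

lemma smooth_on_subset: "smooth_on S f \<Longrightarrow> T \<subseteq> S \<Longrightarrow> smooth_on T f"
  unfolding smooth_on_def using Ck_on_subset by blast

lemma smooth_on_continuous: "smooth_on S f \<Longrightarrow> continuous_on S f"
  unfolding smooth_on_def by (metis Ck_on.simps(1))

lemma smooth_on_has_derivative:
  "smooth_on S f \<Longrightarrow> x \<in> S \<Longrightarrow> (f has_derivative frechet_derivative f (at x)) (at x)"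
  unfolding smooth_on_def by (rule Ck_on_has_derivative[of 0]) auto

lemma smooth_on_derivative:
  "smooth_on S f \<Longrightarrow> smooth_on S (\<lambda>x. frechet_derivative f (at x) v)"
  unfolding smooth_on_def
proof
  fix k assume "\<forall>k. Ck_on k S f"
  then have "Ck_on (Suc k) S f" ..
  then show "Ck_on k S (\<lambda>x. frechet_derivative f (at x) v)" by simp
qed

lemma smooth_on_local:
  assumes "open S" "\<And>x. x \<in> S \<Longrightarrow> \<exists>T. open T \<and> x \<in> T \<and> smooth_on T f"
  shows "smooth_on S f"
  unfolding smooth_on_def
proof
  fix k
  have "\<exists>T. open T \<and> x \<in> T \<and> Ck_on k T f" if "x \<in> S" for x
    using assms(2)[OF that] by (auto simp: smooth_on_def)
  then show "Ck_on k S f"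
  proof (induction k arbitrary: f)
    case 0
    have "isCont f x" if "x \<in> S" for x
      using 0[OF that] continuous_on_eq_continuous_at by auto
    then show ?case by (simp add: continuous_at_imp_continuous_on)
  next
    case (Suc k)
    have "f differentiable at x" if "x \<in> S" for x
      using Suc.prems[OF that] by auto
    moreover have "Ck_on k S (\<lambda>x. frechet_derivative f (at x) v)" for v
    proof (rule Suc.IH)
      fix x assume "x \<in> S"
      then obtain T where "open T" "x \<in> T" "Ck_on (Suc k) T f" using Suc.prems by blast
      then show "\<exists>T. open T \<and> x \<in> T \<and> Ck_on k T (\<lambda>x. frechet_derivative f (at x) v)" by auto
    qed
    ultimately show ?case by simp
  qed
qed

lemma Ck_on_const [simp]: "Ck_on k S (\<lambda>x. c)"
  by (induction k arbitrary: c) auto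

lemma Ck_on_add:
  assumes "open S" "Ck_on k S f" "Ck_on k S g"
  shows "Ck_on k S (\<lambda>x. f x + g x)"
  using assms(2,3)
proof (induction k arbitrary: f g)
  case 0
  then show ?case by (simp add: continuous_on_add)
next
  case (Suc k)
  show ?case
  proof (rule Ck_on_SucI[OF assms(1)])
    show "((\<lambda>x. f x + g x) has_derivative
        (\<lambda>v. frechet_derivative f (at x) v + frechet_derivative g (at x) v)) (at x)" if "x \<in> S" for x
      using Suc.prems that by (intro has_derivative_add Ck_on_has_derivative)
  qed (use Suc in simp)
qed

lemma Ck_on_bilinear:
  assumes "bounded_bilinear h" "open S" "Ck_on k S f" "Ck_on k S g"
  shows "Ck_on k S (\<lambda>x. h (f x) (g x))"
  using assms(3,4)
proof (induction k arbitrary: f g)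
  case 0
  then show ?case by (simp add: bounded_bilinear.continuous_on[OF assms(1)])
next
  case (Suc k)
  show ?case
  proof (rule Ck_on_SucI[OF assms(2)])
    show "((\<lambda>x. h (f x) (g x)) has_derivative
        (\<lambda>v. h (f x) (frechet_derivative g (at x) v) + h (frechet_derivative f (at x) v) (g x))) (at x)"
      if "x \<in> S" for x
      using Suc.prems that by (intro bounded_bilinear.FDERIV[OF assms(1)] Ck_on_has_derivative)
    show "Ck_on k S (\<lambda>x. h (f x) (frechet_derivative g (at x) v) +
        h (frechet_derivative f (at x) v) (g x))" for v
      using Suc.prems[THEN Ck_on_Suc_imp] Suc.prems
      by (intro Ck_on_add assms Suc.IH) auto
  qed
qed

lemma Ck_on_linear:
  assumes "bounded_linear h" "open S" "Ck_on k S f"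
  shows "Ck_on k S (\<lambda>x. h (f x))"
  using assms(3)
proof (induction k arbitrary: f)
  case 0
  then show ?case by (simp add: bounded_linear.continuous_on[OF assms(1)])
next
  case (Suc k)
  show ?case
    using Suc
    by (intro Ck_on_SucI[OF assms(2), where f' = "\<lambda>x v. h (frechet_derivative f (at x) v)"]
        bounded_linear.has_derivative[OF assms(1)] Ck_on_has_derivative) auto
qed

text \<open>The derivative contains \<open>inverse (f x)\<close> itself, so \<open>f\<close> stays
  fixed in the induction: the hypothesis of order \<open>k\<close> for the same reciprocal is fed
  into the product rule.\<close>

lemma Ck_on_inverse:
  fixes f :: "'a::euclidean_space \<Rightarrow> real"
  assumes "open S" "Ck_on k S f" "\<And>x. x \<in> S \<Longrightarrow> f x \<noteq> 0"
  shows "Ck_on k S (\<lambda>x. inverse (f x))"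
  using assms(2)
proof (induction k)
  case 0
  then show ?case using assms(3) by (auto intro: continuous_on_inverse)
next
  case (Suc k)
  show ?case
  proof (rule Ck_on_SucI[OF assms(1)])
    show "((\<lambda>x. inverse (f x)) has_derivative
        (\<lambda>v. - (inverse (f x) * frechet_derivative f (at x) v * inverse (f x)))) (at x)"
      if "x \<in> S" for x
      using Suc.prems that assms(3) by (intro Deriv.has_derivative_inverse Ck_on_has_derivative) auto
    have "Ck_on k S (\<lambda>x. inverse (f x))"
      using Suc.IH Ck_on_Suc_imp[OF Suc.prems] .
    then show "Ck_on k S (\<lambda>x. - (inverse (f x) * frechet_derivative f (at x) v * inverse (f x)))" for v
      using Suc.prems
      by (intro Ck_on_linear[OF bounded_linear_minus[OF bounded_linear_ident]] assms
          Ck_on_bilinear[OF bounded_bilinear_mult]) auto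
  qed
qed

lemma smooth_on_const [simp]: "smooth_on S (\<lambda>x. c)"
  by (simp add: smooth_on_def)

lemma smooth_on_add:
  "open S \<Longrightarrow> smooth_on S f \<Longrightarrow> smooth_on S g \<Longrightarrow> smooth_on S (\<lambda>x. f x + g x)"
  by (simp add: smooth_on_def Ck_on_add)

lemma smooth_on_linear:
  "bounded_linear h \<Longrightarrow> open S \<Longrightarrow> smooth_on S f \<Longrightarrow> smooth_on S (\<lambda>x. h (f x))"
  by (simp add: smooth_on_def Ck_on_linear)

lemma smooth_on_mult:
  fixes f g :: "'a::euclidean_space \<Rightarrow> real"
  shows "open S \<Longrightarrow> smooth_on S f \<Longrightarrow> smooth_on S g \<Longrightarrow> smooth_on S (\<lambda>x. f x * g x)"
  by (simp add: smooth_on_def Ck_on_bilinear[OF bounded_bilinear_mult])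

lemma smooth_on_inverse:
  fixes f :: "'a::euclidean_space \<Rightarrow> real"
  shows "open S \<Longrightarrow> smooth_on S f \<Longrightarrow> (\<And>x. x \<in> S \<Longrightarrow> f x \<noteq> 0) \<Longrightarrow> smooth_on S (\<lambda>x. inverse (f x))"
  by (simp add: smooth_on_def Ck_on_inverse)

lemma smooth_on_minus:
  "open S \<Longrightarrow> smooth_on S f \<Longrightarrow> smooth_on S (\<lambda>x. - f x)"
  by (rule smooth_on_linear[OF bounded_linear_minus[OF bounded_linear_ident]])

lemma smooth_on_diff:
  "open S \<Longrightarrow> smooth_on S f \<Longrightarrow> smooth_on S g \<Longrightarrow> smooth_on S (\<lambda>x. f x - g x)"
  using smooth_on_add[OF _ _ smooth_on_minus, of S f g] by simp

lemma smooth_on_id: "open S \<Longrightarrow> smooth_on S (\<lambda>x. x)"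
proof (rule smooth_on_coinduct[of S "\<lambda>f. f = (\<lambda>x. x) \<or> (\<exists>c. f = (\<lambda>x. c))"])
  fix f :: "'a \<Rightarrow> 'a"
  assume "f = (\<lambda>x. x) \<or> (\<exists>c. f = (\<lambda>x. c))"
  then have "(\<forall>x\<in>S. (f has_derivative (\<lambda>v. v)) (at x)) \<or> (\<forall>x\<in>S. (f has_derivative (\<lambda>v. 0)) (at x))"
    by auto
  then show "\<exists>f'. (\<forall>x\<in>S. (f has_derivative f' x) (at x)) \<and>
         (\<forall>v. (\<lambda>x. f' x v) = (\<lambda>x. x) \<or> (\<exists>c. (\<lambda>x. f' x v) = (\<lambda>x. c)))"
    by auto
qed auto

lemma smooth_on_vec:
  fixes f :: "'a::euclidean_space \<Rightarrow> real^'m"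
  assumes "open S" "\<And>i. smooth_on S (\<lambda>x. f x $ i)"
  shows "smooth_on S f"
proof -
  have bl: "bounded_linear (\<lambda>c. c *\<^sub>R (axis i 1 :: real^'m))" for i
    by (rule bounded_linear_scaleR_left)
  have "Ck_on k S (\<lambda>x. \<Sum>i\<in>I. (f x $ i) *\<^sub>R (axis i 1 :: real^'m))" if "finite I" for k and I :: "'m set"
    using that
  proof induction
    case (insert i I)
    have "Ck_on k S (\<lambda>x. f x $ i *\<^sub>R (axis i 1 :: real^'m))"
      using Ck_on_linear[OF bl assms(1), of k "\<lambda>x. f x $ i" i] assms(2)[of i] by (simp add: smooth_on_def)
    with insert show ?case by (simp add: Ck_on_add[OF assms(1)])
  qed simp
  from this[of UNIV] show ?thesis
    by (simp add: smooth_on_def basis_expansion scalar_mult_eq_scaleR[symmetric])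
qed

text \<open>The chain rule, together with the inverse function theorem, expresses the derivative of
  \<open>G \<circ> g\<close> as \<open>G' \<circ> g\<close> with \<open>G'\<close> built from \<open>G\<close> and the inverse of the derivative of \<open>\<psi>\<close>; iterating
  this never differentiates \<open>g\<close> more than once.\<close>
lemma smooth_on_compose_inverse:
  fixes g :: "'a::euclidean_space \<Rightarrow> 'a" and G :: "'a \<Rightarrow> real"
  assumes "open N" "open W" "g ` N \<subseteq> W"
    and g: "\<And>x. x \<in> N \<Longrightarrow> (g has_derivative Q (g x)) (at x)"
    and Q: "\<And>b v. b \<in> Basis \<Longrightarrow> smooth_on W (\<lambda>y. Q y v \<bullet> b)"
    and "smooth_on W G"
  shows "smooth_on N (\<lambda>x. G (g x))"
proof (rule smooth_on_coinduct[of N "\<lambda>f. \<exists>G :: 'a \<Rightarrow> real. smooth_on W G \<and> f = (\<lambda>x. G (g x))"])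
  fix f assume "\<exists>G :: 'a \<Rightarrow> real. smooth_on W G \<and> f = (\<lambda>x. G (g x))"
  then obtain G where G: "smooth_on W G" "f = (\<lambda>x. G (g x))" by blast
  define F where "F = (\<lambda>x v. frechet_derivative G (at (g x)) (Q (g x) v))"
  have "(f has_derivative F x) (at x)" if "x \<in> N" for x
    unfolding G(2) F_def using has_derivative_compose[OF g[OF that] smooth_on_has_derivative[OF G(1)]]
      that assms(3) by auto
  moreover have "\<exists>G'. smooth_on W G' \<and> (\<forall>x\<in>N. F x v = G' (g x))" for v
  proof (intro exI conjI ballI)
    let ?G = "\<lambda>y. \<Sum>b\<in>Basis. (Q y v \<bullet> b) * frechet_derivative G (at y) b"
    have "smooth_on W (\<lambda>y. \<Sum>b\<in>I. (Q y v \<bullet> b) * frechet_derivative G (at y) b)"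
      if "finite I" "I \<subseteq> Basis" for I
      using that
      by (induction I) (auto intro!: smooth_on_add smooth_on_mult assms smooth_on_derivative G)
    then show "smooth_on W ?G" by simp
    fix x assume "x \<in> N"
    then have "linear (frechet_derivative G (at (g x)))"
      using smooth_on_has_derivative[OF G(1)] assms(3) has_derivative_linear by blast
    then show "F x v = ?G (g x)"
      unfolding F_def
      by (subst euclidean_representation[of "Q (g x) v", symmetric])
        (simp add: linear_sum linear_scale del: euclidean_representation)
  qed
  \<comment> \<open>The factorisation through \<open>g\<close> holds on \<open>N\<close> only,
    whereas the coinduction class asks for an equation of functions. Replacing \<open>F x v\<close>
    by \<open>G' v (g x)\<close> changes nothing on \<open>N\<close> and makes it hold
    everywhere.\<close>
  then obtain G' where "\<And>v. smooth_on W (G' v)" "\<And>v x. x \<in> N \<Longrightarrow> F x v = G' v (g x)" by metis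
  ultimately show "\<exists>f'. (\<forall>x\<in>N. (f has_derivative f' x) (at x)) \<and>
        (\<forall>v. \<exists>G. smooth_on W G \<and> (\<lambda>x. f' x v) = (\<lambda>x. G (g x)))"
    by (intro exI[of _ "\<lambda>x v. G' v (g x)"]) (metis ext)
qed (use assms in auto)

section \<open>Differentiation under the integral sign\<close>

text \<open>Dominated convergence along sequences: by the mean value inequality, the bound
  \<open>C\<close> on the derivative yields difference quotients dominated by
  \<open>2 * C * norm (f y)\<close>. With one fixed integrable factor \<open>f\<close> and a bounded
  kernel this covers convolutions (parameter in space), averages (parameter the radius) and
  translations.\<close>

lemma has_derivative_lebesgue_integral:
  fixes K :: "'p::real_normed_vector \<Rightarrow> 'y \<Rightarrow> real"
    and f :: "'y \<Rightarrow> 'b::{banach, second_countable_topology}"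
  assumes f: "integrable M f" and r: "r > 0"
    and K: "\<And>t. t \<in> ball t0 r \<Longrightarrow> K t \<in> borel_measurable M"
    and KB: "\<And>t y. t \<in> ball t0 r \<Longrightarrow> \<bar>K t y\<bar> \<le> B"
    and K': "\<And>t y. t \<in> ball t0 r \<Longrightarrow> ((\<lambda>t. K t y) has_derivative K' t y) (at t)"
    and bound: "\<And>t y v. t \<in> ball t0 r \<Longrightarrow> \<bar>K' t y v\<bar> \<le> C * norm v"
    and K'm: "\<And>v. (\<lambda>y. K' t0 y v) \<in> borel_measurable M"
  shows "((\<lambda>t. LINT y|M. K t y *\<^sub>R f y) has_derivative (\<lambda>v. LINT y|M. K' t0 y v *\<^sub>R f y)) (at t0)"
proof -
  have t0: "t0 \<in> ball t0 r" using r by simp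
  have [measurable]: "f \<in> borel_measurable M" using f by simp
  have bdd: "integrable M (\<lambda>y. g y *\<^sub>R f y)" if "g \<in> borel_measurable M" "\<And>y. \<bar>g y\<bar> \<le> c" for g c
  proof (rule Bochner_Integration.integrable_bound[of M "\<lambda>y. c *\<^sub>R norm (f y)"])
    show "AE y in M. norm (g y *\<^sub>R f y) \<le> norm (c *\<^sub>R norm (f y))"
      using that(2) order_trans[OF that(2) abs_ge_self] by (auto intro!: AE_I2 mult_right_mono simp: abs_mult)
  qed (use f that(1) in \<open>auto intro: borel_measurable_integrable\<close>)
  have iK: "integrable M (\<lambda>y. K t y *\<^sub>R f y)" if "t \<in> ball t0 r" for t
    using bdd[OF K[OF that] KB[OF that]] .
  have iK': "integrable M (\<lambda>y. K' t0 y v *\<^sub>R f y)" for v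
    using bdd[OF K'm bound[OF t0]] .
  have lin: "linear (K' t0 y)" for y using K'[OF t0] has_derivative_linear by blast
  let ?L = "\<lambda>v. LINT y|M. K' t0 y v *\<^sub>R f y"
  have "bounded_linear ?L"
  proof (rule bounded_linear_intro)
    show "?L (a + b) = ?L a + ?L b" for a b
      by (simp add: linear_add[OF lin] scaleR_add_left Bochner_Integration.integral_add[OF iK' iK'])
    show "?L (c *\<^sub>R a) = c *\<^sub>R ?L a" for a c
      by (simp add: linear_scale[OF lin] flip: scaleR_scaleR)
    show "norm (?L v) \<le> norm v * (C * (LINT y|M. norm (f y)))" for v
    proof -
      have "norm (?L v) \<le> (LINT y|M. norm (K' t0 y v *\<^sub>R f y))" by (rule integral_norm_bound)
      also have "\<dots> \<le> (LINT y|M. (C * norm v) * norm (f y))"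
        using bound[OF t0] f by (intro integral_mono integrable_norm iK') (auto intro!: mult_right_mono)
      finally show ?thesis by (simp add: algebra_simps)
    qed
  qed
  moreover have "((\<lambda>t. norm ((LINT y|M. K t y *\<^sub>R f y) - (LINT y|M. K t0 y *\<^sub>R f y) - ?L (t - t0))
      / norm (t - t0)) \<longlongrightarrow> 0) (at t0)"
    unfolding tendsto_at_iff_sequentially
  proof (intro allI impI)
    fix X assume X: "\<forall>i. X i \<in> UNIV - {t0}" "X \<longlonglongrightarrow> t0"
    define s where "s i y = (if X i \<in> ball t0 r then
       ((K (X i) y - K t0 y - K' t0 y (X i - t0)) / norm (X i - t0)) *\<^sub>R f y else 0)" for i y
    have ev: "\<forall>\<^sub>F i in sequentially. X i \<in> ball t0 r"
      using X(2) topological_tendstoD[OF X(2) open_ball t0] by simp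
    have "(\<lambda>i. LINT y|M. s i y) \<longlonglongrightarrow> (LINT y|M. 0)"
    proof (rule integral_dominated_convergence[where w = "\<lambda>y. (2 * C) * norm (f y)"])
      show "s i \<in> borel_measurable M" for i
        unfolding s_def by (cases "X i \<in> ball t0 r") (auto intro!: borel_measurable_scaleR
          borel_measurable_diff borel_measurable_divide K K'm t0 simp del: mem_ball)
      show "AE y in M. (\<lambda>i. s i y) \<longlonglongrightarrow> 0"
      proof (rule AE_I2)
        fix y
        have "((\<lambda>t. norm (K t y - K t0 y - K' t0 y (t - t0)) / norm (t - t0)) \<longlongrightarrow> 0) (at t0)"
          using K'[OF t0] unfolding has_derivative_iff_norm by simp
        then have "(\<lambda>i. norm (K (X i) y - K t0 y - K' t0 y (X i - t0)) / norm (X i - t0)) \<longlonglongrightarrow> 0"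
          using X by (simp add: tendsto_at_iff_sequentially o_def)
        then have "(\<lambda>i. (norm (K (X i) y - K t0 y - K' t0 y (X i - t0)) / norm (X i - t0)) * norm (f y)) \<longlonglongrightarrow> 0"
          by (rule tendsto_mult_left_zero)
        then have "(\<lambda>i. norm (s i y)) \<longlonglongrightarrow> 0"
          by (rule Lim_transform_eventually) (use ev in eventually_elim, simp add: s_def)
        then show "(\<lambda>i. s i y) \<longlonglongrightarrow> 0" by (rule tendsto_norm_zero_cancel)
      qed
      show "AE y in M. norm (s i y) \<le> (2 * C) * norm (f y)" for i
      proof (rule AE_I2, cases "X i \<in> ball t0 r")
        fix y assume Xi: "X i \<in> ball t0 r"
        \<comment> \<open>The sign of \<open>C\<close> follows from the bound applied to the nonzero
          vector \<open>X i - t0\<close>.\<close>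
        have "0 \<le> C * norm (X i - t0)" using bound[OF t0] abs_ge_zero order_trans by blast
        then have C0: "0 \<le> C" using X(1) by (simp add: zero_le_mult_iff)
        have "norm (K (X i) y - K t0 y) \<le> C * norm (X i - t0)"
        proof (rule differentiable_bound[of "ball t0 r" "\<lambda>t. K t y" "\<lambda>t. K' t y"])
          show "((\<lambda>t. K t y) has_derivative K' t y) (at t within ball t0 r)" if "t \<in> ball t0 r" for t
            using K'[OF that] has_derivative_at_withinI by blast
          show "onorm (K' t y) \<le> C" if "t \<in> ball t0 r" for t
            by (rule onorm_bound) (use bound[OF that] C0 in simp_all)
        qed (use Xi t0 in auto)
        moreover have "\<bar>K' t0 y (X i - t0)\<bar> \<le> C * norm (X i - t0)" by (rule bound[OF t0])
        ultimately have "\<bar>K (X i) y - K t0 y - K' t0 y (X i - t0)\<bar> \<le> (2 * C) * norm (X i - t0)"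
          by simp
        moreover have "norm (X i - t0) > 0" using X(1) by auto
        ultimately have "\<bar>K (X i) y - K t0 y - K' t0 y (X i - t0)\<bar> / norm (X i - t0) \<le> 2 * C"
          by (simp add: divide_le_eq)
        then show "norm (s i y) \<le> (2 * C) * norm (f y)"
          using mult_right_mono[OF _ norm_ge_zero[of "f y"], of _ "2 * C"] Xi
          by (simp add: s_def del: times_divide_eq_left)
      next
        fix y assume "X i \<notin> ball t0 r"
        moreover have "0 \<le> C * norm (X i - t0)" using bound[OF t0] abs_ge_zero order_trans by blast
        then have "0 \<le> C" using X(1) by (simp add: zero_le_mult_iff)
        ultimately show "norm (s i y) \<le> (2 * C) * norm (f y)" by (simp add: s_def)
      qed
    qed (use f in auto)
    then have "(\<lambda>i. norm (LINT y|M. s i y)) \<longlonglongrightarrow> 0"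
      by (simp add: tendsto_norm_zero)
    then show "((\<lambda>t. norm ((LINT y|M. K t y *\<^sub>R f y) - (LINT y|M. K t0 y *\<^sub>R f y) - ?L (t - t0))
        / norm (t - t0)) \<circ> X) \<longlonglongrightarrow> 0"
    proof (rule Lim_transform_eventually)
      show "\<forall>\<^sub>F i in sequentially. norm (LINT y|M. s i y) = ((\<lambda>t. norm ((LINT y|M. K t y *\<^sub>R f y) -
          (LINT y|M. K t0 y *\<^sub>R f y) - ?L (t - t0)) / norm (t - t0)) \<circ> X) i"
        using ev
      proof eventually_elim
        case (elim i)
        have "(LINT y|M. s i y) = (LINT y|M. (1 / norm (X i - t0)) *\<^sub>R
            (K (X i) y *\<^sub>R f y - K t0 y *\<^sub>R f y - K' t0 y (X i - t0) *\<^sub>R f y))"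
          using elim by (intro Bochner_Integration.integral_cong)
            (auto simp: s_def scaleR_diff_left diff_divide_distrib divide_inverse algebra_simps)
        also have "\<dots> = (1 / norm (X i - t0)) *\<^sub>R ((LINT y|M. K (X i) y *\<^sub>R f y) -
            (LINT y|M. K t0 y *\<^sub>R f y) - ?L (X i - t0))"
          by (simp add: Bochner_Integration.integral_diff iK[OF elim] iK[OF t0] iK')
        finally show ?case by simp
      qed
    qed
  qed
  ultimately show ?thesis by (simp add: has_derivative_iff_norm)
qed

section \<open>A family of smooth radial kernels\<close>

text \<open>The functions \<open>p (1/t) exp (-1/t)\<close>, extended by \<open>0\<close> to \<open>t \<le> 0\<close>, are closed under
  differentiation, which makes all of them smooth at once.\<close>

definition flat :: "real poly \<Rightarrow> real \<Rightarrow> real" where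
  "flat p t = (if t \<le> 0 then 0 else poly p (1 / t) * exp (- (1 / t)))"

text \<open>With \<open>s = 1 / t\<close> one has \<open>s' = - s\<^sup>2\<close>, so the derivative
  of \<open>p(s) exp(-s)\<close> is \<open>s\<^sup>2 (p - p')(s) exp(-s)\<close>; the coefficient
  list is the polynomial \<open>s\<^sup>2\<close>.\<close>

definition flat_deriv :: "real poly \<Rightarrow> real poly" where
  "flat_deriv p = [:0, 0, 1:] * (p - pderiv p)"

lemma flat_tendsto_0: "(flat p \<longlongrightarrow> 0) (at 0)"
proof -
  have "((\<lambda>s. \<Sum>i\<le>degree p. coeff p i * (s ^ i / exp s)) \<longlongrightarrow> (\<Sum>i\<le>degree p. coeff p i * 0)) at_top"
    by (intro tendsto_intros tendsto_power_div_exp_0)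
  then have "((\<lambda>s. poly p s * exp (- s)) \<longlongrightarrow> 0) at_top"
    by (simp add: poly_altdef exp_minus divide_inverse sum_distrib_right mult.assoc)
  from filterlim_compose[OF this filterlim_inverse_at_top_right]
  have "((\<lambda>t. poly p (inverse t) * exp (- inverse t)) \<longlongrightarrow> 0) (at_right 0)" .
  then have "(flat p \<longlongrightarrow> 0) (at_right 0)"
    by (rule Lim_transform_eventually)
      (auto simp: flat_def eventually_at_filter inverse_eq_divide)
  moreover have "(flat p \<longlongrightarrow> 0) (at_left 0)"
    by (rule Lim_transform_eventually[of "\<lambda>t. 0"]) (auto simp: flat_def eventually_at_filter)
  ultimately show ?thesis by (simp add: filterlim_split_at)
qed

lemma flat_has_derivative: "(flat p has_real_derivative flat (flat_deriv p) t) (at t)"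
proof (cases t "0 :: real" rule: linorder_cases)
  case less
  have "((\<lambda>t. 0) has_real_derivative 0) (at t)" by simp
  then have "(flat p has_real_derivative 0) (at t)"
    by (rule has_field_derivative_transform_within_open[where S = "{..<0}"]) (use less in \<open>auto simp: flat_def\<close>)
  then show ?thesis using less by (simp add: flat_def)
next
  case equal
  \<comment> \<open>The difference quotient at 0 is again of the family: dividing by
    \<open>h\<close> multiplies the polynomial by its variable \<open>1 / h\<close>.\<close>
  have "((\<lambda>h. flat (pCons 0 p) h) \<longlongrightarrow> 0) (at 0)" by (rule flat_tendsto_0)
  then have "((\<lambda>h. (flat p h - flat p 0) / h) \<longlongrightarrow> 0) (at 0)"
    by (rule Lim_transform_eventually) (auto simp: flat_def eventually_at_filter)
  then show ?thesis using equal by (simp add: has_field_derivative_iff flat_def)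
next
  case greater
  have "((\<lambda>t. poly p (1 / t) * exp (- (1 / t))) has_real_derivative
      poly (flat_deriv p) (1 / t) * exp (- (1 / t))) (at t)"
    using greater
    by (auto intro!: derivative_eq_intros poly_DERIV[THEN DERIV_chain2]
        simp: flat_deriv_def field_simps power2_eq_square)
  then have "(flat p has_real_derivative poly (flat_deriv p) (1 / t) * exp (- (1 / t))) (at t)"
    by (rule has_field_derivative_transform_within_open[where S = "{0<..}"])
      (use greater in \<open>auto simp: flat_def\<close>)
  then show ?thesis using greater by (simp add: flat_def)
qed

lemma smooth_on_flat_compose:
  fixes r :: "'a::euclidean_space \<Rightarrow> real"
  assumes "open S" "smooth_on S r"
  shows "smooth_on S (\<lambda>x. flat p (r x))"
proof -
  have "Ck_on k S (\<lambda>x. flat p (r x))" for k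
  proof (induction k arbitrary: p)
    case 0
    have "continuous_on UNIV (flat p)"
      using flat_has_derivative DERIV_isCont by (blast intro: continuous_at_imp_continuous_on)
    then show ?case
      using smooth_on_continuous[OF assms(2)] by (auto intro: continuous_on_compose2)
  next
    case (Suc k)
    show ?case
    proof (rule Ck_on_SucI[OF assms(1)])
      show "((\<lambda>x. flat p (r x)) has_derivative
          (\<lambda>v. flat (flat_deriv p) (r x) * frechet_derivative r (at x) v)) (at x)" if "x \<in> S" for x
        using has_derivative_compose[OF smooth_on_has_derivative[OF assms(2) that]
            flat_has_derivative[unfolded has_field_derivative_def]] .
      show "Ck_on k S (\<lambda>x. flat (flat_deriv p) (r x) * frechet_derivative r (at x) v)" for v
        using smooth_on_derivative[OF assms(2)] Suc.IH
        by (intro Ck_on_bilinear[OF bounded_bilinear_mult assms(1)]) (auto simp: smooth_on_def)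
    qed
  qed
  then show ?thesis by (simp add: smooth_on_def)
qed

text \<open>Smooth at the origin because only the squared norm enters. For \<open>d > 0\<close> it
  vanishes outside the ball of radius \<open>d\<close>, where the argument of \<open>flat p\<close>
  is not positive. Leaving \<open>p\<close> free closes the family under differentiation, up to
  polynomial factors in \<open>w\<close>.\<close>

definition radial :: "real poly \<Rightarrow> real \<Rightarrow> 'a::euclidean_space \<Rightarrow> real" where
  "radial p d w = flat p (1 - (w \<bullet> w) / d\<^sup>2)"

lemma smooth_on_inner: "open S \<Longrightarrow> smooth_on S (\<lambda>x. x \<bullet> x)"
  unfolding smooth_on_def
  using smooth_on_id[of S] by (auto simp: smooth_on_def intro: Ck_on_bilinear[OF bounded_bilinear_inner])

lemma smooth_radial: "smooth_on UNIV (radial p d)"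
proof -
  have "smooth_on UNIV (\<lambda>w :: 'a. 1 - inverse (d\<^sup>2) * (w \<bullet> w))"
    by (intro smooth_on_diff smooth_on_mult smooth_on_inner) auto
  then have "smooth_on UNIV (\<lambda>w :: 'a. flat p (1 - inverse (d\<^sup>2) * (w \<bullet> w)))"
    by (rule smooth_on_flat_compose[OF open_UNIV])
  then show ?thesis unfolding radial_def[abs_def] by (simp add: divide_inverse mult.commute)
qed

lemma radial_has_derivative:
  "(radial p d has_derivative (\<lambda>v. radial (flat_deriv p) d w * (- 2 * (w \<bullet> v) / d\<^sup>2))) (at w)"
proof -
  have "((\<lambda>w :: 'a. 1 - (w \<bullet> w) * inverse (d\<^sup>2)) has_derivative
      (\<lambda>v. - 2 * (w \<bullet> v) * inverse (d\<^sup>2))) (at w)"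
    by (auto intro!: derivative_eq_intros simp: inner_commute algebra_simps)
  from has_derivative_compose[OF this flat_has_derivative[unfolded has_field_derivative_def]]
  show ?thesis unfolding radial_def[abs_def] divide_inverse .
qed

lemma radial_eq_0: "d > 0 \<Longrightarrow> norm w \<ge> d \<Longrightarrow> radial p d w = 0"
  unfolding radial_def flat_def
  by (auto simp: dot_square_norm divide_less_eq power2_eq_square not_le mult_mono)

lemma radial_sym: "radial p d (- w) = radial p d w"
  by (simp add: radial_def)

lemma radial_scale: "d > 0 \<Longrightarrow> radial p d (d *\<^sub>R w) = radial p 1 w"
  by (simp add: radial_def power2_eq_square)

lemma radial_cont: "continuous_on UNIV (radial p d)"
  using smooth_on_continuous smooth_radial .

lemma radial_measurable [measurable]: "radial p d \<in> borel_measurable borel"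
  by (rule borel_measurable_continuous_onI[OF radial_cont])

lemma compact_support_bounded:
  fixes f :: "'a::euclidean_space \<Rightarrow> real"
  assumes "continuous_on UNIV f" "compact K" "\<And>x. x \<notin> K \<Longrightarrow> f x = 0"
  obtains B where "\<And>x. \<bar>f x\<bar> \<le> B" "B \<ge> 0"
proof -
  have "bounded (f ` K)"
    using assms by (intro compact_imp_bounded compact_continuous_image) (auto intro: continuous_on_subset)
  then obtain B where "\<And>x. x \<in> K \<Longrightarrow> \<bar>f x\<bar> \<le> B" by (auto simp: bounded_iff)
  with assms(3) have "\<bar>f x\<bar> \<le> max B 0" for x by (cases "x \<in> K") (auto simp: le_max_iff_disj)
  then show ?thesis by (intro that[of "max B 0"]) auto
qed

lemma compact_support_integrable:
  fixes f :: "'a::euclidean_space \<Rightarrow> real"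
  assumes "continuous_on UNIV f" "compact K" "\<And>x. x \<notin> K \<Longrightarrow> f x = 0"
  shows "integrable lborel f"
proof -
  have "integrable lborel (\<lambda>x. indicator K x *\<^sub>R f x)"
    by (rule borel_integrable_compact[OF assms(2)]) (rule continuous_on_subset[OF assms(1)], simp)
  also have "(\<lambda>x. indicator K x *\<^sub>R f x) = f" using assms(3) by (auto simp: indicator_def fun_eq_iff)
  finally show ?thesis .
qed

lemma radial_integrable: "d > 0 \<Longrightarrow> integrable lborel (radial p d)"
  by (rule compact_support_integrable[OF radial_cont compact_cball[of 0 d]]) (auto intro: radial_eq_0)

text \<open>Both the averaging kernel \<open>moll d\<close> and \<open>bump d\<close> are radial, and the former is a multiple of the
  derivative of the profile of the latter; this is what relates their derivatives in \<open>d\<close> and in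
  the space variable.\<close>

abbreviation bump :: "real \<Rightarrow> 'a::euclidean_space \<Rightarrow> real" where
  "bump \<equiv> radial 1"

abbreviation profile :: "real \<Rightarrow> 'a::euclidean_space \<Rightarrow> real" where
  "profile \<equiv> radial (flat_deriv 1)"

definition mass :: "'a::euclidean_space itself \<Rightarrow> real" where
  "mass _ = (LINT w|lborel. profile 1 (w :: 'a))"

definition moll :: "real \<Rightarrow> 'a::euclidean_space \<Rightarrow> real" where
  "moll d w = profile d w / (mass TYPE('a) * d ^ DIM('a))"

lemma profile_nonneg: "profile d w \<ge> 0"
  by (simp add: radial_def flat_def flat_deriv_def pderiv_1)

lemma profile_pos: "d > 0 \<Longrightarrow> norm w < d \<Longrightarrow> profile d w > 0"
  by (auto simp: radial_def flat_def flat_deriv_def pderiv_1 dot_square_norm divide_le_eq not_le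
      power_strict_mono)

text \<open>In the variable \<open>s\<close> of the family the profile is
  \<open>s\<^sup>2 exp (- s)\<close>, positive on the open unit ball; a zero integral would make
  that ball a null set.\<close>

lemma mass_pos: "mass TYPE('a::euclidean_space) > 0"
proof -
  have "mass TYPE('a) \<noteq> 0"
  proof
    assume "mass TYPE('a) = 0"
    then have "AE w in lborel. profile 1 (w :: 'a) = 0"
      unfolding mass_def
      by (subst (asm) integral_nonneg_eq_0_iff_AE) (auto simp: profile_nonneg radial_integrable)
    then have "AE w in lborel. (w :: 'a) \<notin> ball 0 1"
      by eventually_elim (use profile_pos[of 1] in force)
    then have "ball 0 1 \<in> null_sets (lborel :: 'a measure)"
      by (subst (asm) AE_iff_null_sets[symmetric]) auto
    then have "negligible (ball (0::'a) 1)"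
      using negligible_iff_null_sets null_sets_completionI by blast
    then show False by (simp add: open_not_negligible)
  qed
  moreover have "mass TYPE('a) \<ge> 0"
    unfolding mass_def by (simp add: profile_nonneg integral_nonneg_AE)
  ultimately show ?thesis by simp
qed

lemma lborel_integral_scale:
  fixes f :: "'a::euclidean_space \<Rightarrow> real"
  assumes "d > 0" and [measurable]: "f \<in> borel_measurable borel"
  shows "(LINT x|lborel. f x) = d ^ DIM('a) * (LINT x|lborel. f (d *\<^sub>R x))"
proof -
  have T: "(\<lambda>x :: 'a. 0 + (\<Sum>j\<in>Basis. (d * (x \<bullet> j)) *\<^sub>R j)) = (\<lambda>x. d *\<^sub>R x)"
    by (simp add: fun_eq_iff euclidean_representation scaleR_sum_right[symmetric] flip: scaleR_scaleR)
  have "lborel = density (distr lborel borel (\<lambda>x :: 'a. d *\<^sub>R x)) (\<lambda>_. ennreal (d ^ DIM('a)))"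
    using lborel_affine_euclidean[of "\<lambda>_ :: 'a. d" 0, unfolded T] assms(1)
    by (simp add: prod_constant)
  then have "(LINT x|lborel. f x) =
      (LINT x|density (distr lborel borel (\<lambda>x :: 'a. d *\<^sub>R x)) (\<lambda>_. ennreal (d ^ DIM('a))). f x)"
    by simp
  also have "\<dots> = d ^ DIM('a) * (LINT x|lborel. f (d *\<^sub>R x))"
    using assms(1) by (subst integral_density) (auto simp: integral_distr)
  finally show ?thesis .
qed

lemma moll_integral: "d > 0 \<Longrightarrow> (LINT w|lborel. moll d (w :: 'a::euclidean_space)) = 1"
  using lborel_integral_scale[of d "profile d :: 'a \<Rightarrow> real"] mass_pos[where 'a = 'a]
  by (simp add: moll_def radial_scale mass_def)

lemma moll_nonneg: "d > 0 \<Longrightarrow> moll d (w :: 'a::euclidean_space) \<ge> 0"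
  using mass_pos[where 'a = 'a] by (simp add: moll_def profile_nonneg)

lemma moll_pos: "d > 0 \<Longrightarrow> norm w < d \<Longrightarrow> moll d (w :: 'a::euclidean_space) > 0"
  using mass_pos[where 'a = 'a] by (simp add: moll_def profile_pos)

lemma moll_eq_0: "d > 0 \<Longrightarrow> norm w \<ge> d \<Longrightarrow> moll d (w :: 'a::euclidean_space) = 0"
  by (simp add: moll_def radial_eq_0)

lemma moll_sym: "moll d (- w) = moll d w"
  by (simp add: moll_def radial_sym)

lemma moll_measurable [measurable]: "moll d \<in> borel_measurable borel"
  unfolding moll_def[abs_def] by measurable

lemma moll_smooth: "smooth_on UNIV (moll d :: 'a::euclidean_space \<Rightarrow> real)"
  unfolding moll_def[abs_def] divide_inverse
  by (intro smooth_on_mult smooth_radial) auto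

lemma moll_integrable: "d > 0 \<Longrightarrow> integrable lborel (moll d :: 'a::euclidean_space \<Rightarrow> real)"
  unfolding moll_def[abs_def] by (simp add: radial_integrable)

section \<open>Test functions\<close>

lemma test_functionI:
  assumes "smooth_on UNIV f" "compact K" "K \<subseteq> S" "\<And>x. x \<notin> K \<Longrightarrow> f x = 0"
  shows "test_function S f"
proof -
  have "closure {x. f x \<noteq> 0} \<subseteq> K"
    using assms(4) compact_imp_closed[OF assms(2)] by (intro closure_minimal) auto
  moreover from this have "compact (closure {x. f x \<noteq> 0})"
    by (meson assms(2) bounded_subset closed_closure compact_eq_bounded_closed)
  ultimately show ?thesis using assms by (auto simp: test_function_def)
qed

lemma test_functionE:
  assumes "test_function S f"
  obtains K where "compact K" "K \<subseteq> S" "\<And>x. x \<notin> K \<Longrightarrow> f x = 0"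
    "\<And>x v. x \<notin> K \<Longrightarrow> frechet_derivative f (at x) v = 0"
proof
  let ?K = "closure {x. f x \<noteq> 0}"
  show "compact ?K" "?K \<subseteq> S" using assms by (auto simp: test_function_def)
  show z: "f x = 0" if "x \<notin> ?K" for x
    using that subsetD[OF closure_subset, of x "{x. f x \<noteq> 0}"] by blast
  fix x v assume x: "x \<notin> ?K"
  have "((\<lambda>x. 0) has_derivative (\<lambda>v. 0)) (at x)" by simp
  moreover have "open (- ?K)" by (simp add: open_Compl)
  moreover have "x \<in> - ?K" using x by blast
  moreover have "0 = f y" if "y \<in> - ?K" for y using z[of y] that by simp
  ultimately have "(f has_derivative (\<lambda>v. 0)) (at x)"
    by (rule has_derivative_transform_within_open)
  then show "frechet_derivative f (at x) v = 0" using frechet_derivative_at by metis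
qed

lemma test_function_has_derivative:
  "test_function S f \<Longrightarrow> (f has_derivative frechet_derivative f (at x)) (at x)"
  unfolding test_function_def by (auto intro: smooth_on_has_derivative)

lemma test_function_smooth: "test_function S f \<Longrightarrow> smooth_on UNIV f"
  by (simp add: test_function_def)

lemma test_function_continuous: "test_function S f \<Longrightarrow> continuous_on UNIV f"
  by (simp add: test_function_def smooth_on_continuous)

lemma test_function_measurable: "test_function S f \<Longrightarrow> f \<in> borel_measurable borel"
  by (rule borel_measurable_continuous_onI[OF test_function_continuous])

lemma test_function_derivative:
  assumes "test_function S f"
  shows "test_function S (\<lambda>x. frechet_derivative f (at x) v)"
  by (rule test_functionE[OF assms])
    (rule test_functionI[OF smooth_on_derivative[OF test_function_smooth[OF assms]]])

lemma test_function_bounded: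
  assumes "test_function S f"
  obtains B where "\<And>x. \<bar>f x\<bar> \<le> B" "B \<ge> 0"
  by (rule test_functionE[OF assms])
    (rule compact_support_bounded[OF test_function_continuous[OF assms]], auto intro: that)

lemma test_function_derivative_bounded:
  assumes "test_function S f"
  obtains C where "\<And>x v. \<bar>frechet_derivative f (at x) v\<bar> \<le> C * norm v"
proof -
  have "\<exists>B. \<forall>x. \<bar>frechet_derivative f (at x) b\<bar> \<le> B" for b
    using test_function_bounded[OF test_function_derivative[OF assms]] by metis
  then obtain B where B: "\<And>x b. \<bar>frechet_derivative f (at x) b\<bar> \<le> B b" by metis
  have "\<bar>frechet_derivative f (at x) v\<bar> \<le> (\<Sum>b\<in>Basis. B b) * norm v" for x v
  proof -
    have lin: "linear (frechet_derivative f (at x))"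
      using test_function_has_derivative[OF assms] has_derivative_linear by blast
    have "frechet_derivative f (at x) v = (\<Sum>b\<in>Basis. (v \<bullet> b) * frechet_derivative f (at x) b)"
      by (subst euclidean_representation[of v, symmetric])
        (simp add: linear_sum[OF lin] linear_scale[OF lin] del: euclidean_representation)
    also have "\<bar>\<dots>\<bar> \<le> (\<Sum>b\<in>Basis. norm v * B b)"
      by (rule sum_abs[THEN order_trans])
        (auto intro!: sum_mono mult_mono B Basis_le_norm simp: abs_mult)
    finally show ?thesis by (simp add: sum_distrib_left mult.commute)
  qed
  then show ?thesis by (rule that)
qed

lemma test_function_subset: "test_function S f \<Longrightarrow> S \<subseteq> T \<Longrightarrow> test_function T f"
  by (auto simp: test_function_def)

lemma smooth_on_reflect:
  fixes f :: "'a::euclidean_space \<Rightarrow> real"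
  assumes "smooth_on UNIV f"
  shows "smooth_on UNIV (\<lambda>y. f (x - y))"
proof (rule smooth_on_compose_inverse[where g = "\<lambda>y. x - y" and Q = "\<lambda>y v. - v" and W = UNIV])
  show "((-) x has_derivative uminus) (at z)" for z
    by (auto intro!: derivative_eq_intros)
qed (use assms in auto)

lemma test_function_reflect:
  assumes "test_function UNIV f" "\<And>w. norm w > d \<Longrightarrow> f w = 0" "cball x d \<subseteq> S"
  shows "test_function S (\<lambda>y. f (x - y))"
  by (rule test_functionI[OF smooth_on_reflect[OF test_function_smooth[OF assms(1)]] compact_cball assms(3)])
    (auto simp: dist_norm intro: assms(2))

lemma frechet_derivative_reflect:
  assumes "test_function S f"
  shows "frechet_derivative (\<lambda>y. f (x - y)) (at y) v = - frechet_derivative f (at (x - y)) v"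
proof -
  have "((\<lambda>y. x - y) has_derivative (\<lambda>v. - v)) (at y)" by (auto intro!: derivative_eq_intros)
  from has_derivative_compose[OF this test_function_has_derivative[OF assms]]
  have "((\<lambda>y. f (x - y)) has_derivative (\<lambda>v. frechet_derivative f (at (x - y)) (- v))) (at y)" .
  moreover have "linear (frechet_derivative f (at (x - y)))"
    using test_function_has_derivative[OF assms] has_derivative_linear by blast
  ultimately show ?thesis using linear_neg frechet_derivative_at by metis
qed

lemma test_function_radial: "d > 0 \<Longrightarrow> test_function UNIV (radial p d)"
  by (rule test_functionI[OF smooth_radial compact_cball[of 0 d]]) (auto intro: radial_eq_0)

lemma test_function_moll: "d > 0 \<Longrightarrow> test_function UNIV (moll d)"
  by (rule test_functionI[OF moll_smooth compact_cball[of 0 d]]) (auto intro: moll_eq_0)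

section \<open>Convolution with test functions\<close>

definition conv :: "('a::euclidean_space \<Rightarrow> 'b::{banach, second_countable_topology}) \<Rightarrow> ('a \<Rightarrow> real) \<Rightarrow> 'a \<Rightarrow> 'b"
  where "conv f \<zeta> x = (LINT y|lborel. \<zeta> (x - y) *\<^sub>R f y)"

text \<open>The derivative falls on the test function, so integrability is the only demand on
  \<open>f\<close>.\<close>

lemma conv_has_derivative:
  assumes f: "integrable lborel f" and \<zeta>: "test_function S \<zeta>"
  shows "(conv f \<zeta> has_derivative (\<lambda>v. conv f (\<lambda>z. frechet_derivative \<zeta> (at z) v) x)) (at x)"
proof -
  obtain B where B: "\<And>x. \<bar>\<zeta> x\<bar> \<le> B" by (rule test_function_bounded[OF \<zeta>]) blast
  obtain C where C: "\<And>x v. \<bar>frechet_derivative \<zeta> (at x) v\<bar> \<le> C * norm v"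
    by (rule test_function_derivative_bounded[OF \<zeta>]) blast
  have [measurable]: "\<zeta> \<in> borel_measurable borel"
      "(\<lambda>z. frechet_derivative \<zeta> (at z) v) \<in> borel_measurable borel" for v
    using test_function_measurable \<zeta> test_function_derivative by blast+
  show ?thesis
    unfolding conv_def[abs_def]
  proof (rule has_derivative_lebesgue_integral[OF f zero_less_one])
    show "((\<lambda>t. \<zeta> (t - y)) has_derivative frechet_derivative \<zeta> (at (t - y))) (at t)" for t y
    proof -
      have "((\<lambda>t. t - y) has_derivative (\<lambda>v. v)) (at t)" by (auto intro!: derivative_eq_intros)
      from has_derivative_compose[OF this test_function_has_derivative[OF \<zeta>]] show ?thesis .
    qed
    show "\<bar>\<zeta> (t - y)\<bar> \<le> B" for t y by (rule B)
    show "\<bar>frechet_derivative \<zeta> (at (t - y)) v\<bar> \<le> C * norm v" for t y v by (rule C)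
  qed measurable
qed

lemma conv_smooth:
  assumes f: "integrable lborel f" and "test_function UNIV \<zeta>"
  shows "smooth_on UNIV (conv f \<zeta>)"
proof (rule smooth_on_coinduct[of UNIV "\<lambda>h. \<exists>\<zeta>. test_function UNIV \<zeta> \<and> h = conv f \<zeta>"])
  fix h assume "\<exists>\<zeta>. test_function UNIV \<zeta> \<and> h = conv f \<zeta>"
  then obtain \<zeta> where \<zeta>: "test_function UNIV \<zeta>" "h = conv f \<zeta>" by blast
  show "\<exists>f'. (\<forall>x\<in>UNIV. (h has_derivative f' x) (at x)) \<and>
      (\<forall>v. \<exists>\<zeta>. test_function UNIV \<zeta> \<and> (\<lambda>x. f' x v) = conv f \<zeta>)"
  proof (intro exI[of _ "\<lambda>x v. conv f (\<lambda>z. frechet_derivative \<zeta> (at z) v) x"] conjI ballI allI)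
    show "(h has_derivative (\<lambda>v. conv f (\<lambda>z. frechet_derivative \<zeta> (at z) v) x)) (at x)" for x
      unfolding \<zeta>(2) by (rule conv_has_derivative[OF f \<zeta>(1)])
    show "\<exists>\<xi>. test_function UNIV \<xi> \<and>
        (\<lambda>x. conv f (\<lambda>z. frechet_derivative \<zeta> (at z) v) x) = conv f \<xi>" for v
      using test_function_derivative[OF \<zeta>(1)] by (intro exI conjI) auto
  qed
qed (use assms in auto)

lemma lborel_integral_translation:
  fixes f :: "'a::euclidean_space \<Rightarrow> 'b::{banach, second_countable_topology}"
  assumes [measurable]: "f \<in> borel_measurable borel"
  shows "(LINT x|lborel. f (c + x)) = (LINT x|lborel. f x)"
proof -
  have "(LINT x|lborel. f x) = (LINT x|distr lborel borel ((+) c). f x)"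
    by (simp add: lborel_distr_plus)
  also have "\<dots> = (LINT x|lborel. f (c + x))" by (rule integral_distr) measurable
  finally show ?thesis ..
qed

lemma lborel_nn_integral_translation:
  fixes f :: "'a::euclidean_space \<Rightarrow> ennreal"
  assumes [measurable]: "f \<in> borel_measurable borel"
  shows "(\<integral>\<^sup>+x. f (c + x) \<partial>lborel) = (\<integral>\<^sup>+x. f x \<partial>lborel)"
proof -
  have "(\<integral>\<^sup>+x. f x \<partial>lborel) = (\<integral>\<^sup>+x. f x \<partial>distr lborel borel ((+) c))"
    by (simp add: lborel_distr_plus)
  also have "\<dots> = (\<integral>\<^sup>+x. f (c + x) \<partial>lborel)" by (rule nn_integral_distr) measurable
  finally show ?thesis ..
qed

text \<open>By translation invariance the integral of \<open>p (y + t *\<^sub>R b)\<close> does not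
  depend on \<open>t\<close>; differentiating it under the integral at \<open>t = 0\<close> gives
  the result. The integrable factor needed there is the indicator of a large ball.\<close>

lemma integral_derivative_eq_0:
  fixes p :: "'a::euclidean_space \<Rightarrow> real"
  assumes p: "\<And>x. (p has_derivative p' x) (at x)"
    and cont: "continuous_on UNIV (\<lambda>x. p' x b)"
    and K: "compact K" "\<And>x. x \<notin> K \<Longrightarrow> p x = 0" "\<And>x. x \<notin> K \<Longrightarrow> p' x b = 0"
  shows "(LINT x|lborel. p' x b) = 0"
proof -
  have pc: "continuous_on UNIV p"
    using has_derivative_continuous[OF p] by (simp add: continuous_at_imp_continuous_on)
  have [measurable]: "p \<in> borel_measurable borel" "(\<lambda>x. p' x b) \<in> borel_measurable borel"
    using pc cont by (auto intro: borel_measurable_continuous_onI)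
  obtain C where C: "\<And>x. \<bar>p' x b\<bar> \<le> C" using compact_support_bounded[OF cont K(1,3)] by blast
  obtain B where B: "\<And>x. \<bar>p x\<bar> \<le> B" using compact_support_bounded[OF pc K(1,2)] by blast
  obtain R where R: "\<And>x. x \<in> K \<Longrightarrow> norm x \<le> R"
    using compact_imp_bounded[OF K(1)] by (auto simp: bounded_iff)
  \<comment> \<open>For \<open>\<bar>t\<bar> < 1\<close> the support of the translate by
    \<open>t *\<^sub>R b\<close> stays inside this ball, so the indicator changes no
    integral.\<close>
  define S where "S = cball (0 :: 'a) (R + norm b)"
  have lin: "linear (p' x)" for x using p has_derivative_linear by blast
  have "((\<lambda>t :: real. LINT y|lborel. p (y + t *\<^sub>R b) *\<^sub>R (indicator S y :: real)) has_derivative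
      (\<lambda>s. LINT y|lborel. p' (y + 0 *\<^sub>R b) (s *\<^sub>R b) *\<^sub>R (indicator S y :: real))) (at 0)"
  proof (rule has_derivative_lebesgue_integral[of _ _ 1])
    show "integrable lborel (indicator S :: 'a \<Rightarrow> real)"
      using emeasure_lborel_cball_finite[of "0::'a" "R + norm b"]
      by (intro integrable_real_indicator) (auto simp: S_def)
    show "((\<lambda>t. p (y + t *\<^sub>R b)) has_derivative (\<lambda>s. p' (y + t *\<^sub>R b) (s *\<^sub>R b))) (at t)" for y t
    proof -
      have "((\<lambda>t. y + t *\<^sub>R b) has_derivative (\<lambda>s. s *\<^sub>R b)) (at t)"
        by (auto intro!: derivative_eq_intros)
      from has_derivative_compose[OF this p] show ?thesis .
    qed
    show "\<bar>p (y + t *\<^sub>R b)\<bar> \<le> B" for y t by (rule B)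
    show "\<bar>p' (y + t *\<^sub>R b) (s *\<^sub>R b)\<bar> \<le> C * norm s" for y t s
      using C[of "y + t *\<^sub>R b"]
      by (simp add: linear_scale[OF lin] abs_mult mult.commute[of _ "\<bar>s\<bar>"] mult_left_mono)
    show "(\<lambda>y. p' (y + 0 *\<^sub>R b) (s *\<^sub>R b)) \<in> borel_measurable lborel" for s
      by (simp add: linear_scale[OF lin])
  qed auto
  moreover have "open {-1<..<1 :: real}" "(0 :: real) \<in> {-1<..<1}" by auto
  moreover have "(LINT y|lborel. p (y + t *\<^sub>R b) *\<^sub>R (indicator S y :: real)) = (LINT y|lborel. p y)"
    if "t \<in> {-1<..<1}" for t
  proof -
    have "p (y + t *\<^sub>R b) *\<^sub>R (indicator S y :: real) = p (t *\<^sub>R b + y)" for y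
    proof (cases "y \<in> S")
      case False
      have "norm (t *\<^sub>R b) \<le> norm b" using that mult_right_mono[of "\<bar>t\<bar>" 1 "norm b"] by auto
      then have "norm (y + t *\<^sub>R b) > R"
        using False norm_triangle_ineq4[of "y + t *\<^sub>R b" "t *\<^sub>R b"] by (simp add: S_def)
      then have "p (y + t *\<^sub>R b) = 0" using R K(2) by (meson not_le)
      then show ?thesis by (simp add: add.commute)
    qed (simp add: add.commute)
    then show ?thesis by (simp add: lborel_integral_translation)
  qed
  ultimately have "((\<lambda>t :: real. LINT y|lborel. p y) has_derivative
      (\<lambda>s. LINT y|lborel. p' (y + 0 *\<^sub>R b) (s *\<^sub>R b) *\<^sub>R (indicator S y :: real))) (at 0)"
    by (rule has_derivative_transform_within_open)
  from fun_cong[OF has_derivative_unique[OF this has_derivative_const[of "LINT y|lborel. p y"]], of 1]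
  have "(LINT y|lborel. p' y b *\<^sub>R (indicator S y :: real)) = 0"
    by simp
  moreover have "p' y b = 0" if "y \<notin> S" for y
    using that R[of y] norm_ge_zero[of b] by (intro K(3)) (auto simp: S_def)
  then have "(LINT y|lborel. p' y b *\<^sub>R (indicator S y :: real)) = (LINT y|lborel. p' y b)"
    by (intro Bochner_Integration.integral_cong) (auto simp: indicator_def)
  ultimately show ?thesis by simp
qed

text \<open>\<open>g\<close> is controlled on \<open>S\<close> only, but its product with
  \<open>z\<close> vanishes off the support of \<open>z\<close> and is therefore differentiable on
  the whole space; the integral of its derivative is 0.\<close>

lemma integral_by_parts:
  fixes g z :: "'a::euclidean_space \<Rightarrow> real"
  assumes "open S" "test_function S z"
    and g: "\<And>x. x \<in> S \<Longrightarrow> (g has_derivative g' x) (at x)" and g': "continuous_on S (\<lambda>x. g' x b)"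
  shows "integrable lborel (\<lambda>x. g x * frechet_derivative z (at x) b)" (is "integrable _ ?u")
    "integrable lborel (\<lambda>x. g' x b * z x)" (is "integrable _ ?v")
    "(LINT x|lborel. g x * frechet_derivative z (at x) b) = - (LINT x|lborel. g' x b * z x)"
proof -
  obtain K where K: "compact K" "K \<subseteq> S" "\<And>x. x \<notin> K \<Longrightarrow> z x = 0"
    "\<And>x v. x \<notin> K \<Longrightarrow> frechet_derivative z (at x) v = 0"
    by (rule test_functionE[OF assms(2)]) blast
  have cov: "S \<union> - K = UNIV" using K(2) by blast
  have op: "open (- K)" using K(1) by (simp add: compact_imp_closed open_Compl)
  have cont: "continuous_on UNIV (\<lambda>x. u x * w x)"
    if "continuous_on S u" "continuous_on UNIV w" "\<And>x. x \<notin> K \<Longrightarrow> w x = 0" for u w :: "'a \<Rightarrow> real"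
  proof -
    have "continuous_on S (\<lambda>x. u x * w x)"
      using that by (intro continuous_intros) (auto intro: continuous_on_subset)
    moreover have "continuous_on (- K) (\<lambda>x. u x * w x)"
      using that(3) by (subst continuous_on_cong[OF refl, of _ _ "\<lambda>_. 0"]) auto
    ultimately show ?thesis
      using continuous_on_open_Un[OF assms(1) op] cov by metis
  qed
  have gc: "continuous_on S g"
    using has_derivative_continuous[OF g] by (simp add: continuous_at_imp_continuous_on)
  note zc = test_function_continuous[OF assms(2)]
    test_function_continuous[OF test_function_derivative[OF assms(2)]]
  have cu: "continuous_on UNIV ?u" by (rule cont[OF gc zc(2) K(4)])
  have cv: "continuous_on UNIV ?v" by (rule cont[OF g' zc(1) K(3)])
  show iu: "integrable lborel ?u" by (rule compact_support_integrable[OF cu K(1)]) (simp add: K)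
  show iv: "integrable lborel ?v" by (rule compact_support_integrable[OF cv K(1)]) (simp add: K)
  define p' where "p' x v = (if x \<in> K then g x * frechet_derivative z (at x) v + g' x v * z x else 0)" for x v
  have p'b: "p' x b = ?u x + ?v x" for x by (simp add: p'_def K)
  have "(LINT x|lborel. p' x b) = 0"
  proof (rule integral_derivative_eq_0[of "\<lambda>x. g x * z x", OF _ _ K(1)])
    show "((\<lambda>x. g x * z x) has_derivative p' x) (at x)" for x
    proof (cases "x \<in> K")
      case True
      then have "x \<in> S" using K(2) by blast
      from has_derivative_mult[OF g[OF this] test_function_has_derivative[OF assms(2)]] True
      show ?thesis by (simp add: p'_def[abs_def])
    next
      case False
      have "((\<lambda>x. 0) has_derivative (\<lambda>v. 0)) (at x)" by simp
      moreover note op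
      moreover have "x \<in> - K" using False by simp
      moreover have "0 = g y * z y" if "y \<in> - K" for y using K(3)[of y] that by simp
      ultimately have "((\<lambda>x. g x * z x) has_derivative (\<lambda>v. 0)) (at x)"
        by (rule has_derivative_transform_within_open)
      then show ?thesis using False by (simp add: p'_def[abs_def])
    qed
    show "continuous_on UNIV (\<lambda>x. p' x b)"
      unfolding p'b by (rule continuous_on_add[OF cu cv])
  qed (auto simp: p'_def K)
  then show "(LINT x|lborel. ?u x) = - (LINT x|lborel. ?v x)"
    unfolding p'b using iu iv by simp
qed

section \<open>Convergence of mollifications\<close>

lemma conv_integrable:
  fixes f :: "'a::euclidean_space \<Rightarrow> 'b::{banach, second_countable_topology}"
  assumes f: "integrable lborel f" and \<zeta>: "test_function UNIV \<zeta>"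
  shows "integrable lborel (\<lambda>y. \<zeta> (x - y) *\<^sub>R f y)"
proof -
  obtain B where B: "\<And>x. \<bar>\<zeta> x\<bar> \<le> B" "B \<ge> 0" by (rule test_function_bounded[OF \<zeta>]) blast
  have [measurable]: "\<zeta> \<in> borel_measurable borel" "f \<in> borel_measurable borel"
    using test_function_measurable[OF \<zeta>] f by auto
  show ?thesis
  proof (rule Bochner_Integration.integrable_bound[of _ "\<lambda>y. B *\<^sub>R norm (f y)"])
    show "AE y in lborel. norm (\<zeta> (x - y) *\<^sub>R f y) \<le> norm (B *\<^sub>R norm (f y))"
      using B by (auto intro!: AE_I2 mult_right_mono simp: abs_mult)
  qed (use f in auto)
qed

lemma moll_translate_integral:
  assumes "d > 0"
  shows "integrable lborel (\<lambda>y. moll d (x - y))" "(LINT y|lborel. moll d (x - y :: 'a::euclidean_space)) = 1"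
    "(\<integral>\<^sup>+ y. ennreal (moll d (y - x :: 'a)) \<partial>lborel) = 1"
proof -
  have s: "moll d (x - y) = moll d (- x + y)" for y using moll_sym[of d "x - y"] by simp
  have "(\<integral>\<^sup>+ y. ennreal (moll d (- x + y)) \<partial>lborel) = (\<integral>\<^sup>+ y. ennreal (moll d (y :: 'a)) \<partial>lborel)"
    by (rule lborel_nn_integral_translation) measurable
  also have "\<dots> = ennreal 1"
    using moll_integral[OF assms, where 'a = 'a] moll_integrable[OF assms, where 'a = 'a]
    by (simp add: nn_integral_eq_integral moll_nonneg[OF assms])
  finally have nn: "(\<integral>\<^sup>+ y. ennreal (moll d (- x + y)) \<partial>lborel) = ennreal 1" .
  then show "(\<integral>\<^sup>+ y. ennreal (moll d (y - x)) \<partial>lborel) = 1" by simp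
  have "has_bochner_integral lborel (\<lambda>y. moll d (- x + y)) 1"
    by (rule has_bochner_integral_nn_integral[OF _ _ _ nn]) (auto simp: moll_nonneg[OF assms])
  then show "integrable lborel (\<lambda>y. moll d (x - y))" "(LINT y|lborel. moll d (x - y)) = 1"
    unfolding s by (auto simp: has_bochner_integral_iff)
qed

text \<open>Young's inequality for a kernel of mass 1: by Tonelli the kernel is integrated first
  over \<open>x\<close>, with the value 1.\<close>

lemma conv_moll_norm:
  fixes f :: "'a::euclidean_space \<Rightarrow> 'b::{banach, second_countable_topology}"
  assumes f: "integrable lborel f" and d: "d > 0"
  shows "integrable lborel (conv f (moll d))"
    "(LINT x|lborel. norm (conv f (moll d) x)) \<le> (LINT x|lborel. norm (f x))"
proof -
  have [measurable]: "f \<in> borel_measurable borel" using f by simp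
  have [measurable]: "conv f (moll d) \<in> borel_measurable borel"
    by (rule borel_measurable_continuous_onI[OF smooth_on_continuous[OF conv_smooth[OF f test_function_moll[OF d]]]])
  have "(\<integral>\<^sup>+x. norm (conv f (moll d) x) \<partial>lborel) \<le>
      (\<integral>\<^sup>+x. (\<integral>\<^sup>+y. ennreal (moll d (x - y)) * ennreal (norm (f y)) \<partial>lborel) \<partial>lborel)"
  proof (rule nn_integral_mono)
    fix x
    have "norm (conv f (moll d) x) \<le> (\<integral>\<^sup>+y. norm (moll d (x - y) *\<^sub>R f y) \<partial>lborel)"
      unfolding conv_def
      by (rule integral_norm_bound_ennreal[OF conv_integrable[OF f test_function_moll[OF d]]])
    then show "norm (conv f (moll d) x) \<le> (\<integral>\<^sup>+y. ennreal (moll d (x - y)) * ennreal (norm (f y)) \<partial>lborel)"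
      by (simp add: moll_nonneg[OF d] ennreal_mult)
  qed
  also have "\<dots> = (\<integral>\<^sup>+y. (\<integral>\<^sup>+x. ennreal (moll d (x - y)) * ennreal (norm (f y)) \<partial>lborel) \<partial>lborel)"
    by (rule lborel_pair.Fubini'[symmetric]) measurable
  also have "\<dots> = (\<integral>\<^sup>+y. ennreal (norm (f y)) \<partial>lborel)"
    by (simp add: nn_integral_multc moll_translate_integral(3)[OF d])
  also have "\<dots> = ennreal (LINT x|lborel. norm (f x))"
    using f by (simp add: nn_integral_eq_integral)
  finally have le: "(\<integral>\<^sup>+x. norm (conv f (moll d) x) \<partial>lborel) \<le> ennreal (LINT x|lborel. norm (f x))" .
  then show i: "integrable lborel (conv f (moll d))"
    by (intro integrableI_bounded) (auto simp: le_less_trans)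
  show "(LINT x|lborel. norm (conv f (moll d) x)) \<le> (LINT x|lborel. norm (f x))"
    using le i by (simp add: nn_integral_eq_integral)
qed

lemma conv_diff:
  assumes "integrable lborel f" "integrable lborel g" "test_function UNIV \<zeta>"
  shows "conv (\<lambda>y. f y - g y) \<zeta> x = conv f \<zeta> x - conv g \<zeta> x"
  using assms by (simp add: conv_def scaleR_diff_right conv_integrable)

text \<open>Induction along the construction of integrable functions. A measurable set is squeezed
  between a closed and an open set, and Urysohn's function for the two differs from the indicator on
  a set of small measure only.\<close>

lemma integrable_continuous_approx:
  fixes f :: "'a::euclidean_space \<Rightarrow> 'b::{banach, second_countable_topology}"
  assumes "integrable lborel f" "e > 0"
  shows "\<exists>g. continuous_on UNIV g \<and> integrable lborel g \<and> (LINT x|lborel. norm (f x - g x)) < e"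
  using assms
proof (induction arbitrary: e)
  case (base A c)
  have A: "A \<in> sets lebesgue" using base by simp
  \<comment> \<open>The outer and the inner approximation each lose \<open>e'\<close>, whence the
    factor 2; the summand 1 covers \<open>c = 0\<close>.\<close>
  define e' where "e' = e / (2 * (norm c + 1))"
  have e': "e' > 0" "2 * e' * norm c < e"
    using base by (auto simp: e'_def field_simps add_pos_nonneg)
  obtain V where V: "open V" "A \<subseteq> V" "V - A \<in> lmeasurable" "emeasure lebesgue (V - A) < ennreal e'"
    using sets_lebesgue_outer_open[OF A e'(1)] .
  obtain T where T: "closed T" "T \<subseteq> A" "A - T \<in> lmeasurable" "emeasure lebesgue (A - T) < ennreal e'"
    using sets_lebesgue_inner_closed[OF A e'(1)] .
  obtain h :: "'a \<Rightarrow> real" where h: "continuous_on UNIV h" "\<And>x. h x \<in> closed_segment 1 0"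
      "\<And>x. x \<in> T \<Longrightarrow> h x = 1" "\<And>x. x \<in> - V \<Longrightarrow> h x = 0"
    using Urysohn[of T "- V" 1 0] T(1,2) V(1,2) by (auto simp: closed_Compl)
  have h01: "0 \<le> h x" "h x \<le> 1" for x using h(2)[of x] by (auto simp: closed_segment_eq_real_ivl)
  have [measurable]: "h \<in> borel_measurable borel" by (rule borel_measurable_continuous_onI[OF h(1)])
  have VT [measurable]: "V \<in> sets borel" "T \<in> sets borel" "A \<in> sets borel" using V(1) T(1) base by auto
  have AT: "emeasure lborel (V - T) \<le> ennreal (2 * e')"
  proof -
    have "V - T = (V - A) \<union> (A - T)" using V T by blast
    then have "emeasure lborel (V - T) \<le> emeasure lborel (V - A) + emeasure lborel (A - T)"
      using VT by (metis emeasure_subadditive sets.Diff sets_lborel)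
    also have "\<dots> \<le> ennreal e' + ennreal e'"
      using V(4) T(4) VT by (intro add_mono) (auto simp: less_imp_le)
    also have "\<dots> = ennreal (2 * e')" using e' by (simp flip: ennreal_plus)
    finally show ?thesis .
  qed
  then have fin: "emeasure lborel (V - T) < \<infinity>" by (simp add: le_less_trans)
  have iVT: "integrable lborel (\<lambda>x. indicator (V - T) x * norm c)"
    using fin by (intro integrable_mult_left integrable_real_indicator) auto
  have bd: "norm (indicator A x *\<^sub>R c - h x *\<^sub>R c) \<le> indicator (V - T) x * norm c" for x
  proof -
    have "\<bar>indicator A x - h x\<bar> \<le> (indicator (V - T) x :: real)"
      using h01[of x] h(3,4)[of x] T(2) V(2) by (auto simp: indicator_def)
    then have "\<bar>indicator A x - h x\<bar> * norm c \<le> indicator (V - T) x * norm c"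
      by (rule mult_right_mono) simp
    then show ?thesis by (simp flip: scaleR_diff_left)
  qed
  have i: "integrable lborel (\<lambda>x. indicator A x *\<^sub>R c - h x *\<^sub>R c)"
    by (rule Bochner_Integration.integrable_bound[OF iVT])
      (use bd in \<open>auto intro!: AE_I2 order_trans[OF _ abs_ge_self]\<close>)
  have "integrable lborel (\<lambda>x. indicator A x *\<^sub>R c)"
    using base by (intro integrable_scaleR_left integrable_real_indicator) auto
  from Bochner_Integration.integrable_diff[OF this i] have "integrable lborel (\<lambda>x. h x *\<^sub>R c)" by simp
  moreover have "(LINT x|lborel. norm (indicator A x *\<^sub>R c - h x *\<^sub>R c)) \<le> (LINT x|lborel. indicator (V - T) x * norm c)"
    using i bd by (intro integral_mono iVT) auto
  moreover have "\<dots> = measure lborel (V - T) * norm c" by simp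
  moreover have "measure lborel (V - T) \<le> 2 * e'"
    using AT e' by (simp add: measure_def enn2real_leI)
  then have "measure lborel (V - T) * norm c \<le> 2 * e' * norm c" by (rule mult_right_mono) simp
  moreover have "continuous_on UNIV (\<lambda>x. h x *\<^sub>R c)" using h(1) by (intro continuous_intros)
  ultimately show ?case using e'(2) by (intro exI[of _ "\<lambda>x. h x *\<^sub>R c"]) auto
next
  case (add f g)
  obtain u where u: "continuous_on UNIV u" "integrable lborel u" "(LINT x|lborel. norm (f x - u x)) < e / 2"
    using add(3)[of "e / 2"] add.prems by auto
  obtain v where v: "continuous_on UNIV v" "integrable lborel v" "(LINT x|lborel. norm (g x - v x)) < e / 2"
    using add(4)[of "e / 2"] add.prems by auto
  have "(LINT x|lborel. norm (f x + g x - (u x + v x))) \<le>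
      (LINT x|lborel. norm (f x - u x) + norm (g x - v x))"
    using u v add(1,2) by (intro integral_mono) (auto simp: add_diff_add norm_triangle_ineq)
  also have "\<dots> = (LINT x|lborel. norm (f x - u x)) + (LINT x|lborel. norm (g x - v x))"
    using u v add(1,2) by (intro Bochner_Integration.integral_add) auto
  finally have "(LINT x|lborel. norm (f x + g x - (u x + v x))) < e" using u v by simp
  then show ?case using u v by (intro exI[of _ "\<lambda>x. u x + v x"]) (auto intro: continuous_intros)
next
  case (lim f s)
  have "(\<lambda>i. LINT x|lborel. norm (f x - s i x)) \<longlonglongrightarrow> (LINT x|(lborel :: 'a measure). (0 :: real))"
  proof (rule integral_dominated_convergence[where w = "\<lambda>x. 3 * norm (f x)"])
    show "AE x in lborel. (\<lambda>i. norm (f x - s i x)) \<longlonglongrightarrow> 0"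
    proof (rule AE_I2)
      fix x
      have "(\<lambda>i. norm (f x - s i x)) \<longlonglongrightarrow> norm (f x - f x)"
        using lim.hyps(2)[of x] by (intro tendsto_intros) auto
      then show "(\<lambda>i. norm (f x - s i x)) \<longlonglongrightarrow> 0" by simp
    qed
    show "AE x in lborel. norm (norm (f x - s i x)) \<le> 3 * norm (f x)" for i
    proof (rule AE_I2)
      fix x
      show "norm (norm (f x - s i x)) \<le> 3 * norm (f x)"
        using lim.hyps(3)[of x i] norm_triangle_ineq4[of "f x" "s i x"] by simp
    qed
  qed (use lim.hyps in auto)
  then have "\<forall>\<^sub>F i in sequentially. (LINT x|lborel. norm (f x - s i x)) < e / 2"
    using lim.prems by (intro order_tendstoD(2)) auto
  then obtain i where i: "(LINT x|lborel. norm (f x - s i x)) < e / 2"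
    by (auto simp: eventually_sequentially)
  obtain u where u: "continuous_on UNIV u" "integrable lborel u" "(LINT x|lborel. norm (s i x - u x)) < e / 2"
    using lim.IH[of "e / 2" i] lim.prems by auto
  have "(LINT x|lborel. norm (f x - u x)) \<le> (LINT x|lborel. norm (f x - s i x) + norm (s i x - u x))"
    using u lim.hyps(1,4) by (intro integral_mono) (auto intro: norm_diff_triangle_ineq norm_triangle_le_diff norm_diff_triangle_le)
  also have "\<dots> = (LINT x|lborel. norm (f x - s i x)) + (LINT x|lborel. norm (s i x - u x))"
    using u lim.hyps(1,4) by (intro Bochner_Integration.integral_add) auto
  finally show ?case using u i by (intro exI[of _ u]) auto
qed

text \<open>Convolution is a contraction in L1, which reduces the convergence to a continuous
  approximant \<open>g\<close>, whose mollifications converge uniformly on bounded sets.\<close>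

lemma conv_moll_tendsto_L1:
  fixes f :: "'a::euclidean_space \<Rightarrow> 'b::{banach, second_countable_topology}"
  assumes f: "integrable lborel f" and S: "bounded S" "S \<in> sets borel"
    and d: "\<And>k. d k > 0" "d \<longlonglongrightarrow> 0"
  shows "(\<lambda>k. LINT x|lborel. indicator S x * norm (conv f (moll (d k)) x - f x)) \<longlonglongrightarrow> 0"
proof (rule LIMSEQ_I)
  fix e :: real assume e: "e > 0"
  have [measurable]: "S \<in> sets borel" by fact
  obtain R where R: "R > 0" "S \<subseteq> ball 0 R" using S(1) bounded_subset_ballD by blast
  obtain g where g: "continuous_on UNIV g" "integrable lborel g" "(LINT x|lborel. norm (f x - g x)) < e / 3"
    using integrable_continuous_approx[OF f, of "e / 3"] e by auto
  define m where "m = measure lborel (ball (0::'a) R)"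
  define e' where "e' = e / (3 * (m + 1))"
  have m: "m \<ge> 0" by (simp add: m_def)
  then have e': "e' > 0" "e' * m < e / 3" using e by (auto simp: e'_def field_simps)
  \<comment> \<open>As soon as \<open>d k < 1\<close>, the kernel around a point of \<open>S\<close>
    reaches at most to radius \<open>R + 1\<close>.\<close>
  have "uniformly_continuous_on (cball 0 (R + 1)) g"
    using g(1) by (intro compact_uniformly_continuous) (auto intro: continuous_on_subset)
  then obtain t where t: "t > 0" "\<And>x y. x \<in> cball 0 (R + 1) \<Longrightarrow> y \<in> cball 0 (R + 1) \<Longrightarrow> dist y x < t \<Longrightarrow> dist (g y) (g x) < e'"
    using e'(1) by (auto simp: uniformly_continuous_on_def)
  have gS: "norm (conv g (moll (d k)) x - g x) \<le> e'" if k: "d k < min t 1" and x: "x \<in> S" for k x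
  proof -
    note mi = moll_translate_integral[OF d(1), of k x]
    note ci = conv_integrable[OF g(2) test_function_moll[OF d(1)], of k x]
    have mi': "integrable lborel (\<lambda>y. moll (d k) (x - y) *\<^sub>R g x)" using mi by simp
    have "conv g (moll (d k)) x - g x = (LINT y|lborel. moll (d k) (x - y) *\<^sub>R g y) - (LINT y|lborel. moll (d k) (x - y) *\<^sub>R g x)"
      using mi by (simp add: conv_def)
    also have "\<dots> = (LINT y|lborel. moll (d k) (x - y) *\<^sub>R (g y - g x))"
      using ci mi' by (simp add: scaleR_diff_right)
    also have "norm \<dots> \<le> (LINT y|lborel. norm (moll (d k) (x - y) *\<^sub>R (g y - g x)))"
      by (rule integral_norm_bound)
    also have "\<dots> \<le> (LINT y|lborel. moll (d k) (x - y) * e')"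
    proof (rule integral_mono)
      show "integrable lborel (\<lambda>y. norm (moll (d k) (x - y) *\<^sub>R (g y - g x)))"
        using ci mi' by (intro integrable_norm) (simp add: scaleR_diff_right)
      show "norm (moll (d k) (x - y) *\<^sub>R (g y - g x)) \<le> moll (d k) (x - y) * e'" for y
      proof (cases "norm (x - y) < d k")
        case True
        have "norm x < R" using R x by auto
        moreover have "norm y \<le> norm x + norm (x - y)" using norm_triangle_ineq4[of x "x - y"] by simp
        ultimately have "dist (g y) (g x) < e'"
          using True k by (intro t(2)) (auto simp: dist_norm norm_minus_commute)
        then show ?thesis
          using moll_nonneg[OF d(1), of k "x - y"] by (simp add: dist_norm mult_left_mono)
      next
        case False
        then show ?thesis using moll_eq_0[OF d(1), of k "x - y"] by simp
      qed
    qed (use mi in auto)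
    also have "\<dots> = e'" using mi by simp
    finally show ?thesis .
  qed
  have "(LINT x|lborel. indicator S x * norm (conv f (moll (d k)) x - f x)) < e" if k: "d k < min t 1" for k
  proof -
    let ?c = "conv (\<lambda>y. f y - g y) (moll (d k))"
    have fg: "integrable lborel (\<lambda>y. f y - g y)" using f g by simp
    note cn = conv_moll_norm[OF fg d(1), of k]
    note cf = conv_moll_norm(1)[OF f d(1), of k]
    have iR: "integrable lborel (\<lambda>x. indicator (ball (0::'a) R) x * e')"
      using emeasure_lborel_ball_finite[of "0::'a" R]
      by (intro integrable_mult_left integrable_real_indicator) auto
    have "(LINT x|lborel. indicator S x * norm (conv f (moll (d k)) x - f x)) \<le>
        (LINT x|lborel. norm (?c x) + indicator (ball 0 R) x * e' + norm (f x - g x))"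
    proof (rule integral_mono)
      show "integrable lborel (\<lambda>x. indicator S x * norm (conv f (moll (d k)) x - f x))"
        using f cf integrable_real_mult_indicator[of S lborel "\<lambda>x. norm (conv f (moll (d k)) x - f x)"]
        by (simp add: mult.commute)
      show "indicator S x * norm (conv f (moll (d k)) x - f x) \<le>
          norm (?c x) + indicator (ball 0 R) x * e' + norm (f x - g x)" for x
      proof (cases "x \<in> S")
        case True
        have "conv f (moll (d k)) x - f x = ?c x + (conv g (moll (d k)) x - g x) - (f x - g x)"
          using conv_diff[OF f g(2) test_function_moll[OF d(1)], of k x] by simp
        then have "norm (conv f (moll (d k)) x - f x) \<le>
            norm (?c x) + norm (conv g (moll (d k)) x - g x) + norm (f x - g x)"
          using norm_triangle_ineq4[of "?c x + (conv g (moll (d k)) x - g x)" "f x - g x"]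
            norm_triangle_ineq[of "?c x" "conv g (moll (d k)) x - g x"] by simp
        then show ?thesis using gS[OF k True] True R by auto
      next
        case False
        then show ?thesis using e'(1) by simp
      qed
    qed (use fg cn(1) iR in auto)
    also have "\<dots> = (LINT x|lborel. norm (?c x)) + m * e' + (LINT x|lborel. norm (f x - g x))"
      using fg cn(1) iR by (simp add: m_def)
    also have "\<dots> < e" using cn(2) g(3) e'(2) by (simp add: mult.commute)
    finally show ?thesis .
  qed
  moreover have "\<forall>\<^sub>F k in sequentially. d k < min t 1"
    using d(2) t(1) by (intro order_tendstoD(2)) auto
  moreover have "(LINT x|lborel. indicator S x * norm (conv f (moll (d k)) x - f x)) \<ge> 0" for k
    by (simp add: integral_nonneg_AE)
  ultimately show "\<exists>N. \<forall>k\<ge>N. norm ((LINT x|lborel. indicator S x * norm (conv f (moll (d k)) x - f x)) - 0) < e"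
    unfolding eventually_sequentially by fastforce
qed

lemma conv_moll_AE_subseq:
  fixes f :: "'a::euclidean_space \<Rightarrow> 'b::{banach, second_countable_topology}"
  assumes f: "integrable lborel f" and S: "bounded S" "S \<in> sets borel"
    and d: "\<And>k. d k > 0" "d \<longlonglongrightarrow> 0"
  shows "\<exists>r. strict_mono r \<and> (AE x in lborel. x \<in> S \<longrightarrow> (\<lambda>k. conv f (moll (d (r k))) x) \<longlonglongrightarrow> f x)"
proof -
  let ?u = "\<lambda>k x. indicator S x * norm (conv f (moll (d k)) x - f x)"
  have "integrable lborel (?u k)" for k
    using f conv_moll_norm(1)[OF f d(1), of k] S(2)
      integrable_real_mult_indicator[of S lborel "\<lambda>x. norm (conv f (moll (d k)) x - f x)"]
    by (simp add: mult.commute)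
  moreover have "norm (?u k x) = ?u k x" for k x by simp
  ultimately obtain r where "strict_mono r" and r: "AE x in lborel. (\<lambda>k. ?u (r k) x) \<longlonglongrightarrow> 0"
    using tendsto_L1_AE_subseq[of lborel ?u] conv_moll_tendsto_L1[OF assms] by auto
  from r have "AE x in lborel. x \<in> S \<longrightarrow> (\<lambda>k. conv f (moll (d (r k))) x) \<longlonglongrightarrow> f x"
  proof eventually_elim
    case (elim x)
    then show ?case by (auto simp: tendsto_norm_zero_iff LIM_zero_iff)
  qed
  with \<open>strict_mono r\<close> show ?thesis by blast
qed

section \<open>Weak derivatives\<close>

text \<open>The integrals run over the whole space because test functions vanish off
  \<open>S\<close> anyway; so representatives extended by 0 can be convolved globally.\<close>

definition weak_deriv :: "'a::euclidean_space set \<Rightarrow> ('a \<Rightarrow> real) \<Rightarrow> 'a \<Rightarrow> ('a \<Rightarrow> real) \<Rightarrow> bool" where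
  "weak_deriv S f b g \<longleftrightarrow> (\<forall>\<zeta>. test_function S \<zeta> \<longrightarrow>
     (LINT x|lborel. f x * frechet_derivative \<zeta> (at x) b) = - (LINT x|lborel. g x * \<zeta> x))"

lemma test_function_moll_reflect:
  assumes "d > 0" "cball x d \<subseteq> S"
  shows "test_function S (\<lambda>y. moll d (x - y))"
  using assms by (intro test_function_reflect[OF test_function_moll]) (auto intro: moll_eq_0)

text \<open>The reflected kernel is a test function on \<open>S\<close> once the closed ball around
  \<open>x\<close> lies in \<open>S\<close>, and the sign from the reflection cancels the sign in
  the definition of the weak derivative.\<close>

lemma conv_moll_weak_deriv:
  assumes f: "integrable lborel f" and "weak_deriv S f b g" and d: "d > 0" "cball x d \<subseteq> S"
  shows "frechet_derivative (conv f (moll d)) (at x) b = conv g (moll d) x"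
proof -
  note m = test_function_moll[OF d(1)]
  have "frechet_derivative (conv f (moll d)) (at x) b = conv f (\<lambda>z. frechet_derivative (moll d) (at z) b) x"
    using frechet_derivative_at[OF conv_has_derivative[OF f m]] by metis
  also have "\<dots> = - (LINT y|lborel. f y * frechet_derivative (\<lambda>y. moll d (x - y)) (at y) b)"
    by (simp add: conv_def frechet_derivative_reflect[OF m] mult.commute)
  also have "\<dots> = conv g (moll d) x"
    using assms(2) test_function_moll_reflect[OF d]
    by (simp add: weak_deriv_def conv_def mult.commute)
  finally show ?thesis .
qed

definition eps :: "nat \<Rightarrow> real" where "eps k = inverse (real (Suc k))"

lemma eps: "eps k > 0" "eps \<longlonglongrightarrow> 0"
  unfolding eps_def[abs_def] using LIMSEQ_inverse_real_of_nat by auto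

lemma eps_subseq: "strict_mono r \<Longrightarrow> (\<lambda>k. eps (r k)) \<longlonglongrightarrow> 0"
  using LIMSEQ_subseq_LIMSEQ[OF eps(2)] by (simp add: o_def)

text \<open>The fundamental lemma of the calculus of variations: close to a point of
  \<open>S\<close> the mollifications of \<open>f\<close> are integrals against test functions,
  hence 0, and a subsequence tends to \<open>f\<close> almost everywhere.\<close>

lemma AE_zero_weak:
  assumes f: "integrable lborel f" and S: "open S" "bounded S"
    and "\<And>\<zeta>. test_function S \<zeta> \<Longrightarrow> (LINT x|lborel. f x * \<zeta> x) = 0"
  shows "AE x in lborel. x \<in> S \<longrightarrow> f x = 0"
proof -
  obtain r where r: "strict_mono r"
      "AE x in lborel. x \<in> S \<longrightarrow> (\<lambda>k. conv f (moll (eps (r k))) x) \<longlonglongrightarrow> f x"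
    using conv_moll_AE_subseq[OF f S(2) _ eps] S(1) by auto
  from r(2) show ?thesis
  proof eventually_elim
    case (elim x)
    show ?case
    proof
      assume x: "x \<in> S"
      obtain e where e: "e > 0" "cball x e \<subseteq> S" using S(1) x by (auto simp: open_contains_cball)
      have "\<forall>\<^sub>F k in sequentially. eps (r k) < e"
        using eps_subseq[OF r(1)] e(1) by (rule order_tendstoD(2))
      then have "\<forall>\<^sub>F k in sequentially. conv f (moll (eps (r k))) x = 0"
      proof eventually_elim
        case (elim k)
        then have "cball x (eps (r k)) \<subseteq> S" using e(2) by (auto simp: subset_iff)
        from assms(4)[OF test_function_moll_reflect[OF eps(1) this]]
        show ?case by (simp add: conv_def mult.commute)
      qed
      then have "(\<lambda>k. conv f (moll (eps (r k))) x) \<longlonglongrightarrow> 0" by (rule tendsto_eventually)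
      with elim x show "f x = 0" using LIMSEQ_unique by blast
    qed
  qed
qed

lemma AE_eq_continuous:
  fixes f g :: "'a::euclidean_space \<Rightarrow> 'b::real_normed_vector"
  assumes "open S" "continuous_on S f" "continuous_on S g" "AE x in lborel. x \<in> S \<longrightarrow> f x = g x" "x \<in> S"
  shows "f x = g x"
proof (rule ccontr)
  let ?N = "S \<inter> (\<lambda>x. f x - g x) -` (- {0})"
  assume ne: "f x \<noteq> g x"
  have op: "open ?N"
    using assms(1-3) by (intro continuous_open_preimage continuous_intros) auto
  from assms(4) have "AE x in lborel. x \<notin> ?N" by eventually_elim auto
  then have "?N \<in> null_sets lborel" using op by (subst AE_iff_null_sets) auto
  then have "negligible ?N" using negligible_iff_null_sets null_sets_completionI by blast
  then have "?N = {}" using op open_not_negligible by blast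
  with ne assms(5) show False by auto
qed

section \<open>Weyl's lemma\<close>

definition laplacian :: "('a::euclidean_space \<Rightarrow> real) \<Rightarrow> 'a \<Rightarrow> real" where
  "laplacian f x = (\<Sum>b\<in>Basis. frechet_derivative (\<lambda>x. frechet_derivative f (at x) b) (at x) b)"

text \<open>It suffices to test with the translates of the radial bumps; their second derivatives are
  explicit, so that the symmetry of second derivatives is not needed in general.\<close>

definition weakly_harmonic :: "'a::euclidean_space set \<Rightarrow> ('a \<Rightarrow> real) \<Rightarrow> bool" where
  "weakly_harmonic S f \<longleftrightarrow> (\<forall>x d. d > 0 \<longrightarrow> cball x d \<subseteq> S \<longrightarrow>
     (LINT y|lborel. laplacian (bump d) (x - y) * f y) = 0)"

lemma radial_derivative:
  "frechet_derivative (radial p d) (at w) v = radial (flat_deriv p) d w * (- 2 * (w \<bullet> v) / d\<^sup>2)"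
  using frechet_derivative_at[OF radial_has_derivative] by metis

lemma radial_derivative2:
  "frechet_derivative (\<lambda>w. frechet_derivative (radial p d) (at w) a) (at w) b =
    radial (flat_deriv (flat_deriv p)) d w * (4 * (w \<bullet> a) * (w \<bullet> b) / d ^ 4)
      - radial (flat_deriv p) d w * (2 * (a \<bullet> b) / d\<^sup>2)"
proof -
  have "((\<lambda>w. radial (flat_deriv p) d w * (- 2 * (w \<bullet> a) / d\<^sup>2)) has_derivative
     (\<lambda>v. radial (flat_deriv p) d w * (- 2 * (v \<bullet> a) / d\<^sup>2) +
        radial (flat_deriv (flat_deriv p)) d w * (- 2 * (w \<bullet> v) / d\<^sup>2) * (- 2 * (w \<bullet> a) / d\<^sup>2))) (at w)"
    unfolding divide_inverse
    by (rule has_derivative_mult[OF radial_has_derivative[unfolded divide_inverse]])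
      (auto intro!: derivative_eq_intros)
  from fun_cong[OF frechet_derivative_at[OF this, symmetric], of b]
  have "frechet_derivative (\<lambda>w. radial (flat_deriv p) d w * (- 2 * (w \<bullet> a) / d\<^sup>2)) (at w) b =
     radial (flat_deriv p) d w * (- 2 * (b \<bullet> a) / d\<^sup>2) +
        radial (flat_deriv (flat_deriv p)) d w * (- 2 * (w \<bullet> b) / d\<^sup>2) * (- 2 * (w \<bullet> a) / d\<^sup>2)" .
  also have "\<dots> = radial (flat_deriv (flat_deriv p)) d w * (4 * (w \<bullet> a) * (w \<bullet> b) / d ^ 4)
      - radial (flat_deriv p) d w * (2 * (a \<bullet> b) / d\<^sup>2)"
    by (cases "d = 0") (simp_all add: field_simps inner_commute power4_eq_xxxx power2_eq_square)
  finally show ?thesis unfolding radial_derivative .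
qed

lemma laplacian_bump:
  fixes w :: "'a::euclidean_space"
  shows "laplacian (bump d) w = radial (flat_deriv (flat_deriv 1)) d w * (4 * (w \<bullet> w) / d ^ 4)
      - profile d w * (2 * DIM('a) / d\<^sup>2)"
proof -
  have "laplacian (bump d) w = (\<Sum>b\<in>Basis. (radial (flat_deriv (flat_deriv 1)) d w * 4 / d ^ 4) * ((w \<bullet> b) * (w \<bullet> b))
      - profile d w * 2 / d\<^sup>2)"
    unfolding laplacian_def radial_derivative2 by (intro sum.cong) auto
  also have "\<dots> = (radial (flat_deriv (flat_deriv 1)) d w * 4 / d ^ 4) * (w \<bullet> w) - DIM('a) * (profile d w * 2 / d\<^sup>2)"
    unfolding sum_subtractf sum_distrib_left[symmetric] euclidean_inner[of w w] by simp
  finally show ?thesis by (simp add: mult_ac)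
qed

lemma flat_bounded:
  obtains B where "\<And>t. t \<le> 1 \<Longrightarrow> \<bar>flat p t\<bar> \<le> B" "B \<ge> 0"
proof -
  have "continuous_on {0..1} (flat p)"
    using flat_has_derivative DERIV_isCont by (metis continuous_at_imp_continuous_on)
  then have "bounded (flat p ` {0..1})"
    by (intro compact_imp_bounded compact_continuous_image) auto
  then obtain B where "\<forall>t\<in>{0..1}. \<bar>flat p t\<bar> \<le> B" by (auto simp: bounded_iff)
  then have B: "\<bar>flat p t\<bar> \<le> B" if "t \<in> {0..1}" for t using that by blast
  have "\<bar>flat p t\<bar> \<le> max B 0" if "t \<le> 1" for t
    using B[of t] that by (cases "t \<ge> 0") (auto simp: flat_def le_max_iff_disj)
  then show ?thesis by (intro that[of "max B 0"]) auto
qed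

lemma radial_uniformly_bounded:
  obtains B where "\<And>d (w :: 'a::euclidean_space). \<bar>radial p d w\<bar> \<le> B" "B \<ge> 0"
proof -
  obtain B where "\<And>t. t \<le> 1 \<Longrightarrow> \<bar>flat p t\<bar> \<le> B" "B \<ge> 0" using flat_bounded[of p] by blast
  then show ?thesis by (intro that[of B]) (auto simp: radial_def)
qed

text \<open>By scaling, the derivative in \<open>d\<close> of a kernel
  \<open>d^(-n) eta(w/d)\<close> is \<open>- 1 / d\<close> times the divergence of \<open>w\<close>
  times the kernel, and \<open>profile d w\<close> times \<open>w\<close> is
  \<open>- d\<^sup>2 / 2\<close> times the gradient of \<open>bump d\<close>. This produces both the
  Laplacian and the constant in front of it.\<close>

lemma moll_deriv_radius:
  fixes w :: "'a::euclidean_space"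
  assumes d: "d > 0"
  shows "((\<lambda>d. moll d w) has_real_derivative
     d / (2 * mass TYPE('a) * d ^ DIM('a)) * laplacian (bump d) w) (at d)"
proof -
  let ?n = "DIM('a)" and ?M = "mass TYPE('a)" and ?s = "w \<bullet> w"
  have n: "?n > 0" by simp
  have M: "?M > 0" by (rule mass_pos)
  let ?F2 = "flat (flat_deriv (flat_deriv 1)) (1 - ?s / d\<^sup>2)" and ?F1 = "flat (flat_deriv 1) (1 - ?s / d\<^sup>2)"
  have "((\<lambda>d. 1 - ?s / d\<^sup>2) has_real_derivative 2 * ?s / d ^ 3) (at d)"
    using d by (auto intro!: derivative_eq_intros simp: field_simps power2_eq_square power3_eq_cube power4_eq_xxxx)
  from DERIV_chain2[OF flat_has_derivative this]
  have P: "((\<lambda>d. profile d w) has_real_derivative ?F2 * (2 * ?s / d ^ 3)) (at d)"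
    by (simp add: radial_def)
  have "((\<lambda>d. moll d w) has_real_derivative
      (?F2 * (2 * ?s / d ^ 3) * (?M * d ^ ?n) - profile d w * (?M * (?n * d ^ (?n - 1)))) /
       (?M * d ^ ?n * (?M * d ^ ?n))) (at d)"
    unfolding moll_def[abs_def]
    by (rule DERIV_divide[OF P]) (use d M in \<open>auto intro!: derivative_eq_intros\<close>)
  moreover have "(?F2 * (2 * ?s / d ^ 3) * (?M * d ^ ?n) - profile d w * (?M * (?n * d ^ (?n - 1)))) /
       (?M * d ^ ?n * (?M * d ^ ?n)) = d / (2 * ?M * d ^ ?n) * laplacian (bump d) w"
  proof -
    have dn: "d ^ ?n = d * d ^ (?n - 1)" using n by (simp add: power_eq_if)
    show ?thesis
      unfolding laplacian_bump radial_def dn using d M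
      by (simp add: field_simps power2_eq_square power3_eq_cube power4_eq_xxxx)
  qed
  ultimately show ?thesis by simp
qed

lemma laplacian_bump_bounded:
  obtains C where "\<And>d (w :: 'a::euclidean_space). d > 0 \<Longrightarrow> \<bar>laplacian (bump d) w\<bar> \<le> C / d\<^sup>2" "C \<ge> 0"
proof -
  obtain B1 where B1: "\<And>d (w :: 'a). \<bar>radial (flat_deriv (flat_deriv 1)) d w\<bar> \<le> B1" "B1 \<ge> 0"
    using radial_uniformly_bounded[of "flat_deriv (flat_deriv 1)"] by blast
  obtain B2 where B2: "\<And>d (w :: 'a). \<bar>profile d w\<bar> \<le> B2" "B2 \<ge> 0"
    using radial_uniformly_bounded[of "flat_deriv 1"] by blast
  have "\<bar>laplacian (bump d) w\<bar> \<le> (4 * B1 + 2 * DIM('a) * B2) / d\<^sup>2" if d: "d > 0" for d and w :: 'a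
  proof (cases "norm w < d")
    case True
    then have "w \<bullet> w \<le> d\<^sup>2" by (simp add: dot_square_norm power_mono)
    then have "\<bar>radial (flat_deriv (flat_deriv 1)) d w\<bar> * (4 * (w \<bullet> w) / d ^ 4) \<le> B1 * (4 * d\<^sup>2 / d ^ 4)"
      using d B1 by (intro mult_mono divide_right_mono) auto
    also have "\<dots> = 4 * B1 / d\<^sup>2" using d by (simp add: power4_eq_xxxx power2_eq_square)
    finally have 1: "\<bar>radial (flat_deriv (flat_deriv 1)) d w * (4 * (w \<bullet> w) / d ^ 4)\<bar> \<le> 4 * B1 / d\<^sup>2"
      using d by (simp add: abs_mult)
    have "\<bar>profile d w\<bar> * (2 * DIM('a) / d\<^sup>2) \<le> B2 * (2 * DIM('a) / d\<^sup>2)"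
      using d B2 by (intro mult_right_mono) auto
    then have 2: "\<bar>profile d w * (2 * DIM('a) / d\<^sup>2)\<bar> \<le> 2 * DIM('a) * B2 / d\<^sup>2"
      using d by (simp add: abs_mult mult_ac)
    from 1 2 show ?thesis unfolding laplacian_bump add_divide_distrib by linarith
  next
    case False
    then show ?thesis using d B1 B2 by (simp add: laplacian_bump radial_eq_0)
  qed
  then show ?thesis using B1 B2 by (intro that[of "4 * B1 + 2 * DIM('a) * B2"]) auto
qed

lemma laplacian_bump_measurable [measurable]: "laplacian (bump d) \<in> borel_measurable borel"
  unfolding laplacian_bump[abs_def] by measurable

text \<open>The derivative of the average in the radius is a multiple of the integral of
  \<open>f\<close> against a translated \<open>laplacian (bump d)\<close>, which weak harmonicity
  makes 0.\<close>

lemma weakly_harmonic_conv_const: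
  fixes f :: "'a::euclidean_space \<Rightarrow> real"
  assumes f: "integrable lborel f" and h: "weakly_harmonic S f"
    and d: "0 < d1" "d1 \<le> d2" "cball x d2 \<subseteq> S"
  shows "conv f (moll d1) x = conv f (moll d2) x"
proof (cases "d1 = d2")
  case False
  let ?n = "DIM('a)" and ?M = "mass TYPE('a)"
  have M: "?M > 0" by (rule mass_pos)
  obtain C where C: "\<And>d (w :: 'a). d > 0 \<Longrightarrow> \<bar>laplacian (bump d) w\<bar> \<le> C / d\<^sup>2" "C \<ge> 0"
    using laplacian_bump_bounded by blast
  obtain B where B: "\<And>d (w :: 'a). \<bar>profile d w\<bar> \<le> B" "B \<ge> 0"
    using radial_uniformly_bounded[of "flat_deriv 1"] by blast
  let ?c = "\<lambda>d. d / (2 * ?M * d ^ ?n)"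
  have D: "((\<lambda>d. conv f (moll d) x) has_derivative
      (\<lambda>s. LINT y|lborel. (s * (?c d * laplacian (bump d) (x - y))) *\<^sub>R f y)) (at d)" if d: "d > 0" for d
    unfolding conv_def
  \<comment> \<open>Radii in this ball exceed \<open>d / 2\<close>, which keeps their negative
    powers bounded.\<close>
  proof (rule has_derivative_lebesgue_integral[OF f, where r = "d / 2"])
    have t0: "t > d / 2" if "t \<in> ball d (d / 2)" for t using that unfolding mem_ball dist_real_def by linarith
    show "\<bar>moll t (x - y)\<bar> \<le> B / (?M * (d / 2) ^ ?n)" if "t \<in> ball d (d / 2)" for t y
    proof -
      have "\<bar>profile t (x - y)\<bar> / (?M * t ^ ?n) \<le> B / (?M * (d / 2) ^ ?n)"
        using t0[OF that] d B M by (intro frac_le mult_left_mono power_mono mult_pos_pos) auto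
      then show ?thesis using t0[OF that] d M by (simp add: moll_def abs_mult)
    qed
    show "((\<lambda>t. moll t (x - y)) has_derivative (\<lambda>s. s * (?c t * laplacian (bump t) (x - y)))) (at t)"
      if "t \<in> ball d (d / 2)" for t y
      unfolding mult.commute[of _ "?c t * _"]
      using moll_deriv_radius[of t "x - y"] t0[OF that] d
      by (simp only: has_field_derivative_def)
    show "\<bar>s * (?c t * laplacian (bump t) (x - y))\<bar> \<le>
       ((3 / 2 * d) / (2 * ?M * (d / 2) ^ ?n) * (C / (d / 2)\<^sup>2)) * norm s" if "t \<in> ball d (d / 2)" for t y s
    proof -
      have t: "t > 0" "t \<ge> d / 2" "t \<le> 3 / 2 * d" using that d unfolding mem_ball dist_real_def by linarith+
      have "?c t \<le> (3 / 2 * d) / (2 * ?M * (d / 2) ^ ?n)"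
        using t d M by (intro frac_le mult_left_mono power_mono mult_pos_pos) auto
      moreover have "\<bar>laplacian (bump t) (x - y)\<bar> \<le> C / (d / 2)\<^sup>2"
        using C(1)[OF t(1), of "x - y"] t d C(2) frac_le[of C C "(d / 2)\<^sup>2" "t\<^sup>2"] power_mono[of "d / 2" t 2]
        by auto
      moreover have "?c t \<ge> 0" using t M by auto
      ultimately have "?c t * \<bar>laplacian (bump t) (x - y)\<bar> \<le> (3 / 2 * d) / (2 * ?M * (d / 2) ^ ?n) * (C / (d / 2)\<^sup>2)"
        using d M by (intro mult_mono) auto
      then have "\<bar>s\<bar> * (?c t * \<bar>laplacian (bump t) (x - y)\<bar>) \<le> \<bar>s\<bar> * ((3 / 2 * d) / (2 * ?M * (d / 2) ^ ?n) * (C / (d / 2)\<^sup>2))"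
        by (rule mult_left_mono) simp
      moreover have "\<bar>s * (?c t * laplacian (bump t) (x - y))\<bar> = \<bar>s\<bar> * (?c t * \<bar>laplacian (bump t) (x - y)\<bar>)"
        using \<open>?c t \<ge> 0\<close> unfolding abs_mult[of s] abs_mult[of "?c t"] by (simp only: abs_of_nonneg)
      ultimately show ?thesis by (simp only: real_norm_def mult.commute)
    qed
  qed (use d in auto)
  have Z: "(LINT y|lborel. (s * (?c d * laplacian (bump d) (x - y))) *\<^sub>R f y) = 0"
    if "0 < d" "d \<le> d2" for s d
  proof -
    have "cball x d \<subseteq> S" using that d by (auto simp: subset_iff)
    then have "(LINT y|lborel. laplacian (bump d) (x - y) * f y) = 0"
      using h that(1) by (simp add: weakly_harmonic_def)
    moreover have "(LINT y|lborel. (s * (?c d * laplacian (bump d) (x - y))) *\<^sub>R f y) =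
      (LINT y|lborel. (s * ?c d) * (laplacian (bump d) (x - y) * f y))"
      by (intro Bochner_Integration.integral_cong) (auto simp: mult_ac)
    ultimately show ?thesis by (simp only: integral_mult_right_zero mult_zero_right)
  qed
  have "((\<lambda>d. conv f (moll d) x) has_real_derivative 0) (at d)" if "0 < d" "d \<le> d2" for d
    unfolding has_field_derivative_def
    by (rule has_derivative_eq_rhs[OF D[OF that(1)]]) (auto simp only: Z[OF that] fun_eq_iff mult_zero_left)
  then have D0: "((\<lambda>d. conv f (moll d) x) has_real_derivative 0) (at d)" if "d1 \<le> d" "d \<le> d2" for d
    using that d(1) by simp
  have "continuous_on {d1..d2} (\<lambda>d. conv f (moll d) x)"
    using D0 by (auto intro!: continuous_at_imp_continuous_on DERIV_isCont)
  from DERIV_isconst_end[OF _ this] D0 False d show ?thesis by simp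
qed simp

text \<open>Averages of all admissible radii agree, and for small radii they tend to
  \<open>f\<close> almost everywhere along a subsequence. The null set is chosen before the radius,
  so one null set serves all \<open>d\<close>.\<close>

theorem weyl_lemma:
  fixes f :: "'a::euclidean_space \<Rightarrow> real"
  assumes f: "integrable lborel f" and S: "open S" "bounded S" and h: "weakly_harmonic S f"
  shows "AE x in lborel. \<forall>d>0. cball x d \<subseteq> S \<longrightarrow> f x = conv f (moll d) x"
proof -
  obtain r where r: "strict_mono r"
      "AE x in lborel. x \<in> S \<longrightarrow> (\<lambda>k. conv f (moll (eps (r k))) x) \<longlonglongrightarrow> f x"
    using conv_moll_AE_subseq[OF f S(2) _ eps] S(1) by auto
  from r(2) show ?thesis
  proof eventually_elim
    case (elim x)
    show ?case
    proof (intro allI impI)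
      fix d :: real assume d: "d > 0" "cball x d \<subseteq> S"
      have "\<forall>\<^sub>F k in sequentially. eps (r k) < d"
        using eps_subseq[OF r(1)] d(1) by (rule order_tendstoD(2))
      then have "\<forall>\<^sub>F k in sequentially. conv f (moll (eps (r k))) x = conv f (moll d) x"
      proof eventually_elim
        case (elim k)
        show ?case
          by (rule weakly_harmonic_conv_const[OF f h eps(1) less_imp_le[OF elim] d(2)])
      qed
      then have "(\<lambda>k. conv f (moll (eps (r k))) x) \<longlonglongrightarrow> conv f (moll d) x" by (rule tendsto_eventually)
      moreover have "x \<in> S" using d by auto
      ultimately show "f x = conv f (moll d) x" using elim LIMSEQ_unique by blast
    qed
  qed
qed

text \<open>A limit of maps whose Cauchy--Riemann defects tend to \<open>0\<close> in \<open>L\<^sup>1\<close> is harmonic; no convergence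
  of the conjugate functions \<open>b k\<close> is required.\<close>
lemma weakly_harmonic_limit:
  fixes a b :: "nat \<Rightarrow> 'a::euclidean_space \<Rightarrow> real"
  assumes basis: "Basis = {e1, e2 :: 'a}" "e1 \<noteq> e2" and S: "open S"
    and a: "\<And>k x. x \<in> S \<Longrightarrow> (a k has_derivative a' k x) (at x)" "\<And>k v. continuous_on S (\<lambda>x. a' k x v)"
    and b: "\<And>k x. x \<in> S \<Longrightarrow> (b k has_derivative b' k x) (at x)" "\<And>k v. continuous_on S (\<lambda>x. b' k x v)"
    and f: "integrable lborel f"
    and lim: "\<And>k. set_integrable lborel S (\<lambda>x. a k x - f x)"
      "(\<lambda>k. LINT x|lborel. indicator S x * \<bar>a k x - f x\<bar>) \<longlonglongrightarrow> 0"
    and p: "\<And>k. set_integrable lborel S (\<lambda>x. a' k x e1 - b' k x e2)"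
      "(\<lambda>k. LINT x|lborel. indicator S x * \<bar>a' k x e1 - b' k x e2\<bar>) \<longlonglongrightarrow> 0"
    and q: "\<And>k. set_integrable lborel S (\<lambda>x. a' k x e2 + b' k x e1)"
      "(\<lambda>k. LINT x|lborel. indicator S x * \<bar>a' k x e2 + b' k x e1\<bar>) \<longlonglongrightarrow> 0"
  shows "weakly_harmonic S f"
  unfolding weakly_harmonic_def
proof (intro allI impI)
  fix x :: 'a and d :: real assume d: "d > 0" "cball x d \<subseteq> S"
  define z where "z y = bump d (x - y)" for y
  define z' where "z' e y = frechet_derivative z (at y) e" for e y
  note bm = test_function_radial[OF d(1), of 1]
  have z: "test_function S z"
    unfolding z_def by (rule test_function_reflect[OF bm _ d(2)]) (simp add: radial_eq_0[OF d(1)] less_imp_le)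
  have z'T: "test_function S (z' e)" for e unfolding z'_def by (rule test_function_derivative[OF z])
  have z'eq: "z' e y = - frechet_derivative (bump d) (at (x - y)) e" for e y
    unfolding z'_def z_def by (rule frechet_derivative_reflect[OF bm])
  have z'': "frechet_derivative (z' e) (at y) e' =
      frechet_derivative (\<lambda>w. frechet_derivative (bump d) (at w) e) (at (x - y)) e'" for e e' y
  proof -
    note dt = test_function_derivative[OF bm, of e]
    have "((\<lambda>y. frechet_derivative (bump d) (at (x - y)) e) has_derivative
        frechet_derivative (\<lambda>y. frechet_derivative (bump d) (at (x - y)) e) (at y)) (at y)"
      by (rule smooth_on_has_derivative[OF smooth_on_reflect[OF test_function_smooth[OF dt]]]) simp
    from fun_cong[OF frechet_derivative_at[OF has_derivative_minus[OF this], symmetric], of e']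
    show ?thesis unfolding z'eq[abs_def] frechet_derivative_reflect[OF dt] by simp
  qed
  \<comment> \<open>The Hessian of a radial function is explicit and visibly symmetric. This is what
    cancels the terms with \<open>b\<close> below.\<close>
  have sym: "frechet_derivative (z' e1) (at y) e2 = frechet_derivative (z' e2) (at y) e1" for y
    unfolding z'' radial_derivative2 by (simp add: inner_commute mult_ac)
  have lap: "laplacian (bump d) (x - y) =
      frechet_derivative (z' e1) (at y) e1 + frechet_derivative (z' e2) (at y) e2" for y
    unfolding laplacian_def z'' basis(1) using basis(2) by simp
  let ?L = "\<lambda>y. laplacian (bump d) (x - y)"
  have LT: "\<exists>B. \<forall>y. \<bar>?L y\<bar> \<le> B" using laplacian_bump_bounded[where 'a='a] d(1) by metis
  then obtain B where B: "\<And>y. \<bar>?L y\<bar> \<le> B" by blast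
  have L0: "?L y = 0" if "y \<notin> S" for y
  proof -
    have "norm (x - y) \<ge> d" using that d(2) unfolding subset_iff mem_cball dist_norm by (meson linear)
    then show ?thesis using d(1) by (simp add: laplacian_bump radial_eq_0)
  qed
  obtain C1 where C1: "\<And>y. \<bar>z' e1 y\<bar> \<le> C1" using test_function_bounded[OF z'T] by metis
  obtain C2 where C2: "\<And>y. \<bar>z' e2 y\<bar> \<le> C2" using test_function_bounded[OF z'T] by metis
  have zS: "z' e y = 0" if "y \<notin> S" for e y
    by (rule test_functionE[OF z'T[of e]]) (use that in blast)
  have bound: "\<bar>LINT y|lborel. g y * u y\<bar> \<le> D * (LINT y|lborel. indicator S y * \<bar>u y\<bar>)"
    if u: "set_integrable lborel S u" and g: "\<And>y. \<bar>g y\<bar> \<le> D" "\<And>y. y \<notin> S \<Longrightarrow> g y = 0"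
      "g \<in> borel_measurable borel" for g u :: "'a \<Rightarrow> real" and D
  proof -
    have [measurable]: "g \<in> borel_measurable borel" by fact
    have iu: "integrable lborel (\<lambda>y. indicator S y * u y)" using u by (simp add: set_integrable_def)
    have ia: "integrable lborel (\<lambda>y. D * (indicator S y * \<bar>u y\<bar>))"
      using integrable_abs[OF iu] by (simp add: abs_mult)
    have eq: "g y * u y = g y * (indicator S y * u y)" for y using g(2)[of y] by (cases "y \<in> S") auto
    have D: "D \<ge> 0" using g(1) abs_ge_zero order_trans by blast
    have le: "\<bar>g y * u y\<bar> \<le> D * (indicator S y * \<bar>u y\<bar>)" for y
      unfolding eq using g(1)[of y] by (auto simp: abs_mult intro!: mult_right_mono)
    have ig: "integrable lborel (\<lambda>y. g y * u y)"
    proof (rule Bochner_Integration.integrable_bound[OF ia])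
      show "(\<lambda>y. g y * u y) \<in> borel_measurable lborel"
        unfolding eq using borel_measurable_times[OF _ borel_measurable_integrable[OF iu], of g] by simp
      show "AE y in lborel. norm (g y * u y) \<le> norm (D * (indicator S y * \<bar>u y\<bar>))"
        using le order_trans[OF le abs_ge_self] by (intro AE_I2) (simp only: real_norm_def)
    qed
    have "\<bar>LINT y|lborel. g y * u y\<bar> \<le> (LINT y|lborel. \<bar>g y * u y\<bar>)" by (rule integral_abs_bound)
    also have "\<dots> \<le> (LINT y|lborel. D * (indicator S y * \<bar>u y\<bar>))"
      using le by (intro integral_mono integrable_abs ig ia)
    finally show ?thesis by simp
  qed
  let ?p = "\<lambda>k x. a' k x e1 - b' k x e2" and ?q = "\<lambda>k x. a' k x e2 + b' k x e1"
  let ?I = "\<lambda>u. LINT y|lborel. indicator S y * \<bar>u y :: real\<bar>"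
  have Lm: "?L \<in> borel_measurable borel" by measurable
  have z'm: "z' e \<in> borel_measurable borel" for e by (rule test_function_measurable[OF z'T])
  have Lf: "integrable lborel (\<lambda>y. ?L y * f y)"
  proof (rule Bochner_Integration.integrable_bound[of lborel "\<lambda>y. B * f y"])
    show "AE y in lborel. norm (?L y * f y) \<le> norm (B * f y)"
      using B order_trans[OF B abs_ge_self] by (auto intro!: AE_I2 mult_right_mono simp: abs_mult)
  qed (use f in auto)
  \<comment> \<open>One integration by parts turns the Laplacian into first derivatives of
    \<open>a k\<close>. These are those of \<open>b k\<close> up to the defects \<open>?p\<close>
    and \<open>?q\<close>; a second integration by parts puts mixed second derivatives of
    \<open>z\<close> on \<open>b k\<close>, which cancel. Three L1 errors remain.\<close>
  have main: "\<bar>LINT y|lborel. ?L y * f y\<bar> \<le> B * ?I (\<lambda>y. a k y - f y) + C1 * ?I (?p k) + C2 * ?I (?q k)" for k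
  proof -
    note A1 = integral_by_parts[OF S z'T[of e1], of "a k" "a' k" e1, OF a(1) a(2)]
    note A2 = integral_by_parts[OF S z'T[of e2], of "a k" "a' k" e2, OF a(1) a(2)]
    note B1 = integral_by_parts[OF S z'T[of e1], of "b k" "b' k" e2, OF b(1) b(2)]
    note B2 = integral_by_parts[OF S z'T[of e2], of "b k" "b' k" e1, OF b(1) b(2)]
    have La: "integrable lborel (\<lambda>y. ?L y * a k y)"
      using Bochner_Integration.integrable_add[OF A1(1) A2(1)] unfolding lap by (simp add: algebra_simps)
    have "(LINT y|lborel. ?L y * a k y) = - (LINT y|lborel. a' k y e1 * z' e1 y) - (LINT y|lborel. a' k y e2 * z' e2 y)"
      using Bochner_Integration.integral_add[OF A1(1) A2(1)] A1(3) A2(3) unfolding lap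
      by (simp add: algebra_simps)
    moreover have "(LINT y|lborel. b' k y e2 * z' e1 y) = (LINT y|lborel. b' k y e1 * z' e2 y)"
      using B1(3) B2(3) by (simp add: sym)
    moreover have "(LINT y|lborel. z' e1 y * ?p k y) =
        (LINT y|lborel. a' k y e1 * z' e1 y) - (LINT y|lborel. b' k y e2 * z' e1 y)"
      using Bochner_Integration.integral_diff[OF A1(2) B1(2)] by (simp add: algebra_simps)
    moreover have "(LINT y|lborel. z' e2 y * ?q k y) =
        (LINT y|lborel. a' k y e2 * z' e2 y) + (LINT y|lborel. b' k y e1 * z' e2 y)"
      using Bochner_Integration.integral_add[OF A2(2) B2(2)] by (simp add: algebra_simps)
    moreover have "(LINT y|lborel. ?L y * (a k y - f y)) = (LINT y|lborel. ?L y * a k y) - (LINT y|lborel. ?L y * f y)"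
      using Bochner_Integration.integral_diff[OF La Lf] by (simp add: algebra_simps)
    ultimately have "(LINT y|lborel. ?L y * f y) = - (LINT y|lborel. z' e1 y * ?p k y)
        - (LINT y|lborel. z' e2 y * ?q k y) - (LINT y|lborel. ?L y * (a k y - f y))" by simp
    moreover have "\<bar>LINT y|lborel. z' e1 y * ?p k y\<bar> \<le> C1 * ?I (?p k)"
      by (rule bound[OF p(1) C1 zS z'm])
    moreover have "\<bar>LINT y|lborel. z' e2 y * ?q k y\<bar> \<le> C2 * ?I (?q k)"
      by (rule bound[OF q(1) C2 zS z'm])
    moreover have "\<bar>LINT y|lborel. ?L y * (a k y - f y)\<bar> \<le> B * ?I (\<lambda>y. a k y - f y)"
      by (rule bound[OF lim(1) B L0 Lm])
    ultimately show ?thesis by linarith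
  qed
  have "(\<lambda>k. B * ?I (\<lambda>y. a k y - f y) + C1 * ?I (?p k) + C2 * ?I (?q k)) \<longlonglongrightarrow> B * 0 + C1 * 0 + C2 * 0"
    by (intro tendsto_intros lim p q)
  then have "\<bar>LINT y|lborel. ?L y * f y\<bar> \<le> 0"
    using main by (intro LIMSEQ_le_const) auto
  then show "(LINT y|lborel. ?L y * f y) = 0" by simp
qed

section \<open>The area function\<close>

text \<open>With \<open>g = I + X\<^sup>T X\<close> and \<open>h = g / sqrt (det g)\<close>, a symmetric matrix of determinant \<open>1\<close>, the rows of
  \<open>B\<close> are, up to order and sign, the rows of \<open>h\<close>, and \<open>A\<close> is \<open>X\<close> multiplied by \<open>h\<^sup>-\<^sup>1 J\<close>.\<close>

abbreviation (input) gram :: "real^2^'n \<Rightarrow> 2 \<Rightarrow> 2 \<Rightarrow> real" where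
  "gram X i j \<equiv> (\<Sum>a\<in>UNIV. X $ a $ i * X $ a $ j)"

text \<open>The summand is symmetric and vanishes on the diagonal, so the sum over
  \<open>a \<le> b\<close> is half of the full double sum, which factorises.\<close>

lemma lagrange_identity:
  fixes x y :: "'n::{finite,linorder} \<Rightarrow> real"
  shows "(\<Sum>a\<in>UNIV. \<Sum>b\<in>{a..}. (x a * y b - y a * x b)\<^sup>2) =
    (\<Sum>a\<in>UNIV. x a * x a) * (\<Sum>a\<in>UNIV. y a * y a) - (\<Sum>a\<in>UNIV. x a * y a)\<^sup>2"
proof -
  define D where "D a b = (x a * y b - y a * x b)\<^sup>2" for a b
  have sym: "D a b = D b a" for a b by (simp add: D_def power2_commute mult.commute)
  have diag: "D a a = 0" for a by (simp add: D_def mult.commute)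
  have 1: "(\<Sum>b\<in>{a..}. D a b) = (\<Sum>b\<in>UNIV. if a \<le> b then D a b else 0)" for a
    by (simp add: sum.If_cases atLeast_def)
  have "(\<Sum>a\<in>UNIV. \<Sum>b\<in>UNIV. if a \<le> b then D a b else 0) = (\<Sum>a\<in>UNIV. \<Sum>b\<in>UNIV. if b \<le> a then D a b else 0)"
    by (subst sum.swap, intro sum.cong refl) (auto intro: sym)
  then have "2 * (\<Sum>a\<in>UNIV. \<Sum>b\<in>UNIV. if a \<le> b then D a b else 0) =
      (\<Sum>a\<in>UNIV. \<Sum>b\<in>UNIV. (if a \<le> b then D a b else 0) + (if b \<le> a then D a b else 0))"
    by (simp add: sum.distrib)
  also have "\<dots> = (\<Sum>a\<in>UNIV. \<Sum>b\<in>UNIV. D a b)"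
    by (intro sum.cong refl) (auto simp: diag)
  also have "\<dots> = (\<Sum>a\<in>UNIV. \<Sum>b\<in>UNIV. (x a * x a) * (y b * y b) + (y a * y a) * (x b * x b) - 2 * ((x a * y a) * (x b * y b)))"
    by (intro sum.cong refl) (simp add: D_def power2_eq_square algebra_simps)
  also have "\<dots> = 2 * ((\<Sum>a\<in>UNIV. x a * x a) * (\<Sum>a\<in>UNIV. y a * y a) - (\<Sum>a\<in>UNIV. x a * y a)\<^sup>2)"
  proof -
    have *: "(\<Sum>a\<in>UNIV. \<Sum>b\<in>UNIV. u a * v b) = sum u UNIV * sum v UNIV" for u v :: "'n \<Rightarrow> real"
      by (simp add: sum_product)
    show ?thesis
      unfolding sum_subtractf sum.distrib sum_distrib_left[symmetric, of 2] *
      by (simp add: power2_eq_square mult.commute)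
  qed
  finally show ?thesis by (simp add: D_def[symmetric] 1)
qed

lemma norm_matrix2: "(norm (X :: real^2^'n))\<^sup>2 = gram X 1 1 + gram X 2 2"
  by (simp add: power2_norm_eq_inner inner_vec_def sum_2 sum.distrib)

text \<open>The radicand is the determinant of \<open>I + X\<^sup>T X\<close>; its minors enter only
  through Lagrange's identity.\<close>

lemma area_eq:
  "area X = sqrt ((1 + gram X 1 1) * (1 + gram X 2 2) - (gram X 1 2)\<^sup>2)"
proof -
  have "1 + (norm X)\<^sup>2 + (\<Sum>a\<in>UNIV. \<Sum>b\<in>{a..}. (det (rows_minor X a b))\<^sup>2) =
      (1 + gram X 1 1) * (1 + gram X 2 2) - (gram X 1 2)\<^sup>2"
    unfolding norm_matrix2 rows_minor_def det_2
    using lagrange_identity[of "\<lambda>a. X $ a $ 1" "\<lambda>a. X $ a $ 2"]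
    by (simp add: algebra_simps)
  then show ?thesis by (simp add: area_def)
qed

lemma gram_det_ge_1: "(1 + gram X 1 1) * (1 + gram X 2 2) - (gram X 1 2)\<^sup>2 \<ge> (1 :: real)"
  for X :: "real^2^'n::{finite,linorder}"
proof -
  have "0 \<le> (\<Sum>a\<in>UNIV. \<Sum>b\<in>{a..}. (X $ a $ 1 * X $ b $ 2 - X $ a $ 2 * X $ b $ 1)\<^sup>2)"
    by (intro sum_nonneg) auto
  moreover have "gram X 1 1 \<ge> 0" "gram X 2 2 \<ge> 0" by (auto intro: sum_nonneg)
  ultimately show ?thesis
    unfolding lagrange_identity[of "\<lambda>a. X $ a $ 1" "\<lambda>a. X $ a $ 2"] by (simp add: algebra_simps)
qed

lemma area_pos: "area X \<ge> 1"
  unfolding area_eq using gram_det_ge_1[of X] by simp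

text \<open>Jacobi's formula for the square root of a determinant: the gradient is \<open>X\<close>
  times the adjugate of \<open>g = I + X\<^sup>T X\<close>, divided by
  \<open>area X\<close>.\<close>

lemma gradient_area:
  fixes X :: "real^2^'n::{finite,linorder}"
  shows "gradient area X $ a $ 1 = ((1 + gram X 2 2) * X $ a $ 1 - gram X 1 2 * X $ a $ 2) / area X"
    "gradient area X $ a $ 2 = ((1 + gram X 1 1) * X $ a $ 2 - gram X 1 2 * X $ a $ 1) / area X"
proof -
  let ?p = "gram X 1 1" and ?q = "gram X 1 2" and ?r = "gram X 2 2"
  define G :: "real^2^'n::{finite,linorder}" where
    "G = (\<chi> a. vector [((1 + ?r) * X $ a $ 1 - ?q * X $ a $ 2) / area X,
        ((1 + ?p) * X $ a $ 2 - ?q * X $ a $ 1) / area X])"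
  have nth: "((\<lambda>X :: real^2^'n::{finite,linorder}. X $ a $ i) has_derivative (\<lambda>h. h $ a $ i)) (at X)" for a i
    by (rule bounded_linear_imp_has_derivative)
      (rule bounded_linear_compose[OF bounded_linear_vec_nth bounded_linear_vec_nth])
  have gd: "((\<lambda>X :: real^2^'n::{finite,linorder}. gram X i j) has_derivative
      (\<lambda>h. \<Sum>a\<in>UNIV. X $ a $ i * h $ a $ j + h $ a $ i * X $ a $ j)) (at X)" for i j
    by (intro has_derivative_sum has_derivative_mult nth)
  let ?dg = "\<lambda>i j h. \<Sum>a\<in>UNIV. X $ a $ i * h $ a $ j + h $ a $ i * X $ a $ j"
  have Q: "((\<lambda>X :: real^2^'n::{finite,linorder}. (1 + gram X 1 1) * (1 + gram X 2 2) - gram X 1 2 * gram X 1 2) has_derivative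
      (\<lambda>h. ((1 + ?p) * (0 + ?dg 2 2 h) + (0 + ?dg 1 1 h) * (1 + ?r)) - (?q * ?dg 1 2 h + ?dg 1 2 h * ?q))) (at X)"
    by (intro has_derivative_diff has_derivative_mult has_derivative_add has_derivative_const gd)
  have pos: "(1 + ?p) * (1 + ?r) - ?q * ?q > 0" using gram_det_ge_1[of X] by (simp add: power2_eq_square)
  have A: "area X = sqrt ((1 + ?p) * (1 + ?r) - ?q * ?q)" by (simp add: area_eq power2_eq_square)
  from has_derivative_compose[OF Q DERIV_real_sqrt[OF pos, unfolded has_field_derivative_def]]
  have "((\<lambda>X. sqrt ((1 + gram X 1 1) * (1 + gram X 2 2) - gram X 1 2 * gram X 1 2)) has_derivative
     (\<lambda>h. inverse (area X) / 2 *
     (((1 + ?p) * (0 + ?dg 2 2 h) + (0 + ?dg 1 1 h) * (1 + ?r)) - (?q * ?dg 1 2 h + ?dg 1 2 h * ?q)))) (at X)"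
    by (simp only: A)
  moreover have "area = (\<lambda>X :: real^2^'n::{finite,linorder}. sqrt ((1 + gram X 1 1) * (1 + gram X 2 2) - gram X 1 2 * gram X 1 2))"
    by (simp add: fun_eq_iff area_eq power2_eq_square)
  ultimately have "(area has_derivative (\<lambda>h. inverse (area X) / 2 *
     (((1 + ?p) * (0 + ?dg 2 2 h) + (0 + ?dg 1 1 h) * (1 + ?r)) - (?q * ?dg 1 2 h + ?dg 1 2 h * ?q)))) (at X)"
    by (simp only:)
  moreover have "inverse (area X) / 2 *
     (((1 + ?p) * (0 + ?dg 2 2 h) + (0 + ?dg 1 1 h) * (1 + ?r)) - (?q * ?dg 1 2 h + ?dg 1 2 h * ?q)) = h \<bullet> G" for h
  proof -
    define s where "s i j = (\<Sum>a\<in>UNIV. X $ a $ i * h $ a $ j)" for i j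
    have dg: "?dg i j h = s i j + s j i" for i j by (simp add: s_def sum.distrib mult.commute)
    have *: "(\<Sum>a\<in>UNIV. h $ a \<bullet> (vector [(R * X $ a $ 1 - Q * X $ a $ 2) / A, (P * X $ a $ 2 - Q * X $ a $ 1) / A] :: real^2)) =
        (R * s 1 1 - Q * s 2 1 + (P * s 2 2 - Q * s 1 2)) * inverse A" for P Q R A :: real
    proof -
      have "(\<Sum>a\<in>UNIV. h $ a \<bullet> (vector [(R * X $ a $ 1 - Q * X $ a $ 2) / A, (P * X $ a $ 2 - Q * X $ a $ 1) / A] :: real^2)) =
        (\<Sum>a\<in>UNIV. (R * (X $ a $ 1 * h $ a $ 1) - Q * (X $ a $ 2 * h $ a $ 1) +
        (P * (X $ a $ 2 * h $ a $ 2) - Q * (X $ a $ 1 * h $ a $ 2))) * inverse A)"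
        by (intro sum.cong refl) (simp add: inner_vec_def sum_2 divide_inverse algebra_simps)
      then show ?thesis
        unfolding s_def sum_distrib_right[symmetric] sum.distrib sum_subtractf sum_distrib_left[symmetric] .
    qed
    have "h \<bullet> G = ((1 + ?r) * s 1 1 - ?q * s 2 1 + ((1 + ?p) * s 2 2 - ?q * s 1 2)) * inverse (area X)"
      unfolding *[symmetric] inner_vec_def[of h G] by (simp add: G_def)
    then show ?thesis unfolding dg by (simp add: algebra_simps)
  qed
  ultimately have "GDERIV area X :> G" by (simp add: gderiv_def)
  from gradient_eqI[OF this]
  show "gradient area X $ a $ 1 = ((1 + ?r) * X $ a $ 1 - ?q * X $ a $ 2) / area X"
    "gradient area X $ a $ 2 = ((1 + ?p) * X $ a $ 2 - ?q * X $ a $ 1) / area X"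
    by (simp_all add: G_def)
qed

lemma J_nth: "J $ 1 $ 1 = 0" "J $ 1 $ 2 = 1" "J $ 2 $ 1 = -1" "J $ 2 $ 2 = 0"
  by (simp_all add: J_def)

lemma mult_J: "(M ** J) $ a $ 1 = - (M $ a $ 2)" "(M ** J) $ a $ 2 = M $ a $ 1"
  by (simp_all add: matrix_matrix_mult_def sum_2 J_nth)

text \<open>The gradient \<open>D\<close> is \<open>area X\<close> times \<open>X g^(-1)\<close>, so
  \<open>X\<^sup>T D\<close> is \<open>area X\<close> times \<open>I - g^(-1)\<close>. This gives
  \<open>B = - h^(-1) J\<close> and \<open>A = X h^(-1) J\<close>. As \<open>h\<close> is symmetric
  of determinant 1, \<open>h^(-1) = - J h J\<close>, whence \<open>B = - J h\<close> and
  \<open>A = X J h\<close>, both linear in \<open>h\<close>.\<close>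

lemma inclusion_structure:
  fixes X :: "real^2^'n::{finite,linorder}"
  defines "h \<equiv> \<lambda>i j. ((if i = j then 1 else 0) + gram X i j) / area X"
  shows "B_map X $ 1 $ 1 = - h 1 2" "B_map X $ 1 $ 2 = - h 2 2"
    "B_map X $ 2 $ 1 = h 1 1" "B_map X $ 2 $ 2 = h 1 2"
    "A_map X $ a $ 1 = h 1 2 * X $ a $ 1 - h 1 1 * X $ a $ 2"
    "A_map X $ a $ 2 = h 2 2 * X $ a $ 1 - h 1 2 * X $ a $ 2"
    "h 1 1 > 0" "h 1 1 * h 2 2 - h 1 2 * h 1 2 = 1"
proof -
  let ?p = "gram X 1 1" and ?q = "gram X 1 2" and ?r = "gram X 2 2" and ?A = "area X"
  have A: "?A > 0" using area_pos[of X] by simp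
  have A2: "?A * ?A = (1 + ?p) * (1 + ?r) - ?q * ?q"
    using gram_det_ge_1[of X] by (simp add: area_eq power2_eq_square)
  show "h 1 1 > 0"
    using A sum_nonneg[of UNIV "\<lambda>a. X $ a $ 1 * X $ a $ 1"] by (simp add: h_def)
  show "h 1 1 * h 2 2 - h 1 2 * h 1 2 = 1"
  proof -
    have "h 1 1 * h 2 2 - h 1 2 * h 1 2 = ((1 + ?p) * (1 + ?r) - ?q * ?q) / (?A * ?A)"
      by (simp add: h_def diff_divide_distrib)
    then show ?thesis using A unfolding A2[symmetric] by simp
  qed
  have M: "(transpose X ** gradient area X) $ i $ j = (\<Sum>a\<in>UNIV. X $ a $ i * gradient area X $ a $ j)" for i j
    by (simp add: matrix_matrix_mult_def transpose_def)
  have s: "gram X i j = gram X j i" for i j by (simp add: mult.commute)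
  have M1: "(transpose X ** gradient area X) $ i $ 1 = ((1 + ?r) * gram X i 1 - ?q * gram X i 2) / ?A" for i
  proof -
    have "(\<Sum>a\<in>UNIV. X $ a $ i * gradient area X $ a $ 1) =
        (\<Sum>a\<in>UNIV. ((1 + ?r) * (X $ a $ i * X $ a $ 1) - ?q * (X $ a $ i * X $ a $ 2)) * inverse ?A)"
      by (intro sum.cong refl) (simp add: gradient_area divide_inverse algebra_simps)
    then show ?thesis
      unfolding M sum_distrib_right[symmetric] sum_subtractf sum_distrib_left[symmetric] by (simp add: divide_inverse)
  qed
  have M2: "(transpose X ** gradient area X) $ i $ 2 = ((1 + ?p) * gram X i 2 - ?q * gram X i 1) / ?A" for i
  proof -
    have "(\<Sum>a\<in>UNIV. X $ a $ i * gradient area X $ a $ 2) =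
        (\<Sum>a\<in>UNIV. ((1 + ?p) * (X $ a $ i * X $ a $ 2) - ?q * (X $ a $ i * X $ a $ 1)) * inverse ?A)"
      by (intro sum.cong refl) (simp add: gradient_area divide_inverse algebra_simps)
    then show ?thesis
      unfolding M sum_distrib_right[symmetric] sum_subtractf sum_distrib_left[symmetric] by (simp add: divide_inverse)
  qed
  show "B_map X $ 1 $ 1 = - h 1 2" "B_map X $ 2 $ 2 = h 1 2"
    using A by (simp_all add: B_map_def mult_J J_nth M1 M2 h_def s[of 2 1] field_simps)
  show "B_map X $ 1 $ 2 = - h 2 2" "B_map X $ 2 $ 1 = h 1 1"
    using A A2 by (simp_all add: B_map_def mult_J J_nth M1 M2 h_def s[of 2 1] field_simps)
  show "A_map X $ a $ 1 = h 1 2 * X $ a $ 1 - h 1 1 * X $ a $ 2"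
    "A_map X $ a $ 2 = h 2 2 * X $ a $ 1 - h 1 2 * X $ a $ 2"
    using A by (simp_all add: A_map_def mult_J gradient_area h_def field_simps)
qed

section \<open>Mollifying a Monge--Ampere map\<close>

lemma conv_linear:
  fixes f :: "'a::euclidean_space \<Rightarrow> 'b::{banach, second_countable_topology}"
    and L :: "'b \<Rightarrow> 'c::{banach, second_countable_topology}"
  assumes "bounded_linear L" "integrable lborel f" "test_function UNIV \<zeta>"
  shows "L (conv f \<zeta> x) = conv (\<lambda>y. L (f y)) \<zeta> x"
proof -
  interpret L: bounded_linear L by fact
  show ?thesis
    unfolding conv_def
    using integral_bounded_linear[OF assms(1) conv_integrable[OF assms(2,3)], of x]
    by (simp add: L.scaleR)
qed

lemma conv_nonneg:
  fixes f :: "'a::euclidean_space \<Rightarrow> real"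
  assumes "d > 0" "AE y in lborel. f y \<ge> 0"
  shows "conv f (moll d) x \<ge> 0"
  unfolding conv_def
  using assms(2) by (intro integral_nonneg_AE) (auto simp: moll_nonneg[OF assms(1)])

lemma conv_cong_AE:
  fixes f g :: "'a::euclidean_space \<Rightarrow> 'b::{banach, second_countable_topology}"
  assumes "integrable lborel f" "integrable lborel g" "test_function UNIV \<zeta>" "AE y in lborel. f y = g y"
  shows "conv f \<zeta> x = conv g \<zeta> x"
  unfolding conv_def
  using assms(4) conv_integrable[OF assms(1,3), of x] conv_integrable[OF assms(2,3), of x]
  by (intro integral_cong_AE) auto

text \<open>The variance of \<open>f\<close> under the probability density
  \<open>moll d (x - y)\<close> is nonnegative.\<close>

lemma conv_jensen:
  fixes f :: "'a::euclidean_space \<Rightarrow> 'b::euclidean_space"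
  assumes f: "integrable lborel f" "integrable lborel (\<lambda>x. (norm (f x))\<^sup>2)" and d: "d > 0"
  shows "(norm (conv f (moll d) x))\<^sup>2 \<le> conv (\<lambda>x. (norm (f x))\<^sup>2) (moll d) x"
proof -
  let ?c = "conv f (moll d) x" and ?m = "\<lambda>y. moll d (x - y)"
  note i1 = conv_integrable[OF f(1) test_function_moll[OF d], of x]
  note i2 = conv_integrable[OF f(2) test_function_moll[OF d], of x]
  note m = moll_translate_integral[OF d, of x]
  have i3: "integrable lborel (\<lambda>y. (?m y *\<^sub>R f y) \<bullet> ?c)"
    by (rule integrable_inner_left) (rule i1)
  have "0 \<le> (LINT y|lborel. ?m y * (norm (f y - ?c))\<^sup>2)"
    by (intro integral_nonneg_AE) (auto simp: moll_nonneg[OF d])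
  also have "\<dots> = (LINT y|lborel. ?m y *\<^sub>R (norm (f y))\<^sup>2 - 2 * ((?m y *\<^sub>R f y) \<bullet> ?c) + ?m y * (norm ?c)\<^sup>2)"
    by (intro Bochner_Integration.integral_cong refl)
      (simp add: power2_norm_eq_inner inner_diff_left inner_diff_right inner_commute algebra_simps)
  also have "\<dots> = (LINT y|lborel. ?m y *\<^sub>R (norm (f y))\<^sup>2) - 2 * (LINT y|lborel. (?m y *\<^sub>R f y) \<bullet> ?c) + (norm ?c)\<^sup>2"
    using i2 i3 m by simp
  also have "(LINT y|lborel. (?m y *\<^sub>R f y) \<bullet> ?c) = ?c \<bullet> ?c"
    using i1 by (subst integral_inner_left) (auto simp: conv_def)
  finally show ?thesis by (simp add: conv_def power2_norm_eq_inner)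
qed

lemma conv_has_derivative_matrix:
  fixes f :: "real^'d \<Rightarrow> real^'m" and G :: "real^'d \<Rightarrow> real^'d^'m"
  assumes f: "integrable lborel f" and G: "integrable lborel G"
    and w: "\<And>i j. weak_deriv S (\<lambda>x. f x $ i) (axis j 1) (\<lambda>x. G x $ i $ j)"
    and d: "d > 0" "cball x d \<subseteq> S"
  shows "(conv f (moll d) has_derivative (\<lambda>v. conv G (moll d) x *v v)) (at x)"
proof -
  note m = test_function_moll[OF d(1)]
  let ?D = "\<lambda>v. conv f (\<lambda>z. frechet_derivative (moll d) (at z) v) x"
  have D: "(conv f (moll d) has_derivative ?D) (at x)" by (rule conv_has_derivative[OF f m])
  then have lin: "linear ?D" by (rule has_derivative_linear)
  have "matrix ?D $ i $ j = conv G (moll d) x $ i $ j" for i j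
  proof -
    have fi: "integrable lborel (\<lambda>x. f x $ i)"
      by (rule integrable_bounded_linear[OF bounded_linear_vec_nth f])
    have "matrix ?D $ i $ j = conv (\<lambda>x. f x $ i) (\<lambda>z. frechet_derivative (moll d) (at z) (axis j 1)) x"
      using conv_linear[OF bounded_linear_vec_nth f test_function_derivative[OF m]] by (simp add: matrix_def)
    also have "\<dots> = frechet_derivative (conv (\<lambda>x. f x $ i) (moll d)) (at x) (axis j 1)"
      using fun_cong[OF frechet_derivative_at[OF conv_has_derivative[OF fi m]], of "axis j 1" x] .
    also have "\<dots> = conv (\<lambda>x. G x $ i $ j) (moll d) x"
      by (rule conv_moll_weak_deriv[OF fi w d])
    also have "\<dots> = conv G (moll d) x $ i $ j"
      by (rule conv_linear[OF bounded_linear_compose[OF bounded_linear_vec_nth bounded_linear_vec_nth] G m, symmetric])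
    finally show ?thesis .
  qed
  then have "matrix ?D = conv G (moll d) x" by (simp add: vec_eq_iff)
  then have "?D = (\<lambda>v. conv G (moll d) x *v v)"
    using matrix_works[OF lin[folded linear_matrix_vector_mul_eq]] by (simp add: fun_eq_iff)
  with D show ?thesis by simp
qed

text \<open>Completing the square after multiplication by the positive entry
  \<open>A $ 1 $ 1\<close>.\<close>

lemma quadratic_form_nonneg:
  fixes A :: "real^2^2"
  assumes "A $ 1 $ 2 = A $ 2 $ 1" "A $ 1 $ 1 > 0" "det A = 1"
  shows "v \<bullet> (A *v v) \<ge> 0"
proof -
  let ?a = "A $ 1 $ 1" and ?b = "A $ 1 $ 2" and ?c = "A $ 2 $ 2"
  have d: "?a * ?c - ?b * ?b = 1" using assms by (simp add: det_2)
  have "?a * (v \<bullet> (A *v v)) = (?a * v $ 1 + ?b * v $ 2)\<^sup>2 + (?a * ?c - ?b * ?b) * (v $ 2)\<^sup>2"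
    using assms(1)[symmetric]
    by (simp add: inner_vec_def matrix_vector_mult_def sum_2 power2_eq_square algebra_simps)
  also have "\<dots> \<ge> 0" unfolding d by simp
  finally show ?thesis using assms(2) by (simp add: zero_le_mult_iff)
qed

lemma abs_det_le: "\<bar>det (A :: real^2^2)\<bar> \<le> (norm A)\<^sup>2"
proof -
  have n: "(norm A)\<^sup>2 = (A$1$1)\<^sup>2 + (A$1$2)\<^sup>2 + ((A$2$1)\<^sup>2 + (A$2$2)\<^sup>2)"
    unfolding power2_norm_eq_inner by (simp add: inner_vec_def sum_2 power2_eq_square)
  have xy: "\<bar>x * y\<bar> \<le> (x\<^sup>2 + y\<^sup>2) / 2" for x y :: real
    using zero_le_power2[of "\<bar>x\<bar> - \<bar>y\<bar>"] by (simp add: power2_diff abs_mult)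
  show ?thesis unfolding n det_2 using xy[of "A$1$1" "A$2$2"] xy[of "A$1$2" "A$2$1"]
      sum_power2_ge_zero[of "A$1$1" "A$1$2"] sum_power2_ge_zero[of "A$2$1" "A$2$2"]
      abs_triangle_ineq4[of "A$1$1 * A$2$2" "A$1$2 * A$2$1"]
    by argo
qed

lemma det_id_plus: "det (mat 1 + (A :: real^2^2)) = 1 + (A$1$1 + A$2$2) + det A"
  by (simp add: det_2 mat_def algebra_simps)

text \<open>As \<open>H\<close> is 0 off \<open>S\<close>, it is symmetric and positive semidefinite
  almost everywhere in the plane, and its mollifications are so at every point. The determinant
  equation is confined to \<open>S\<close> and is not inherited; the square integrability of
  \<open>H\<close> makes up for that.\<close>

locale monge_ampere =
  fixes S :: "(real^2) set" and \<phi> :: "real^2 \<Rightarrow> real^2" and H :: "real^2 \<Rightarrow> real^2^2"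
  assumes S: "open S" "bounded S"
    and \<phi>_int: "integrable lborel \<phi>" and H_int: "integrable lborel H"
    and H2_int: "integrable lborel (\<lambda>x. (norm (H x))\<^sup>2)"
    and weak: "\<And>i j. weak_deriv S (\<lambda>x. \<phi> x $ i) (axis j 1) (\<lambda>x. H x $ i $ j)"
    and ma: "AE x in lborel. x \<in> S \<longrightarrow> H x $ 1 $ 2 = H x $ 2 $ 1 \<and> H x $ 1 $ 1 > 0 \<and> det (H x) = 1"
    and H_off: "\<And>x. x \<notin> S \<Longrightarrow> H x = 0"
begin

definition P :: "real \<Rightarrow> real^2 \<Rightarrow> real^2" where
  "P d x = x + conv \<phi> (moll d) x"

definition M :: "real \<Rightarrow> real^2 \<Rightarrow> real^2^2" where
  "M d x = conv H (moll d) x"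

lemma P_derivative:
  assumes "d > 0" "cball x d \<subseteq> S"
  shows "(P d has_derivative (\<lambda>v. v + M d x *v v)) (at x)"
  unfolding P_def[abs_def] M_def
  by (intro has_derivative_add has_derivative_ident
      conv_has_derivative_matrix[OF \<phi>_int H_int weak assms])

lemma M_continuous: "d > 0 \<Longrightarrow> continuous_on UNIV (M d)"
  unfolding M_def[abs_def]
  using smooth_on_continuous[OF conv_smooth[OF H_int test_function_moll]] .

lemma M_entry: "d > 0 \<Longrightarrow> M d x $ i $ j = conv (\<lambda>x. H x $ i $ j) (moll d) x"
  unfolding M_def
  using conv_linear[OF bounded_linear_compose[OF bounded_linear_vec_nth bounded_linear_vec_nth] H_int test_function_moll] .

lemma entry_int: "integrable lborel (\<lambda>x. H x $ i $ j)"
  by (rule integrable_bounded_linear[OF bounded_linear_compose[OF bounded_linear_vec_nth bounded_linear_vec_nth] H_int])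

lemma M_sym: "d > 0 \<Longrightarrow> M d x $ 1 $ 2 = M d x $ 2 $ 1"
proof -
  assume d: "d > 0"
  have "AE y in lborel. H y $ 1 $ 2 = H y $ 2 $ 1"
    using ma by eventually_elim (use H_off in force)
  then show ?thesis
    unfolding M_entry[OF d] by (intro conv_cong_AE entry_int test_function_moll[OF d])
qed

text \<open>For fixed \<open>v\<close> the quadratic form is linear in the matrix, so it commutes
  with averaging.\<close>

lemma M_nonneg: "d > 0 \<Longrightarrow> v \<bullet> (M d x *v v) \<ge> 0"
proof -
  assume d: "d > 0"
  have bl: "bounded_linear (\<lambda>A :: real^2^2. v \<bullet> (A *v v))"
    by (intro linear_conv_bounded_linear[THEN iffD1] linearI)
      (simp_all add: matrix_vector_mult_add_rdistrib inner_add_right scaleR_matrix_vector_assoc[symmetric])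
  have "v \<bullet> (M d x *v v) = conv (\<lambda>y. v \<bullet> (H y *v v)) (moll d) x"
    unfolding M_def by (rule conv_linear[OF bl H_int test_function_moll[OF d]])
  also have "\<dots> \<ge> 0"
  proof (rule conv_nonneg[OF d])
    show "AE y in lborel. v \<bullet> (H y *v v) \<ge> 0"
      using ma
    proof eventually_elim
      case (elim y)
      then show ?case using quadratic_form_nonneg[of "H y" v] H_off[of y] by (cases "y \<in> S") auto
    qed
  qed
  finally show ?thesis .
qed

lemma det_M_le: "d > 0 \<Longrightarrow> \<bar>det (M d x)\<bar> \<le> conv (\<lambda>x. (norm (H x))\<^sup>2) (moll d) x"
  using abs_det_le[of "M d x"] conv_jensen[OF H_int H2_int, of d x] by (simp add: M_def)

text \<open>\<open>P d\<close> is the identity plus a monotone map, hence expanding.\<close>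
lemma P_expanding:
  assumes d: "d > 0" and C: "convex C" "\<And>z. z \<in> C \<Longrightarrow> cball z d \<subseteq> S" and x: "x \<in> C" "x' \<in> C"
  shows "(P d x - P d x') \<bullet> (x - x') \<ge> (norm (x - x'))\<^sup>2"
proof -
  let ?u = "x - x'"
  define g where "g t = P d (x' + t *\<^sub>R ?u) \<bullet> ?u" for t
  have seg: "x' + t *\<^sub>R ?u \<in> C" if "0 \<le> t" "t \<le> 1" for t
  proof -
    have "x' + t *\<^sub>R ?u = (1 - t) *\<^sub>R x' + t *\<^sub>R x" by (simp add: algebra_simps)
    then show ?thesis using convexD[OF C(1) x(2,1), of "1 - t" t] that by simp
  qed
  have der: "(g has_real_derivative (?u + M d (x' + t *\<^sub>R ?u) *v ?u) \<bullet> ?u) (at t)" if "0 \<le> t" "t \<le> 1" for t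
  proof -
    have "((\<lambda>t. x' + t *\<^sub>R ?u) has_derivative (\<lambda>s. s *\<^sub>R ?u)) (at t)"
      by (auto intro!: derivative_eq_intros)
    from has_derivative_compose[OF this P_derivative[OF d C(2)[OF seg[OF that]]]]
    have "((\<lambda>t. P d (x' + t *\<^sub>R ?u)) has_derivative (\<lambda>s. s *\<^sub>R (?u + M d (x' + t *\<^sub>R ?u) *v ?u))) (at t)"
      by (simp add: matrix_vector_mult_scaleR scaleR_add_right)
    from has_derivative_inner_left[OF this, of ?u]
    show ?thesis unfolding g_def[abs_def] has_field_derivative_def by (simp add: mult_commute_abs)
  qed
  obtain t where t: "0 < t" "t < 1" "g 1 - g 0 = (1 - 0) * ((?u + M d (x' + t *\<^sub>R ?u) *v ?u) \<bullet> ?u)"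
    using MVT2[of 0 1 g "\<lambda>t. (?u + M d (x' + t *\<^sub>R ?u) *v ?u) \<bullet> ?u"] der by auto
  have "g 1 - g 0 = (P d x - P d x') \<bullet> ?u" by (simp add: g_def inner_diff_left)
  moreover have "(?u + M d (x' + t *\<^sub>R ?u) *v ?u) \<bullet> ?u \<ge> (norm ?u)\<^sup>2"
    using M_nonneg[OF d, of ?u] by (subst inner_commute) (simp add: inner_add_right power2_norm_eq_inner)
  ultimately show ?thesis using t(3) by simp
qed

lemma trace_nonneg: "d > 0 \<Longrightarrow> M d x $ 1 $ 1 \<ge> 0" "d > 0 \<Longrightarrow> M d x $ 2 $ 2 \<ge> 0"
  using M_nonneg[of d "axis 1 1" x] M_nonneg[of d "axis 2 1" x]
  by (simp_all add: inner_axis' matrix_vector_mult_basis column_def)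

lemma det_nonneg: "d > 0 \<Longrightarrow> det (M d x) \<ge> 0"
proof -
  assume d: "d > 0"
  let ?a = "M d x $ 1 $ 1" and ?b = "M d x $ 1 $ 2" and ?c = "M d x $ 2 $ 2"
  have q: "?a * s\<^sup>2 + 2 * ?b * s * t + ?c * t\<^sup>2 \<ge> 0" for s t
    using M_nonneg[OF d, of "vector [s, t]" x] M_sym[OF d, of x]
    by (simp add: inner_vec_def matrix_vector_mult_def sum_2 power2_eq_square algebra_simps)
  have "?a * ?c - ?b * ?b \<ge> 0"
  proof (cases "?c = 0")
    case True
    have "?b = 0"
    proof (rule ccontr)
      assume "?b \<noteq> 0"
      \<comment> \<open>This vector gives the form the value \<open>?a - (?a + 1)\<close>, which is
        -1.\<close>
      then show False using q[of 1 "- (?a + 1) / (2 * ?b)"] True trace_nonneg(1)[OF d, of x]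
        by (simp add: field_simps)
    qed
    then show ?thesis using True by simp
  next
    case False
    then have c: "?c > 0" using trace_nonneg(2)[OF d, of x] by simp
    \<comment> \<open>The form at the vector with entries \<open>?c\<close> and \<open>- ?b\<close>
      is \<open>?c\<close> times the determinant.\<close>
    have "?c * (?a * ?c - ?b * ?b) \<ge> 0"
      using q[of ?c "- ?b"] by (simp add: power2_eq_square algebra_simps)
    then show ?thesis using c by (simp add: zero_le_mult_iff)
  qed
  then show ?thesis using M_sym[OF d, of x] by (simp add: det_2)
qed

lemma det_P_pos: "d > 0 \<Longrightarrow> det (mat 1 + M d x) > 0"
  using trace_nonneg[of d x] det_nonneg[of d x] by (simp add: det_id_plus)

text \<open>The mollified determinants are dominated by \<open>norm H\<^sup>2 * moll\<close>, which converges in \<open>L\<^sup>1\<close>, and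
  converge pointwise; splitting off the excess over the limit of the dominating functions leaves a
  fixed dominating function.\<close>
lemma det_M_tendsto_L1:
  assumes d: "\<And>k. d k > 0" "d \<longlonglongrightarrow> 0"
    and lim: "AE x in lborel. x \<in> S \<longrightarrow> (\<lambda>k. M (d k) x) \<longlonglongrightarrow> H x"
  shows "\<And>k. set_integrable lborel S (\<lambda>x. det (M (d k) x) - 1)"
    "(\<lambda>k. LINT x|lborel. indicator S x * \<bar>det (M (d k) x) - 1\<bar>) \<longlonglongrightarrow> 0"
proof -
  let ?G = "\<lambda>x. (norm (H x))\<^sup>2"
  let ?Gk = "\<lambda>k. conv ?G (moll (d k))"
  have [measurable]: "S \<in> sets borel" using S(1) by simp
  have [measurable]: "H \<in> borel_measurable borel" using H_int by simp
  have Sfin: "emeasure lborel S < \<infinity>" using emeasure_bounded_finite[OF S(2)] by (simp add: top.not_eq_extremum)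
  have iS: "integrable lborel (\<lambda>x. indicator S x :: real)" using Sfin by simp
  have Mm [measurable]: "M (d k) \<in> borel_measurable borel" for k
    by (rule borel_measurable_continuous_onI[OF M_continuous[OF d(1)]])
  have dm [measurable]: "(\<lambda>x. det (M (d k) x)) \<in> borel_measurable borel" for k
    by (rule borel_measurable_continuous_onI)
      (use M_continuous[OF d(1)] in \<open>auto simp: det_2 intro!: continuous_intros\<close>)
  note Gi = conv_moll_norm(1)[OF H2_int d(1)]
  have iSG: "integrable lborel (\<lambda>x. indicator S x * g x)" if "integrable lborel g" for g :: "real^2 \<Rightarrow> real"
    using integrable_real_mult_indicator[OF _ that, of S] by (simp add: mult.commute)
  have bd: "\<bar>det (M (d k) x) - 1\<bar> \<le> ?Gk k x + 1" for k x
    using det_M_le[OF d(1), of k x] by linarith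
  have Gk0: "?Gk k x \<ge> 0" for k x by (rule conv_nonneg[OF d(1)]) auto
  show si: "set_integrable lborel S (\<lambda>x. det (M (d k) x) - 1)" for k
    unfolding set_integrable_def
  proof (rule Bochner_Integration.integrable_bound)
    show "integrable lborel (\<lambda>x. indicator S x * (?Gk k x) + indicator S x)"
      using iSG[OF Gi] iS by (intro Bochner_Integration.integrable_add)
    show "AE x in lborel. norm (indicator S x *\<^sub>R (det (M (d k) x) - 1)) \<le> norm (indicator S x * ?Gk k x + indicator S x)"
      using bd Gk0 by (auto intro!: AE_I2 simp: indicator_def)
  qed measurable
  define s where "s k x = indicator S x * min \<bar>det (M (d k) x) - 1\<bar> (?G x + 1)" for k x
  have sI: "(\<lambda>k. LINT x|lborel. s k x) \<longlonglongrightarrow> (LINT x|(lborel :: (real^2) measure). (0::real))"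
  proof (rule integral_dominated_convergence[where w = "\<lambda>x. indicator S x * ?G x + indicator S x"])
    show "integrable lborel (\<lambda>x. indicator S x * ?G x + indicator S x)"
      using iSG[OF H2_int] iS by (intro Bochner_Integration.integrable_add)
    show "AE x in lborel. norm (s k x) \<le> indicator S x * ?G x + indicator S x" for k
      by (auto intro!: AE_I2 simp: indicator_def s_def)
    show "AE x in lborel. (\<lambda>k. s k x) \<longlonglongrightarrow> 0"
      using lim ma
    proof eventually_elim
      case (elim x)
      show ?case
      proof (cases "x \<in> S")
        case True
        then have "(\<lambda>k. det (M (d k) x)) \<longlonglongrightarrow> det (H x)"
          unfolding det_2 using elim by (intro tendsto_intros) auto
        then have "(\<lambda>k. min \<bar>det (M (d k) x) - 1\<bar> (?G x + 1)) \<longlonglongrightarrow> min \<bar>det (H x) - 1\<bar> (?G x + 1)"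
          by (intro tendsto_intros)
        then show ?thesis using True elim by (simp add: s_def)
      qed (simp add: s_def)
    qed
    show "s k \<in> borel_measurable lborel" for k unfolding s_def by measurable
  qed auto
  have si': "integrable lborel (s k)" for k
  proof (rule Bochner_Integration.integrable_bound)
    show "integrable lborel (\<lambda>x. indicator S x * ?G x + indicator S x)"
      using iSG[OF H2_int] iS by (intro Bochner_Integration.integrable_add)
    show "AE x in lborel. norm (s k x) \<le> norm (indicator S x * ?G x + indicator S x)"
      by (auto intro!: AE_I2 simp: indicator_def s_def)
    show "s k \<in> borel_measurable lborel" unfolding s_def by measurable
  qed
  let ?e = "\<lambda>k x. indicator S x * norm (?Gk k x - ?G x)"
  have eI: "(\<lambda>k. LINT x|lborel. ?e k x) \<longlonglongrightarrow> 0"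
    by (rule conv_moll_tendsto_L1[OF H2_int S(2) _ d]) measurable
  have ie: "integrable lborel (?e k)" for k
    using Gi H2_int by (intro iSG) auto
  have le: "(LINT x|lborel. indicator S x * \<bar>det (M (d k) x) - 1\<bar>) \<le> (LINT x|lborel. s k x) + (LINT x|lborel. ?e k x)" for k
  proof -
    have "(LINT x|lborel. indicator S x * \<bar>det (M (d k) x) - 1\<bar>) \<le> (LINT x|lborel. s k x + ?e k x)"
    proof (rule integral_mono)
      show "integrable lborel (\<lambda>x. indicator S x * \<bar>det (M (d k) x) - 1\<bar>)"
        using integrable_abs[OF si[of k, unfolded set_integrable_def]] by (simp add: abs_mult)
      show "indicator S x * \<bar>det (M (d k) x) - 1\<bar> \<le> s k x + ?e k x" for x
        using bd[of k x] by (cases "x \<in> S") (auto simp: s_def min_def)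
    qed (use si' ie in auto)
    also have "\<dots> = (LINT x|lborel. s k x) + (LINT x|lborel. ?e k x)"
      by (intro Bochner_Integration.integral_add si' ie)
    finally show ?thesis .
  qed
  show "(\<lambda>k. LINT x|lborel. indicator S x * \<bar>det (M (d k) x) - 1\<bar>) \<longlonglongrightarrow> 0"
  proof (rule tendsto_sandwich[OF _ _ tendsto_const])
    show "\<forall>\<^sub>F k in sequentially. 0 \<le> (LINT x|lborel. indicator S x * \<bar>det (M (d k) x) - 1\<bar>)"
      by (auto intro!: always_eventually integral_nonneg_AE)
    show "\<forall>\<^sub>F k in sequentially. (LINT x|lborel. indicator S x * \<bar>det (M (d k) x) - 1\<bar>) \<le>
        (LINT x|lborel. s k x) + (LINT x|lborel. ?e k x)"
      using le by (auto intro!: always_eventually)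
    show "(\<lambda>k. (LINT x|lborel. s k x) + (LINT x|lborel. ?e k x)) \<longlonglongrightarrow> 0"
      using tendsto_add[OF sI eI] by simp
  qed
qed

end

section \<open>The inverses of the mollified maps\<close>

text \<open>Adjugate over determinant, so that entries can be read off; a singular matrix is sent to
  0.\<close>

definition inv2 :: "real^2^2 \<Rightarrow> real^2^2" where
  "inv2 A = (1 / det A) *\<^sub>R vector [vector [A $ 2 $ 2, - (A $ 1 $ 2)], vector [- (A $ 2 $ 1), A $ 1 $ 1]]"

lemma inv2_nth:
  "inv2 A $ 1 $ 1 = A $ 2 $ 2 / det A" "inv2 A $ 1 $ 2 = - (A $ 1 $ 2) / det A"
  "inv2 A $ 2 $ 1 = - (A $ 2 $ 1) / det A" "inv2 A $ 2 $ 2 = A $ 1 $ 1 / det A"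
  by (simp_all add: inv2_def)

lemma inv2_mult: "det A \<noteq> 0 \<Longrightarrow> inv2 A ** A = mat 1" "det A \<noteq> 0 \<Longrightarrow> A ** inv2 A = mat 1"
proof -
  assume "det A \<noteq> 0"
  moreover have "A $ 1 $ 1 * A $ 2 $ 2 - A $ 1 $ 2 * A $ 2 $ 1 = det A" by (simp add: det_2)
  ultimately show "inv2 A ** A = mat 1" "A ** inv2 A = mat 1"
    by (simp_all add: vec_eq_iff forall_2 matrix_matrix_mult_def sum_2 inv2_nth mat_def)
      (simp_all add: divide_simps mult.commute)
qed

lemma norm_le_of_firm:
  fixes u v :: "'a::real_inner"
  assumes "u \<bullet> v \<ge> (norm v)\<^sup>2"
  shows "norm v \<le> norm u"
proof (cases "v = 0")
  case False
  have "norm v * norm v \<le> norm u * norm v"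
    using assms norm_cauchy_schwarz[of u v] by (simp add: power2_eq_square)
  then show ?thesis using False by simp
qed simp

locale monge_ampere_at = monge_ampere +
  fixes x0 :: "real^2" and R :: real
  assumes R: "R > 0" "cball x0 (2 * R) \<subseteq> S"
begin

lemma cball_in: "d \<le> R \<Longrightarrow> z \<in> cball x0 R \<Longrightarrow> cball z d \<subseteq> S"
proof
  fix w assume "d \<le> R" "z \<in> cball x0 R" "w \<in> cball z d"
  then have "w \<in> cball x0 (2 * R)" using dist_triangle[of x0 w z] by simp
  then show "w \<in> S" using R(2) by blast
qed

lemma P_expanding':
  assumes "0 < d" "d \<le> R" "x \<in> cball x0 R" "x' \<in> cball x0 R"
  shows "(P d x - P d x') \<bullet> (x - x') \<ge> (norm (x - x'))\<^sup>2"
  using P_expanding[OF assms(1) convex_cball cball_in[OF assms(2)] assms(3,4)] .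

text \<open>The distance of \<open>P d\<close> to \<open>y\<close> attains a minimum on the closed
  ball. Expansion keeps the minimiser \<open>x\<close> inside: \<open>norm (x - x0)\<close> is at
  most the sum of the distances of \<open>P d x\<close> and \<open>P d x0\<close> from
  \<open>y\<close>, each below \<open>R / 2\<close>. At an interior critical point, the direction
  \<open>P d x - y\<close> and the nonnegativity of \<open>M d x\<close> force the distance to be
  0.\<close>

lemma P_surj:
  assumes d: "0 < d" "d \<le> R" and y: "y \<in> ball (P d x0) (R / 2)"
  shows "\<exists>x\<in>ball x0 R. P d x = y"
proof -
  let ?f = "\<lambda>x. (P d x - y) \<bullet> (P d x - y)"
  have Pd: "(P d has_derivative (\<lambda>v. v + M d x *v v)) (at x)" if "x \<in> cball x0 R" for x
    by (rule P_derivative[OF d(1) cball_in[OF d(2) that]])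
  have "isCont (P d) x" if "x \<in> cball x0 R" for x using Pd[OF that] has_derivative_continuous by blast
  then have "continuous_on (cball x0 R) (P d)" by (simp add: continuous_at_imp_continuous_on)
  then have "continuous_on (cball x0 R) ?f" by (intro continuous_intros)
  then obtain x where x: "x \<in> cball x0 R" "\<And>z. z \<in> cball x0 R \<Longrightarrow> ?f x \<le> ?f z"
    using continuous_attains_inf[of "cball x0 R" ?f] R(1) by auto
  have x0: "x0 \<in> cball x0 R" using R by simp
  have "norm (P d x - y) \<le> norm (P d x0 - y)"
    using x(2)[OF x0] by (simp add: norm_le)
  moreover have "norm (P d x0 - y) < R / 2" using y by (simp add: dist_norm)
  moreover have "norm (x - x0) \<le> norm (P d x - P d x0)"
    by (rule norm_le_of_firm) (rule P_expanding'[OF d x(1) x0])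
  moreover have "norm (P d x - P d x0) \<le> norm (P d x - y) + norm (P d x0 - y)"
    using norm_triangle_ineq4[of "P d x - y" "P d x0 - y"] by simp
  ultimately have xb: "x \<in> ball x0 R" by (simp add: dist_norm norm_minus_commute)
  have "(?f has_derivative (\<lambda>v. (P d x - y) \<bullet> (v + M d x *v v) + (v + M d x *v v) \<bullet> (P d x - y))) (at x)"
    by (rule has_derivative_inner; intro has_derivative_diff[OF Pd[OF x(1)] has_derivative_const, simplified])
  then have "(\<lambda>v. (P d x - y) \<bullet> (v + M d x *v v) + (v + M d x *v v) \<bullet> (P d x - y)) = (\<lambda>v. 0)"
    using x(2) by (intro differential_zero_maxmin[OF xb open_ball]) auto
  from fun_cong[OF this, of "P d x - y"]
  have "(P d x - y) \<bullet> (P d x - y) + (P d x - y) \<bullet> (M d x *v (P d x - y)) = 0"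
    by (simp add: inner_add_left inner_add_right inner_commute)
  then have "(P d x - y) \<bullet> (P d x - y) \<le> 0" using M_nonneg[OF d(1), of "P d x - y" x] by linarith
  then have "P d x - y = 0" by (meson inner_gt_zero_iff not_le)
  then have "P d x = y" by simp
  then show ?thesis using xb by blast
qed

definition psi :: "real \<Rightarrow> real^2 \<Rightarrow> real^2" where
  "psi d = inv_into (ball x0 R) (P d)"

lemma psi:
  assumes "0 < d" "d \<le> R" "y \<in> ball (P d x0) (R / 2)"
  shows "psi d y \<in> ball x0 R" "P d (psi d y) = y"
proof -
  have "y \<in> P d ` ball x0 R" using P_surj[OF assms] by blast
  then show "psi d y \<in> ball x0 R" "P d (psi d y) = y"
    unfolding psi_def by (rule inv_into_into, rule f_inv_into_f)
qed

lemma psi_P: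
  assumes d: "0 < d" "d \<le> R" and x: "x \<in> ball x0 R"
  shows "psi d (P d x) = x"
proof -
  have "inj_on (P d) (ball x0 R)"
  proof (rule inj_onI)
    fix x x' assume "x \<in> ball x0 R" "x' \<in> ball x0 R" "P d x = P d x'"
    then have "(norm (x - x'))\<^sup>2 \<le> 0" using P_expanding'[OF d, of x x'] by simp
    then show "x = x'" by simp
  qed
  then show ?thesis unfolding psi_def using x by (rule inv_into_f_f)
qed

text \<open>The expanding estimate read through the inverse: firm nonexpansiveness. It is uniform in
  \<open>d\<close> and closed under pointwise limits, so the limit map inherits it.\<close>

lemma psi_firm:
  assumes d: "0 < d" "d \<le> R" and y: "y \<in> ball (P d x0) (R / 2)" "y' \<in> ball (P d x0) (R / 2)"
  shows "(y - y') \<bullet> (psi d y - psi d y') \<ge> (norm (psi d y - psi d y'))\<^sup>2"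
  using P_expanding'[OF d, of "psi d y" "psi d y'"] psi[OF d y(1)] psi[OF d y(2)] by simp

lemma psi_lipschitz:
  assumes d: "0 < d" "d \<le> R" and y: "y \<in> ball (P d x0) (R / 2)" "y' \<in> ball (P d x0) (R / 2)"
  shows "norm (psi d y - psi d y') \<le> norm (y - y')"
  by (rule norm_le_of_firm) (rule psi_firm[OF assms])

lemma psi_continuous:
  assumes d: "0 < d" "d \<le> R"
  shows "continuous_on (ball (P d x0) (R / 2)) (psi d)"
  unfolding continuous_on_iff
proof (intro ballI allI impI)
  fix y e assume "y \<in> ball (P d x0) (R / 2)" "(0::real) < e"
  then show "\<exists>t>0. \<forall>y'\<in>ball (P d x0) (R / 2). dist y' y < t \<longrightarrow> dist (psi d y') (psi d y) < e"
    by (intro exI[of _ e]) (auto simp: dist_norm intro!: psi_lipschitz[OF d, THEN le_less_trans])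
qed

lemma psi_derivative:
  assumes d: "0 < d" "d \<le> R" and y: "y \<in> ball (P d x0) (R / 2)"
  shows "(psi d has_derivative (\<lambda>v. inv2 (mat 1 + M d (psi d y)) *v v)) (at y)"
proof (rule has_derivative_inverse_basic[where T = "ball (P d x0) (R / 2)" and f = "P d" and f' = "\<lambda>v. (mat 1 + M d (psi d y)) *v v"])
  let ?A = "mat 1 + M d (psi d y)"
  have "psi d y \<in> cball x0 R" using psi(1)[OF assms] by auto
  from P_derivative[OF d(1) cball_in[OF d(2) this]]
  show "(P d has_derivative (\<lambda>v. ?A *v v)) (at (psi d y))"
    by (simp add: matrix_vector_mult_add_rdistrib)
  show "bounded_linear ((*v) (inv2 ?A))" by (rule matrix_vector_mul_bounded_linear)
  have "det ?A \<noteq> 0" using det_P_pos[OF d(1), of "psi d y"] by simp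
  then show "(*v) (inv2 ?A) \<circ> (*v) ?A = id"
    by (simp add: fun_eq_iff matrix_vector_mul_assoc inv2_mult)
  show "continuous (at y) (psi d)"
    using psi_continuous[OF d] y continuous_on_eq_continuous_at open_ball by blast
qed (use y psi(2)[OF d] in auto)

lemma dense_convergence:
  assumes "AE x in lborel. x \<in> S \<longrightarrow> Q x" "c \<in> S" "e > 0"
  obtains p where "Q p" "dist p c < e"
proof -
  have "open (S \<inter> ball c e)" "S \<inter> ball c e \<noteq> {}" using S(1) assms by (auto intro: open_Int)
  then have n: "\<not> negligible (S \<inter> ball c e)" using open_not_negligible by blast
  have "\<exists>x\<in>S \<inter> ball c e. Q x"
  proof (rule ccontr)
    assume "\<not> ?thesis"
    with assms(1) have "AE x in lborel. x \<notin> S \<inter> ball c e" by (auto elim: AE_mp intro: AE_I2)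
    then have "S \<inter> ball c e \<in> null_sets lborel" using S(1) by (subst AE_iff_null_sets) auto
    then show False using n negligible_iff_null_sets null_sets_completionI by blast
  qed
  then show ?thesis using that by (auto simp: dist_commute)
qed

text \<open>Convergence almost everywhere says nothing about the single point \<open>x0\<close>;
  monotonicity does. Comparison with points of convergence near
  \<open>x0 + (R / 2) *\<^sub>R b\<close>, for the four signed unit vectors \<open>b\<close>, bounds
  each component of \<open>P (d k) x0\<close>.\<close>

lemma P_bounded:
  assumes d: "\<And>k. 0 < d k" "\<And>k. d k \<le> R"
    and lim: "AE x in lborel. x \<in> S \<longrightarrow> (\<lambda>k. P (d k) x) \<longlonglongrightarrow> L x"
  shows "\<exists>B. \<forall>k. norm (P (d k) x0) \<le> B"
proof -
  have "\<exists>C p. dist p (x0 + (R / 2) *\<^sub>R b) < R / 20 \<and> (\<forall>k. norm (P (d k) p) \<le> C)"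
    if "norm b = 1" for b :: "real^2"
  proof -
    have "x0 + (R / 2) *\<^sub>R b \<in> S" using R that by (auto intro!: subsetD[OF R(2)] simp: dist_norm)
    then obtain p where p: "(\<lambda>k. P (d k) p) \<longlonglongrightarrow> L p" "dist p (x0 + (R / 2) *\<^sub>R b) < R / 20"
      using dense_convergence[OF lim, of "x0 + (R / 2) *\<^sub>R b" "R / 20"] R by auto
    have "Bseq (\<lambda>k. P (d k) p)" using p(1) convergentI convergent_imp_Bseq by blast
    then show ?thesis using p(2) by (auto simp: Bseq_def)
  qed
  then obtain C p where p: "\<And>b :: real^2. norm b = 1 \<Longrightarrow> dist (p b) (x0 + (R / 2) *\<^sub>R b) < R / 20"
      "\<And>b k. norm b = 1 \<Longrightarrow> norm (P (d k) (p b)) \<le> C b" by metis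
  have key: "(R / 2) * (P (d k) x0 \<bullet> b) \<le> R * C b + (R / 20) * norm (P (d k) x0)" if b: "norm b = 1" for k b
  proof -
    let ?z = "P (d k) x0" and ?w = "p b - (x0 + (R / 2) *\<^sub>R b)"
    have pe: "p b - x0 = (R / 2) *\<^sub>R b + ?w" by simp
    have w: "norm ?w \<le> R / 20" using p(1)[OF b] by (simp add: dist_norm)
    have "norm (p b - x0) \<le> norm ((R / 2) *\<^sub>R b) + norm ?w" unfolding pe by (rule norm_triangle_ineq)
    then have nR: "norm (p b - x0) \<le> R" using w b R(1) by simp
    then have "p b \<in> cball x0 R" by (simp add: dist_norm norm_minus_commute)
    then have "0 \<le> (?z - P (d k) (p b)) \<bullet> (x0 - p b)"
      using P_expanding'[OF d(1)[of k] d(2), of x0 "p b"] R(1) order_trans[OF zero_le_power2] by auto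
    then have "?z \<bullet> (p b - x0) \<le> P (d k) (p b) \<bullet> (p b - x0)"
      by (simp add: inner_diff_left inner_diff_right)
    also have "\<dots> \<le> norm (P (d k) (p b)) * norm (p b - x0)" by (rule norm_cauchy_schwarz)
    also have "\<dots> \<le> C b * R" using p(2)[OF b, of k] nR norm_ge_zero order_trans by (intro mult_mono) blast+
    finally have "(R / 2) * (?z \<bullet> b) + ?z \<bullet> ?w \<le> R * C b"
      unfolding pe by (simp only: inner_add_right inner_scaleR_right mult.commute)
    moreover have "- (?z \<bullet> ?w) \<le> norm ?z * norm ?w"
      using Cauchy_Schwarz_ineq2[of ?z ?w] by linarith
    moreover have "norm ?z * norm ?w \<le> norm ?z * (R / 20)" by (rule mult_left_mono[OF w norm_ge_zero])
    ultimately show ?thesis by (simp add: mult.commute)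
  qed
  define C' where "C' = max (max (C (axis 1 1)) (C (- axis 1 1))) (max (C (axis 2 1)) (C (- axis 2 1)))"
  \<comment> \<open>The displacement errors of size \<open>R / 20\<close> for the two components
    leave \<open>(R / 2 - R / 10) * norm ?z \<le> 2 * R * C'\<close>, whence the constant 5.\<close>
  have "norm (P (d k) x0) \<le> 5 * C'" for k
  proof -
    let ?z = "P (d k) x0"
    have cmp: "(R / 2) * \<bar>?z $ i\<bar> \<le> R * C' + (R / 20) * norm ?z" if i: "i = 1 \<or> i = 2" for i :: 2
    proof -
      have n: "norm (axis i (1 :: real) :: real^2) = 1" "norm (- axis i (1 :: real) :: real^2) = 1"
        by simp_all
      have "C (axis i 1) \<le> C'" "C (- axis i 1) \<le> C'" using i by (auto simp: C'_def)
      then have "R * C (axis i 1) \<le> R * C'" "R * C (- axis i 1) \<le> R * C'" using R(1) by auto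
      moreover note key[OF n(1), of k] key[OF n(2), of k]
      ultimately show ?thesis by (auto simp: inner_axis abs_if)
    qed
    have "norm ?z \<le> \<bar>?z $ 1\<bar> + \<bar>?z $ 2\<bar>" using norm_le_l1_cart[of ?z] by (simp add: sum_2)
    then have "(R / 2) * norm ?z \<le> (R / 2) * (\<bar>?z $ 1\<bar> + \<bar>?z $ 2\<bar>)"
      using R(1) by (intro mult_left_mono) auto
    also have "\<dots> \<le> 2 * (R * C' + (R / 20) * norm ?z)"
      using cmp[of 1] cmp[of 2] by (simp only: distrib_left) auto
    finally have "R * (2 / 5 * norm ?z) \<le> R * (2 * C')" by (simp add: algebra_simps)
    then have "2 / 5 * norm ?z \<le> 2 * C'" using R(1) by simp
    then show ?thesis by simp
  qed
  then show ?thesis by blast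
qed

lemma limit_map:
  obtains d y0 p where "\<And>k. 0 < d k" "\<And>k. d k \<le> R" "d \<longlonglongrightarrow> 0"
    "AE x in lborel. x \<in> S \<longrightarrow> (\<lambda>k. P (d k) x) \<longlonglongrightarrow> x + \<phi> x"
    "AE x in lborel. x \<in> S \<longrightarrow> (\<lambda>k. M (d k) x) \<longlonglongrightarrow> H x"
    "(\<lambda>k. P (d k) x0) \<longlonglongrightarrow> y0" "\<And>k. cball y0 (R / 8) \<subseteq> ball (P (d k) x0) (R / 2)"
    "continuous_on (cball y0 (R / 8)) p"
    "uniform_limit (cball y0 (R / 8)) (\<lambda>k. psi (d k)) p sequentially"
proof -
  define d0 where "d0 k = R * eps k" for k
  have e1: "eps k \<le> 1" for k by (simp add: eps_def inverse_le_1_iff)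
  have d0: "0 < d0 k" "d0 k \<le> R" for k
    using R(1) eps(1)[of k] e1[of k] by (auto simp: d0_def mult_left_le)
  have d0': "d0 \<longlonglongrightarrow> 0" unfolding d0_def[abs_def] using tendsto_mult_right_zero[OF eps(2)] .
  \<comment> \<open>Mollifying the pair yields one subsequence along which both
    \<open>\<phi>\<close> and \<open>H\<close> converge almost everywhere.\<close>
  have pint: "integrable lborel (\<lambda>x. (\<phi> x, H x))"
  proof -
    have "integrable lborel (\<lambda>x. (\<phi> x, 0 :: real^2^2) + (0 :: real^2, H x))"
      by (intro Bochner_Integration.integrable_add
          integrable_bounded_linear[OF bounded_linear_Pair[OF bounded_linear_ident bounded_linear_zero] \<phi>_int]
          integrable_bounded_linear[OF bounded_linear_Pair[OF bounded_linear_zero bounded_linear_ident] H_int])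
    then show ?thesis by simp
  qed
  obtain r where r: "strict_mono r"
      "AE x in lborel. x \<in> S \<longrightarrow> (\<lambda>k. conv (\<lambda>x. (\<phi> x, H x)) (moll (d0 (r k))) x) \<longlonglongrightarrow> (\<phi> x, H x)"
    using conv_moll_AE_subseq[OF pint S(2) _ d0(1) d0'] S(1) by auto
  have L1: "AE x in lborel. x \<in> S \<longrightarrow> (\<lambda>k. P (d0 (r k)) x) \<longlonglongrightarrow> x + \<phi> x"
    using r(2)
  proof eventually_elim
    case (elim x)
    show ?case
    proof
      assume "x \<in> S"
      then have "(\<lambda>k. fst (conv (\<lambda>x. (\<phi> x, H x)) (moll (d0 (r k))) x)) \<longlonglongrightarrow> fst (\<phi> x, H x)"
        using elim tendsto_fst by blast
      then have "(\<lambda>k. conv \<phi> (moll (d0 (r k))) x) \<longlonglongrightarrow> \<phi> x"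
        by (simp add: conv_linear[OF bounded_linear_fst pint test_function_moll[OF d0(1)]])
      then show "(\<lambda>k. P (d0 (r k)) x) \<longlonglongrightarrow> x + \<phi> x"
        unfolding P_def by (intro tendsto_intros)
    qed
  qed
  have L2: "AE x in lborel. x \<in> S \<longrightarrow> (\<lambda>k. M (d0 (r k)) x) \<longlonglongrightarrow> H x"
    using r(2)
  proof eventually_elim
    case (elim x)
    show ?case
    proof
      assume "x \<in> S"
      then have "(\<lambda>k. snd (conv (\<lambda>x. (\<phi> x, H x)) (moll (d0 (r k))) x)) \<longlonglongrightarrow> snd (\<phi> x, H x)"
        using elim tendsto_snd by blast
      then show "(\<lambda>k. M (d0 (r k)) x) \<longlonglongrightarrow> H x"
        by (simp add: M_def conv_linear[OF bounded_linear_snd pint test_function_moll[OF d0(1)]])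
    qed
  qed
  obtain B where B: "\<And>k. norm (P (d0 (r k)) x0) \<le> B"
    using P_bounded[of "\<lambda>k. d0 (r k)", OF d0(1) d0(2) L1] by blast
  have "compact (cball (0 :: real^2) B)" by simp
  then have "seq_compact (cball (0 :: real^2) B)" by (simp add: compact_eq_seq_compact_metric)
  moreover have "\<forall>k. P (d0 (r k)) x0 \<in> cball 0 B" using B by simp
  ultimately obtain y0 s where s: "strict_mono s" "((\<lambda>k. P (d0 (r k)) x0) \<circ> s) \<longlonglongrightarrow> y0"
    unfolding seq_compact_def by metis
  have "\<forall>\<^sub>F k in sequentially. dist (P (d0 (r (s k))) x0) y0 < R / 4"
    using tendstoD[OF s(2), of "R / 4"] R(1) by simp
  \<comment> \<open>As \<open>R / 4 + R / 8 < R / 2\<close>, from the index \<open>N\<close> on the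
    ball of radius \<open>R / 8\<close> around \<open>y0\<close> lies in the domain of each
    inverse.\<close>
  then obtain N where N: "\<And>k. k \<ge> N \<Longrightarrow> dist (P (d0 (r (s k))) x0) y0 < R / 4"
    unfolding eventually_sequentially by blast
  define d2 where "d2 k = d0 (r (s (k + N)))" for k
  have d2: "0 < d2 k" "d2 k \<le> R" for k by (simp_all add: d2_def d0)
  have sub2: "cball y0 (R / 8) \<subseteq> ball (P (d2 k) x0) (R / 2)" for k
  proof
    fix y assume "y \<in> cball y0 (R / 8)"
    then show "y \<in> ball (P (d2 k) x0) (R / 2)"
      using N[of "k + N"] dist_triangle[of "P (d2 k) x0" y y0] R(1) by (simp add: d2_def)
  qed
  have inb: "y \<in> ball (P (d2 k) x0) (R / 2)" if "y \<in> cball y0 (R / 8)" for k y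
    using sub2 that by blast
  obtain p t where p: "continuous_on (cball y0 (R / 8)) p" "strict_mono (t :: nat \<Rightarrow> nat)"
     "\<And>e. 0 < e \<Longrightarrow> \<exists>N. \<forall>n x. n \<ge> N \<and> x \<in> cball y0 (R / 8) \<longrightarrow> norm (psi (d2 (t n)) x - p x) < e"
  \<comment> \<open>Equicontinuity is the common Lipschitz constant 1; boundedness holds because all
    inverses take values in \<open>ball x0 R\<close>.\<close>
  proof (rule Arzela_Ascoli[of "cball y0 (R / 8)" "\<lambda>k. psi (d2 k)" "norm x0 + R"])
    show "norm (psi (d2 n) x) \<le> norm x0 + R" if "x \<in> cball y0 (R / 8)" for n x
    proof -
      have "norm (psi (d2 n) x - x0) < R"
        using psi(1)[OF d2 inb[OF that]] by (simp add: dist_norm norm_minus_commute)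
      then show ?thesis using norm_triangle_ineq2[of "psi (d2 n) x" x0] by linarith
    qed
    show "\<exists>e. 0 < e \<and> (\<forall>n y. y \<in> cball y0 (R / 8) \<and> norm (x - y) < e \<longrightarrow> norm (psi (d2 n) x - psi (d2 n) y) < e')"
      if "x \<in> cball y0 (R / 8)" "0 < e'" for x e'
      using that by (intro exI[of _ e']) (auto intro!: psi_lipschitz[OF d2 inb inb, THEN le_less_trans])
  qed (use that in auto)
  have "uniform_limit (cball y0 (R / 8)) (\<lambda>k. psi (d2 (t k))) p sequentially"
    unfolding uniform_limit_iff eventually_sequentially using p(3) by (metis dist_norm)
  moreover have mono: "strict_mono (\<lambda>k. s (t k + N))"
    using s(1) p(2) by (simp add: strict_mono_def)
  moreover have "(\<lambda>k. d2 (t k)) \<longlonglongrightarrow> 0"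
    using LIMSEQ_subseq_LIMSEQ[OF d0' strict_mono_o[OF r(1) mono]] by (simp add: d2_def o_def)
  moreover have "AE x in lborel. x \<in> S \<longrightarrow> (\<lambda>k. P (d2 (t k)) x) \<longlonglongrightarrow> x + \<phi> x"
    using L1
  proof eventually_elim
    case (elim x)
    then show ?case using LIMSEQ_subseq_LIMSEQ[OF _ mono] by (auto simp: d2_def o_def)
  qed
  moreover have "AE x in lborel. x \<in> S \<longrightarrow> (\<lambda>k. M (d2 (t k)) x) \<longlonglongrightarrow> H x"
    using L2
  proof eventually_elim
    case (elim x)
    then show ?case using LIMSEQ_subseq_LIMSEQ[OF _ mono] by (auto simp: d2_def o_def)
  qed
  moreover have "(\<lambda>k. P (d2 (t k)) x0) \<longlonglongrightarrow> y0"
  proof -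
    have "strict_mono (\<lambda>k. t k + N)" using p(2) by (simp add: strict_mono_def)
    from LIMSEQ_subseq_LIMSEQ[OF s(2) this] show ?thesis by (simp add: d2_def o_def)
  qed
  ultimately show ?thesis using that[of "\<lambda>k. d2 (t k)" y0 p] d2 sub2 p(1) by blast
qed

end

section \<open>The limit of the inverse maps\<close>

text \<open>The formula for absolutely integrable functions is applied to \<open>f\<close> read as a
  map into \<open>real^1\<close>; what remains is the passage from \<open>lebesgue\<close> to
  \<open>lborel\<close>.\<close>

lemma change_of_variables:
  fixes g :: "real^'m::{finite,wellorder} \<Rightarrow> real^'m::_" and f :: "real^'m::_ \<Rightarrow> real"
  assumes T: "open T" and g: "\<And>y. y \<in> T \<Longrightarrow> (g has_derivative (\<lambda>v. A y *v v)) (at y)"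
    and A: "continuous_on T (\<lambda>y. det (A y))" and inj: "inj_on g T" and gT: "open (g ` T)"
    and f: "f \<in> borel_measurable borel" "set_integrable lborel (g ` T) f"
  shows "set_integrable lborel T (\<lambda>y. \<bar>det (A y)\<bar> * f (g y))"
    "(LINT y:T|lborel. \<bar>det (A y)\<bar> * f (g y)) = (LINT x:(g ` T)|lborel. f x)"
proof -
  let ?F = "\<lambda>x. vec (f x) :: real^1" and ?h = "\<lambda>y. \<bar>det (A y)\<bar> * f (g y)"
  have abs: "f absolutely_integrable_on (g ` T)"
    using f gT unfolding set_integrable_def by (subst integrable_completion) auto
  have gc: "continuous_on T g"
    using has_derivative_continuous[OF g] by (simp add: continuous_at_imp_continuous_on)
  have hm: "(\<lambda>y. indicator T y *\<^sub>R ?h y) \<in> borel_measurable lborel"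
  proof -
    \<comment> \<open>\<open>g\<close> is controlled on \<open>T\<close> only; cut off by the
      indicator it becomes a Borel map on the whole space, which can be composed with
      \<open>f\<close>.\<close>
    have [measurable]: "(\<lambda>y. indicator T y *\<^sub>R g y) \<in> borel_measurable borel"
      "(\<lambda>y. indicator T y *\<^sub>R \<bar>det (A y)\<bar>) \<in> borel_measurable borel"
      using T borel_measurable_continuous_on_indicator[OF _ gc]
        borel_measurable_continuous_on_indicator[OF _ continuous_on_rabs[OF A]] by auto
    have [measurable]: "f \<in> borel_measurable borel" by (rule f(1))
    have "(\<lambda>y. (indicator T y *\<^sub>R \<bar>det (A y)\<bar>) * f (indicator T y *\<^sub>R g y)) \<in> borel_measurable borel"
      by measurable
    also have "(\<lambda>y. (indicator T y *\<^sub>R \<bar>det (A y)\<bar>) * f (indicator T y *\<^sub>R g y)) = (\<lambda>y. indicator T y *\<^sub>R ?h y)"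
      by (auto simp: fun_eq_iff indicator_def)
    finally show ?thesis by simp
  qed
  have der: "(g has_derivative (\<lambda>v. A y *v v)) (at y within T)" if "y \<in> T" for y
    using g[OF that] has_derivative_at_withinI by blast
  have "T \<in> sets lebesgue" using T by auto
  note cv = has_absolute_integral_change_of_variables[OF this der inj, of ?F "integral (g ` T) ?F"]
  have F: "?F absolutely_integrable_on (g ` T)"
    using abs by (simp add: absolutely_integrable_on_1_iff)
  with cv have "(\<lambda>y. \<bar>det (A y)\<bar> *\<^sub>R ?F (g y)) absolutely_integrable_on T"
    "integral T (\<lambda>y. \<bar>det (A y)\<bar> *\<^sub>R ?F (g y)) = integral (g ` T) ?F" by simp_all
  then have h: "?h absolutely_integrable_on T" "integral T ?h = integral (g ` T) f"
    by (simp_all add: absolutely_integrable_on_1_iff integral_on_1_eq vec_eq_iff)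
  show si: "set_integrable lborel T ?h"
    using h(1) unfolding set_integrable_def by (subst (asm) integrable_completion[OF hm])
  show "(LINT y:T|lborel. ?h y) = (LINT x:(g ` T)|lborel. f x)"
    using set_borel_integral_eq_integral(2)[OF si] set_borel_integral_eq_integral(2)[OF f(2)] h(2) by simp
qed

lemma Basis_real2: "Basis = {axis 1 1, axis 2 1 :: real^2}"
  by (auto simp: Basis_vec_def UNIV_2)

lemma axis_neq: "axis 1 1 \<noteq> (axis 2 1 :: real^2)"
  by (simp add: axis_eq_axis)

lemma det_inv2: "det A \<noteq> 0 \<Longrightarrow> det (inv2 A) = 1 / det A"
proof -
  assume "det A \<noteq> 0"
  from arg_cong[OF inv2_mult(1)[OF this], of det] this
  show ?thesis by (simp add: det_mul field_simps)
qed

locale monge_ampere_limit = monge_ampere_at +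
  fixes d :: "nat \<Rightarrow> real" and y0 :: "real^2" and p :: "real^2 \<Rightarrow> real^2"
  assumes d: "\<And>k. 0 < d k" "\<And>k. d k \<le> R" "d \<longlonglongrightarrow> 0"
    and P_lim: "AE x in lborel. x \<in> S \<longrightarrow> (\<lambda>k. P (d k) x) \<longlonglongrightarrow> x + \<phi> x"
    and M_lim: "AE x in lborel. x \<in> S \<longrightarrow> (\<lambda>k. M (d k) x) \<longlonglongrightarrow> H x"
    and y0: "(\<lambda>k. P (d k) x0) \<longlonglongrightarrow> y0" "\<And>k. cball y0 (R / 8) \<subseteq> ball (P (d k) x0) (R / 2)"
    and p_cont: "continuous_on (cball y0 (R / 8)) p"
    and p_lim: "uniform_limit (cball y0 (R / 8)) (\<lambda>k. psi (d k)) p sequentially"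
begin

abbreviation "B \<equiv> ball y0 (R / 8)"
abbreviation "CB \<equiv> cball y0 (R / 8)"

lemma in_dom: "y \<in> CB \<Longrightarrow> y \<in> ball (P (d k) x0) (R / 2)"
  using y0(2) by blast

lemmas psi_mem = psi[OF d(1,2) in_dom]
lemmas psi_der = psi_derivative[OF d(1,2) in_dom]

lemma psi_lim: "y \<in> CB \<Longrightarrow> (\<lambda>k. psi (d k) y) \<longlonglongrightarrow> p y"
  using tendsto_uniform_limitI[OF p_lim] .

lemma p_firm:
  assumes "y \<in> CB" "y' \<in> CB"
  shows "(y - y') \<bullet> (p y - p y') \<ge> (norm (p y - p y'))\<^sup>2"
proof (rule LIMSEQ_le)
  show "(\<lambda>k. (norm (psi (d k) y - psi (d k) y'))\<^sup>2) \<longlonglongrightarrow> (norm (p y - p y'))\<^sup>2"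
    by (intro tendsto_intros psi_lim assms)
  show "(\<lambda>k. (y - y') \<bullet> (psi (d k) y - psi (d k) y')) \<longlonglongrightarrow> (y - y') \<bullet> (p y - p y')"
    by (intro tendsto_intros psi_lim assms)
qed (use psi_firm[OF d(1,2) in_dom[OF assms(1)] in_dom[OF assms(2)]] in auto)

lemma y0_mem: "y0 \<in> B" "y0 \<in> CB"
  using R(1) by auto

lemma p_y0: "p y0 = x0"
proof -
  have "(\<lambda>k. psi (d k) y0 - x0) \<longlonglongrightarrow> 0"
  proof (rule Lim_null_comparison)
    have "x0 \<in> ball x0 R" using R by simp
    then have e: "psi (d k) (P (d k) x0) = x0" for k by (rule psi_P[OF d(1,2)])
    have "norm (psi (d k) y0 - x0) \<le> norm (y0 - P (d k) x0)" for k
      using psi_lipschitz[OF d(1,2) in_dom[OF y0_mem(2)], of "P (d k) x0" k] e[of k] R(1) by simp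
    then show "\<forall>\<^sub>F k in sequentially. norm (psi (d k) y0 - x0) \<le> norm (y0 - P (d k) x0)"
      by simp
    show "(\<lambda>k. norm (y0 - P (d k) x0)) \<longlonglongrightarrow> 0"
      using tendsto_norm[OF tendsto_diff[OF tendsto_const y0(1)], of y0] by simp
  qed
  then have "(\<lambda>k. psi (d k) y0) \<longlonglongrightarrow> x0" by (simp add: LIM_zero_iff)
  then show ?thesis using psi_lim[OF y0_mem(2)] LIMSEQ_unique by blast
qed

text \<open>As a preimage under the continuous map \<open>P (d k)\<close> the image of an open set
  is open, without invariance of domain.\<close>

lemma psi_image:
  assumes "T \<subseteq> CB"
  shows "psi (d k) ` T = ball x0 R \<inter> P (d k) -` T"
proof (intro equalityI subsetI)
  fix x assume "x \<in> psi (d k) ` T"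
  then show "x \<in> ball x0 R \<inter> P (d k) -` T" using assms psi_mem[of _ k] by auto
next
  fix x assume "x \<in> ball x0 R \<inter> P (d k) -` T"
  then show "x \<in> psi (d k) ` T" using psi_P[OF d(1,2), of x k] by (auto intro!: image_eqI[of x])
qed

lemma P_continuous: "continuous_on (ball x0 R) (P (d k))"
proof -
  have "isCont (P (d k)) x" if "x \<in> ball x0 R" for x
    using has_derivative_continuous[OF P_derivative[OF d(1) cball_in[OF d(2)]]] that by simp
  then show ?thesis by (simp add: continuous_at_imp_continuous_on)
qed

lemma psi_image_open: "open T \<Longrightarrow> T \<subseteq> CB \<Longrightarrow> open (psi (d k) ` T)"
  unfolding psi_image using P_continuous open_ball by (simp add: continuous_open_preimage)

lemma psi_cont: "continuous_on CB (psi (d k))"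
  using psi_continuous[OF d(1,2)] y0(2) by (rule continuous_on_subset)

abbreviation "A k y \<equiv> mat 1 + M (d k) (psi (d k) y)"

lemma A_pos: "det (A k y) > 0"
  by (rule det_P_pos[OF d(1)])

lemma A_cont: "continuous_on CB (\<lambda>y. A k y $ i $ j)"
proof -
  have "continuous_on CB (\<lambda>y. M (d k) (psi (d k) y))"
    using continuous_on_compose2[OF M_continuous[OF d(1)] psi_cont] by auto
  then show ?thesis by (intro continuous_intros)
qed

lemma detA_cont: "continuous_on CB (\<lambda>y. det (A k y))"
  unfolding det_2 by (intro continuous_intros A_cont)

lemma inv2_cont: "continuous_on CB (\<lambda>y. inv2 (A k y) $ i $ j)"
proof -
  have z: "det (A k y) \<noteq> 0" for y using A_pos[of k y] by simp
  have "i = 1 \<or> i = 2" "j = 1 \<or> j = 2" by (rule exhaust_2)+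
  then show ?thesis
    by (elim disjE) (simp_all add: inv2_nth z continuous_on_divide[OF A_cont detA_cont]
        continuous_on_minus[OF continuous_on_divide[OF A_cont detA_cont]] del: vector_add_component)
qed

lemma inj_psi: "inj_on (psi (d k)) CB"
  by (rule inj_on_inverseI[of _ "P (d k)"]) (rule psi_mem)

lemma psi_in_S: "T \<subseteq> CB \<Longrightarrow> psi (d k) ` T \<subseteq> S"
  using psi_image[of T k] cball_in[OF d(2)] d(1) R by (auto simp: subset_iff) 

text \<open>The trace of the Jacobian of \<open>2 * psi - id\<close>. That Jacobian is symmetric, so
  its trace is the only Cauchy--Riemann defect.\<close>

definition defect :: "nat \<Rightarrow> real^2 \<Rightarrow> real" where
  "defect k y = 2 * (inv2 (A k y) $ 1 $ 1 + inv2 (A k y) $ 2 $ 2) - 2"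

text \<open>In the plane \<open>tr (I + M) = det (I + M) + 1 - det M\<close>; division by
  \<open>det (I + M)\<close> gives the trace of the inverse. The factor
  \<open>det (inv2 (A k y))\<close> is the Jacobian of \<open>psi\<close>, so the area formula turns
  the L1 norm of the defect into an integral of \<open>\<bar>1 - det M\<bar>\<close>.\<close>

lemma defect_eq: "defect k y = \<bar>det (inv2 (A k y))\<bar> * (2 * (1 - det (M (d k) (psi (d k) y))))"
proof -
  let ?M = "M (d k) (psi (d k) y)"
  have "defect k y = 2 * ((?M $ 1 $ 1 + ?M $ 2 $ 2 + 2 - det (A k y)) / det (A k y))"
    using A_pos[of k y] by (simp add: defect_def inv2_nth mat_def field_simps)
  also have "?M $ 1 $ 1 + ?M $ 2 $ 2 + 2 - det (A k y) = 1 - det ?M"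
    by (simp add: det_id_plus)
  finally show ?thesis using A_pos[of k y] by (simp add: det_inv2)
qed

lemma defect_L1:
  "set_integrable lborel B (defect k)" "(\<lambda>k. LINT y|lborel. indicator B y * \<bar>defect k y\<bar>) \<longlonglongrightarrow> 0"
proof -
  have BC: "B \<subseteq> CB" by auto
  have S': "S \<in> sets borel" using S(1) by simp
  note dM = det_M_tendsto_L1[OF d(1) d(3) M_lim]
  have fc: "continuous_on UNIV (\<lambda>x. 2 * (1 - det (M (d k) x)))" for k
    unfolding det_2 using M_continuous[OF d(1)] by (intro continuous_intros)
  have im: "psi (d k) ` B \<in> sets lborel" for k using psi_image_open[OF open_ball BC] by simp
  have fi: "set_integrable lborel S (\<lambda>x. 2 * (1 - det (M (d k) x)))" for k
    using set_integrable_mult_right[of "-2", OF dM(1)] by (simp add: algebra_simps)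
  have fi': "set_integrable lborel (psi (d k) ` B) (\<lambda>x. 2 * (1 - det (M (d k) x)))" for k
    by (rule set_integrable_subset[OF fi im psi_in_S[OF BC]])
  have dc: "continuous_on B (\<lambda>y. det (inv2 (A k y)))" for k
    unfolding det_2 by (intro continuous_on_diff continuous_on_mult continuous_on_subset[OF inv2_cont BC])
  have der: "(psi (d k) has_derivative (\<lambda>v. inv2 (A k y) *v v)) (at y)" if "y \<in> B" for y k
    using psi_der BC that by blast
  note cv = change_of_variables[OF open_ball der dc inj_on_subset[OF inj_psi BC] psi_image_open[OF open_ball BC]]
  have d1: "set_integrable lborel B (defect k)" for k
    using cv(1)[OF _ borel_measurable_continuous_onI[OF fc] fi'] by (simp add: defect_eq[abs_def])
  then show "set_integrable lborel B (defect k)" .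
  have fa: "continuous_on UNIV (\<lambda>x. \<bar>2 * (1 - det (M (d k) x))\<bar>)" for k
    by (rule continuous_on_rabs[OF fc])
  have fai: "set_integrable lborel (psi (d k) ` B) (\<lambda>x. \<bar>2 * (1 - det (M (d k) x))\<bar>)" for k
    using set_integrable_abs[OF fi'] .
  have le: "(LINT y|lborel. indicator B y * \<bar>defect k y\<bar>) \<le> 2 * (LINT x|lborel. indicator S x * \<bar>det (M (d k) x) - 1\<bar>)" for k
  proof -
    have "(LINT y|lborel. indicator B y * \<bar>defect k y\<bar>) = (LINT x:(psi (d k) ` B)|lborel. \<bar>2 * (1 - det (M (d k) x))\<bar>)"
      using cv(2)[OF _ borel_measurable_continuous_onI[OF fa] fai, of k]
      by (simp add: set_lebesgue_integral_def defect_eq abs_mult)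
    also have "\<dots> \<le> (LINT x|lborel. 2 * (indicator S x * \<bar>det (M (d k) x) - 1\<bar>))"
      unfolding set_lebesgue_integral_def
    proof (rule integral_mono)
      show "integrable lborel (\<lambda>x. indicator (psi (d k) ` B) x *\<^sub>R \<bar>2 * (1 - det (M (d k) x))\<bar>)"
        using fai by (simp add: set_integrable_def)
      have "integrable lborel (\<lambda>x. indicator S x * \<bar>det (M (d k) x) - 1\<bar>)"
        using integrable_abs[OF dM(1)[of k, unfolded set_integrable_def]] by (simp add: abs_mult)
      then show "integrable lborel (\<lambda>x. 2 * (indicator S x * \<bar>det (M (d k) x) - 1\<bar>))" by simp
      show "indicator (psi (d k) ` B) x *\<^sub>R \<bar>2 * (1 - det (M (d k) x))\<bar> \<le> 2 * (indicator S x * \<bar>det (M (d k) x) - 1\<bar>)" for x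
        using psi_in_S[OF BC, of k] unfolding abs_mult[of 2] abs_minus_commute[of 1]
        by (auto simp: indicator_def)
    qed
    finally show ?thesis by simp
  qed
  show "(\<lambda>k. LINT y|lborel. indicator B y * \<bar>defect k y\<bar>) \<longlonglongrightarrow> 0"
  proof (rule tendsto_sandwich[OF _ _ tendsto_const])
    show "\<forall>\<^sub>F k in sequentially. 0 \<le> (LINT y|lborel. indicator B y * \<bar>defect k y\<bar>)"
      by (auto intro!: always_eventually integral_nonneg_AE)
    show "\<forall>\<^sub>F k in sequentially. (LINT y|lborel. indicator B y * \<bar>defect k y\<bar>) \<le>
        2 * (LINT x|lborel. indicator S x * \<bar>det (M (d k) x) - 1\<bar>)"
      using le by (auto intro!: always_eventually)
    show "(\<lambda>k. 2 * (LINT x|lborel. indicator S x * \<bar>det (M (d k) x) - 1\<bar>)) \<longlonglongrightarrow> 0"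
      using tendsto_mult_right_zero[OF dM(2)] .
  qed
qed

text \<open>The cut-off to \<open>B\<close> makes it integrable on the whole plane, as convolution
  and Weyl's lemma require.\<close>

definition N :: "2 \<Rightarrow> real^2 \<Rightarrow> real" where
  "N i y = indicator B y * (2 * p y $ i - y $ i)"

lemma N_integrable: "integrable lborel (N i)"
proof -
  have "set_integrable lborel CB (\<lambda>y. 2 * p y $ i - y $ i)"
    unfolding set_integrable_def
    by (rule borel_integrable_compact) (auto intro!: continuous_intros p_cont)
  then have "set_integrable lborel B (\<lambda>y. 2 * p y $ i - y $ i)"
    by (rule set_integrable_subset) auto
  then show ?thesis by (simp add: set_integrable_def N_def[abs_def])
qed

lemma N_limit:
  fixes i :: 2
  defines "a \<equiv> \<lambda>k y. 2 * psi (d k) y $ i - y $ i"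
  shows "set_integrable lborel B (\<lambda>y. a k y - N i y)"
    "(\<lambda>k. LINT y|lborel. indicator B y * \<bar>a k y - N i y\<bar>) \<longlonglongrightarrow> 0"
proof -
  have eq: "indicator B y * \<bar>a k y - N i y\<bar> = \<bar>indicator B y * (2 * (psi (d k) y $ i - p y $ i))\<bar>" for k y
    by (simp add: a_def N_def indicator_def)
  have c: "set_integrable lborel CB (\<lambda>y. 2 * (psi (d k) y $ i - p y $ i))" for k
    unfolding set_integrable_def
    by (rule borel_integrable_compact) (auto intro!: continuous_intros p_cont psi_cont)
  then have c': "set_integrable lborel B (\<lambda>y. 2 * (psi (d k) y $ i - p y $ i))" for k
    by (rule set_integrable_subset) auto
  moreover have "(\<lambda>y. indicator B y *\<^sub>R (a k y - N i y)) = (\<lambda>y. indicator B y *\<^sub>R (2 * (psi (d k) y $ i - p y $ i)))" for k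
    by (auto simp: a_def N_def indicator_def fun_eq_iff)
  ultimately show "set_integrable lborel B (\<lambda>y. a k y - N i y)" by (simp add: set_integrable_def)
  have pb: "norm (psi (d k) y) \<le> norm x0 + R" if "y \<in> CB" for k y
  proof -
    have "norm (psi (d k) y - x0) < R" using psi_mem(1)[OF that, of k] by (simp add: dist_norm norm_minus_commute)
    then show ?thesis using norm_triangle_ineq2[of "psi (d k) y" x0] by linarith
  qed
  have pb': "norm (p y) \<le> norm x0 + R" if "y \<in> CB" for y
    using tendsto_upperbound[OF tendsto_norm[OF psi_lim[OF that]]] pb[OF that] by simp
  have "(\<lambda>k. LINT y|lborel. \<bar>indicator B y * (2 * (psi (d k) y $ i - p y $ i))\<bar>) \<longlonglongrightarrow> (LINT y|(lborel :: (real^2) measure). (0 :: real))"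
  proof (rule integral_dominated_convergence[where w = "\<lambda>y. indicator B y * (4 * (norm x0 + R))"])
    show "integrable lborel (\<lambda>y. indicator B y * (4 * (norm x0 + R)))"
      using emeasure_lborel_ball_finite[of y0 "R / 8"]
      by (intro integrable_mult_left integrable_real_indicator) auto
    show "(\<lambda>y. \<bar>indicator B y * (2 * (psi (d k) y $ i - p y $ i))\<bar>) \<in> borel_measurable lborel" for k
      using c'[of k, unfolded set_integrable_def, THEN borel_measurable_integrable] by simp
    show "AE y in lborel. (\<lambda>k. \<bar>indicator B y * (2 * (psi (d k) y $ i - p y $ i))\<bar>) \<longlonglongrightarrow> 0"
    proof (rule AE_I2)
      fix y
      show "(\<lambda>k. \<bar>indicator B y * (2 * (psi (d k) y $ i - p y $ i))\<bar>) \<longlonglongrightarrow> 0"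
      proof (cases "y \<in> B")
        case True
        then have "(\<lambda>k. \<bar>2 * (psi (d k) y $ i - p y $ i)\<bar>) \<longlonglongrightarrow> \<bar>2 * (p y $ i - p y $ i)\<bar>"
          by (intro tendsto_intros psi_lim) auto
        then show ?thesis using True by simp
      qed simp
    qed
    show "AE y in lborel. norm \<bar>indicator B y * (2 * (psi (d k) y $ i - p y $ i))\<bar> \<le> indicator B y * (4 * (norm x0 + R))" for k
    proof (rule AE_I2)
      fix y
      show "norm \<bar>indicator B y * (2 * (psi (d k) y $ i - p y $ i))\<bar> \<le> indicator B y * (4 * (norm x0 + R))"
      proof (cases "y \<in> B")
        case True
        then have "y \<in> CB" by auto
        from pb[OF this, of k] pb'[OF this] True component_le_norm_cart[of "psi (d k) y" i] component_le_norm_cart[of "p y" i]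
        show ?thesis by simp
      qed simp
    qed
  qed simp
  then show "(\<lambda>k. LINT y|lborel. indicator B y * \<bar>a k y - N i y\<bar>) \<longlonglongrightarrow> 0" unfolding eq by simp
qed

lemma psi_comp_derivative:
  assumes "y \<in> B"
  shows "((\<lambda>y. 2 * psi (d k) y $ i - y $ i) has_derivative (\<lambda>v. 2 * (inv2 (A k y) *v v) $ i - v $ i)) (at y)"
proof -
  have "y \<in> CB" using assms by auto
  note D = psi_der[OF this, of k]
  show ?thesis
    by (intro has_derivative_diff has_derivative_mult_right bounded_linear.has_derivative[OF bounded_linear_vec_nth] D has_derivative_ident)
qed

lemma psi_comp_derivative_cont:
  "continuous_on B (\<lambda>y. 2 * (inv2 (A k y) *v v) $ i - v $ i)"
  unfolding matrix_vector_mult_def sum_2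
  by (simp, intro continuous_intros continuous_on_subset[OF inv2_cont]) auto

text \<open>For the first component of \<open>2 * psi - id\<close> the conjugate function is minus
  the second, for the second component it is the first. One Cauchy--Riemann equation then holds
  exactly by symmetry of the Jacobian, the other up to \<open>defect\<close>.\<close>

lemma weakly_harmonic_N: "weakly_harmonic B (N i)"
proof -
  let ?a = "\<lambda>i k y. 2 * psi (d k) y $ i - y $ i"
  let ?a' = "\<lambda>i k y v. 2 * (inv2 (A k y) *v v) $ i - v $ i"
  have i: "i = 1 \<or> i = 2" by (rule exhaust_2)
  have sym: "inv2 (A k y) $ 1 $ 2 = inv2 (A k y) $ 2 $ 1" for k y
    using M_sym[OF d(1), of k "psi (d k) y"] by (simp add: inv2_nth mat_def)
  have e: "(inv2 (A k y) *v axis j 1) $ i = inv2 (A k y) $ i $ j" for k y i j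
    by (simp add: matrix_vector_mult_basis column_def)
  have q: "?a' 1 k y (axis 2 1) - ?a' 2 k y (axis 1 1) = 0" for k y
    unfolding e using sym by (simp add: axis_def)
  have pd: "?a' 1 k y (axis 1 1) + ?a' 2 k y (axis 2 1) = defect k y" for k y
    unfolding e by (simp add: defect_def axis_def)
  have neg: "((\<lambda>y. - ?a i k y) has_derivative (\<lambda>v. - ?a' i k y v)) (at y)" if "y \<in> B" for i k y
    by (rule has_derivative_minus[OF psi_comp_derivative[OF that]])
  have negc: "continuous_on B (\<lambda>y. - ?a' i k y v)" for i k v
    by (rule continuous_on_minus[OF psi_comp_derivative_cont])
  have q': "?a' 2 k y (axis 1 1) - ?a' 1 k y (axis 2 1) = 0" for k y using q[of k y] by simp
  have pd': "?a' 2 k y (axis 2 1) + ?a' 1 k y (axis 1 1) = defect k y" for k y using pd[of k y] by simp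
  have pd'': "?a' 1 k y (axis 1 1) - - ?a' 2 k y (axis 2 1) = defect k y"
    "?a' 1 k y (axis 2 1) + - ?a' 2 k y (axis 1 1) = 0" for k y using pd[of k y] q[of k y] by simp_all
  have zero: "set_integrable lborel B (\<lambda>y. 0 :: real)" by (simp add: set_integrable_def)
  have "weakly_harmonic B (N 1)"
  proof (rule weakly_harmonic_limit[OF Basis_real2 axis_neq open_ball, where a = "?a 1" and a' = "?a' 1"
        and b = "\<lambda>k y. - ?a 2 k y" and b' = "\<lambda>k y v. - ?a' 2 k y v"],
      unfold pd'')
  qed (simp_all add: defect_L1 zero N_limit N_integrable psi_comp_derivative psi_comp_derivative_cont neg negc
      del: right_diff_distrib_numeral minus_diff_eq)
  moreover have "weakly_harmonic B (N 2)"
  proof (rule weakly_harmonic_limit[OF Basis_real2 axis_neq open_ball, where a = "?a 2" and a' = "?a' 2" and b = "?a 1" and b' = "?a' 1"],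
      unfold pd' q')
  qed (simp_all add: defect_L1 zero N_limit N_integrable psi_comp_derivative psi_comp_derivative_cont)
  ultimately show ?thesis using i by auto
qed

end

section \<open>Smoothness of the limit map and the strong maximum principle for its
  derivative\<close>

lemma directional_quotient:
  fixes f :: "'a::real_normed_vector \<Rightarrow> 'b::real_normed_vector"
  assumes "(f has_derivative D) (at y)"
  shows "((\<lambda>t :: real. (1 / t) *\<^sub>R (f (y + t *\<^sub>R v) - f y)) \<longlongrightarrow> D v) (at 0)"
proof -
  have lin: "linear D" using assms has_derivative_linear by blast
  have "((\<lambda>t :: real. y + t *\<^sub>R v) has_derivative (\<lambda>s. s *\<^sub>R v)) (at 0)"
    by (auto intro!: derivative_eq_intros)
  moreover have "(f has_derivative D) (at (y + 0 *\<^sub>R v))" using assms by simp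
  ultimately have "((\<lambda>t :: real. f (y + t *\<^sub>R v)) has_derivative (\<lambda>s. D (s *\<^sub>R v))) (at 0)"
    by (rule has_derivative_compose)
  then have "((\<lambda>h :: real. norm (f (y + (0 + h) *\<^sub>R v) - f (y + 0 *\<^sub>R v) - D (h *\<^sub>R v)) / norm h) \<longlongrightarrow> 0) (at 0)"
    unfolding has_derivative_at by blast
  then have "((\<lambda>t :: real. norm ((1 / t) *\<^sub>R (f (y + t *\<^sub>R v) - f y) - D v)) \<longlongrightarrow> 0) (at 0)"
  proof (rule Lim_transform_eventually)
    have "norm (f (y + (0 + h) *\<^sub>R v) - f (y + 0 *\<^sub>R v) - D (h *\<^sub>R v)) / norm h =
        norm ((1 / h) *\<^sub>R (f (y + h *\<^sub>R v) - f y) - D v)" if "h \<noteq> 0" for h :: real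
    proof -
      have "(1 / h) *\<^sub>R (f (y + h *\<^sub>R v) - f y) - D v = (1 / h) *\<^sub>R (f (y + h *\<^sub>R v) - f y - D (h *\<^sub>R v))"
        using that by (simp add: linear_scale[OF lin] scaleR_diff_right)
      then show ?thesis by simp
    qed
    then show "\<forall>\<^sub>F h in at 0. norm (f (y + (0 + h) *\<^sub>R v) - f (y + 0 *\<^sub>R v) - D (h *\<^sub>R v)) / norm h =
        norm ((1 / h) *\<^sub>R (f (y + h *\<^sub>R v) - f y) - D v)"
      by (auto simp: eventually_at_filter)
  qed
  from LIM_zero_cancel[OF tendsto_norm_zero_cancel[OF this]] show ?thesis .
qed

lemma conv_translate:
  fixes f :: "'a::euclidean_space \<Rightarrow> real"
  assumes [measurable]: "f \<in> borel_measurable borel"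
  shows "conv f (moll e) x = (LINT w|lborel. f (x + w) * moll e w)"
proof -
  have "(LINT w|lborel. moll e (x - (x + w)) * f (x + w)) = (LINT y|lborel. moll e (x - y) * f y)"
    by (rule lborel_integral_translation) measurable
  then show ?thesis by (simp add: conv_def moll_sym mult.commute)
qed

context monge_ampere_limit
begin

abbreviation "B2 \<equiv> ball y0 (R / 16)"

lemma B2_sub: "B2 \<subseteq> B" "B2 \<subseteq> CB"
  using R(1) by auto

text \<open>Weyl's lemma gives the equation almost everywhere, and on \<open>B2\<close> both sides
  are continuous. The radius \<open>R / 16\<close> is the room between \<open>B2\<close> and the
  boundary of \<open>B\<close>.\<close>

lemma N_mean_value:
  assumes "y \<in> B2" "0 < e" "e \<le> R / 16"
  shows "N i y = conv (N i) (moll e) y"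
proof (rule AE_eq_continuous[OF open_ball _ _ _ assms(1)])
  have "continuous_on B2 (\<lambda>y. 2 * p y $ i - y $ i)"
    by (intro continuous_intros continuous_on_subset[OF p_cont B2_sub(2)])
  then show "continuous_on B2 (N i)"
    by (rule continuous_on_eq) (use B2_sub in \<open>auto simp: N_def\<close>)
  show "continuous_on B2 (conv (N i) (moll e))"
    using smooth_on_continuous[OF conv_smooth[OF N_integrable test_function_moll[OF assms(2)]]]
    by (rule continuous_on_subset) simp
  show "AE y in lborel. y \<in> B2 \<longrightarrow> N i y = conv (N i) (moll e) y"
    using weyl_lemma[OF N_integrable open_ball bounded_ball weakly_harmonic_N[of i]]
  proof eventually_elim
    case (elim y)
    have "cball y e \<subseteq> B" if "y \<in> B2"
    proof
      fix z assume "z \<in> cball y e"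
      then show "z \<in> B" using that assms(3) dist_triangle[of y0 z y] by simp
    qed
    then show ?case using elim assms(2) by blast
  qed
qed

lemma p_smooth: "smooth_on B2 p"
proof (rule smooth_on_vec[OF open_ball])
  fix i :: 2
  have e: "0 < R / 16" "R / 16 \<le> R / 16" using R(1) by auto
  have "smooth_on B2 (\<lambda>y. inverse 2 * (conv (N i) (moll (R / 16)) y + y $ i))"
    by (intro smooth_on_mult smooth_on_add smooth_on_const open_ball
        smooth_on_linear[OF bounded_linear_vec_nth open_ball smooth_on_id[OF open_ball]]
        smooth_on_subset[OF conv_smooth[OF N_integrable test_function_moll[OF e(1)]] subset_UNIV])
  moreover have "p y $ i = inverse 2 * (conv (N i) (moll (R / 16)) y + y $ i)" if "y \<in> B2" for y
  proof -
    have "y \<in> B" using that B2_sub by blast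
    then show ?thesis using N_mean_value[OF that e, of i, symmetric] by (simp add: N_def)
  qed
  ultimately show "smooth_on B2 (\<lambda>y. p y $ i)"
    by (subst smooth_on_cong[OF open_ball, of _ _ "\<lambda>y. p y $ i"])
qed

definition D :: "real^2 \<Rightarrow> real^2 \<Rightarrow> real^2" where
  "D y = frechet_derivative p (at y)"

lemma p_derivative: "y \<in> B2 \<Longrightarrow> (p has_derivative D y) (at y)"
  unfolding D_def by (rule smooth_on_has_derivative[OF p_smooth])

lemma D_linear: "y \<in> B2 \<Longrightarrow> linear (D y)"
  using p_derivative has_derivative_linear by blast

lemma D_cont: "continuous_on B2 (\<lambda>y. D y v)"
  unfolding D_def by (rule smooth_on_continuous[OF smooth_on_derivative[OF p_smooth]])

text \<open>Difference quotients inherit firmness from \<open>p_firm\<close>, and the inequality is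
  closed under limits.\<close>

lemma D_firm:
  assumes "y \<in> B2"
  shows "v \<bullet> D y v \<ge> (norm (D y v))\<^sup>2"
proof (rule tendsto_le[OF trivial_limit_at])
  let ?q = "\<lambda>t :: real. (1 / t) *\<^sub>R (p (y + t *\<^sub>R v) - p y)"
  note q = directional_quotient[OF p_derivative[OF assms], of v]
  show "((\<lambda>t. v \<bullet> ?q t) \<longlongrightarrow> v \<bullet> D y v) (at 0)" by (intro tendsto_intros q)
  show "((\<lambda>t. (norm (?q t))\<^sup>2) \<longlongrightarrow> (norm (D y v))\<^sup>2) (at 0)" by (intro tendsto_intros q)
  have "((\<lambda>t :: real. y + t *\<^sub>R v) \<longlongrightarrow> y + 0 *\<^sub>R v) (at 0)" by (intro tendsto_intros)
  then have "\<forall>\<^sub>F t in at (0 :: real). y + t *\<^sub>R v \<in> B2"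
    using assms by (intro topological_tendstoD[OF _ open_ball]) auto
  moreover have "\<forall>\<^sub>F t in at (0 :: real). t \<noteq> 0" by (simp add: eventually_at_filter)
  ultimately show "\<forall>\<^sub>F t in at 0. (norm (?q t))\<^sup>2 \<le> v \<bullet> ?q t"
  proof eventually_elim
    case (elim t)
    have "(norm (p (y + t *\<^sub>R v) - p y))\<^sup>2 \<le> (y + t *\<^sub>R v - y) \<bullet> (p (y + t *\<^sub>R v) - p y)"
      using elim(1) assms B2_sub(2) by (intro p_firm) auto
    then have "(norm (p (y + t *\<^sub>R v) - p y))\<^sup>2 / t\<^sup>2 \<le> (t * (v \<bullet> (p (y + t *\<^sub>R v) - p y))) / t\<^sup>2"
      by (intro divide_right_mono) auto
    then show ?case using elim(2) by (simp add: power_divide power2_eq_square)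
  qed
qed

lemma D_nonneg: "y \<in> B2 \<Longrightarrow> v \<bullet> D y v \<ge> 0"
  using D_firm zero_le_power2 order_trans by blast

lemma D_norm: "y \<in> B2 \<Longrightarrow> norm (D y v) \<le> norm v"
  by (rule norm_le_of_firm) (rule D_firm)

text \<open>Strong maximum principle: the harmonic function \<open>v \<bullet> D y v\<close> attains its minimum \<open>0\<close> at \<open>y0\<close>.\<close>
lemma D_degenerate:
  assumes v: "norm v = 1" "D y0 v = 0" and y: "y \<in> ball y0 (R / 32)"
  shows "v \<bullet> D y v = 0"
proof -
  define e where "e = R / 32"
  have e: "0 < e" "e \<le> R / 16" using R(1) by (auto simp: e_def)
  \<comment> \<open>The component of \<open>2 p - id\<close> in direction \<open>v\<close>. Its
    derivative in that direction is \<open>2 * c y - 1\<close> with \<open>c\<close> as below, so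
    the mean value property of \<open>Nv\<close> passes to \<open>c\<close>.\<close>
  define Nv where "Nv y = N 1 y * v $ 1 + N 2 y * v $ 2" for y
  have Nv: "Nv y = 2 * (p y \<bullet> v) - y \<bullet> v" if "y \<in> B2" for y
    using that B2_sub by (auto simp: Nv_def N_def inner_vec_def sum_2 algebra_simps)
  have Ni: "integrable lborel Nv"
    unfolding Nv_def[abs_def] by (intro Bochner_Integration.integrable_add integrable_mult_left N_integrable)
  then have [measurable]: "Nv \<in> borel_measurable borel" by simp
  have conv: "Nv y = (LINT w|lborel. Nv (y + w) * moll e w)" if "y \<in> B2" for y
  proof -
    note i = conv_integrable[OF N_integrable test_function_moll[OF e(1)], where x = y]
    have "Nv y = conv (N 1) (moll e) y * v $ 1 + conv (N 2) (moll e) y * v $ 2"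
      unfolding Nv_def N_mean_value[OF that e, symmetric] ..
    also have "\<dots> = (LINT z|lborel. moll e (y - z) *\<^sub>R N 1 z * v $ 1 + moll e (y - z) *\<^sub>R N 2 z * v $ 2)"
      unfolding conv_def using i by simp
    also have "\<dots> = conv Nv (moll e) y"
      unfolding conv_def Nv_def by (intro Bochner_Integration.integral_cong refl) (simp add: algebra_simps)
    finally show ?thesis by (simp add: conv_translate)
  qed
  define c where "c y = v \<bullet> D y v" for y
  have c0: "c y \<ge> 0" if "y \<in> B2" for y using D_nonneg[OF that] by (simp add: c_def)
  have c1: "c y \<le> 1" if "y \<in> B2" for y
    using norm_cauchy_schwarz[of v "D y v"] D_norm[OF that, of v] v(1) by (simp add: c_def)
  have cc: "continuous_on B2 c" unfolding c_def[abs_def] by (intro continuous_intros D_cont)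
  have in2: "y0 + t *\<^sub>R v + w \<in> B2" if "t \<in> ball 0 e" "norm w < e" for t w
  proof -
    have "norm (t *\<^sub>R v + w) < 2 * e"
      using norm_triangle_ineq[of "t *\<^sub>R v" w] that v(1) by simp
    moreover have "dist y0 (y0 + t *\<^sub>R v + w) = norm (t *\<^sub>R v + w)"
      by (simp add: dist_norm norm_minus_commute add.assoc flip: norm_minus_cancel[of "t *\<^sub>R v + w"])
    ultimately show ?thesis by (simp add: e_def)
  qed
  have sh: "(\<lambda>w. y0 + w) ` ball 0 e \<subseteq> B2"
  proof (rule image_subsetI)
    fix w :: "real^2" assume "w \<in> ball 0 e"
    then show "y0 + w \<in> B2" using in2[of 0 w] e(1) by simp
  qed
  have Nb: "\<exists>b. \<forall>y\<in>B2. \<bar>Nv y\<bar> \<le> b"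
  proof -
    have "continuous_on CB (\<lambda>y. 2 * (p y \<bullet> v) - y \<bullet> v)" by (intro continuous_intros p_cont)
    then have "bounded ((\<lambda>y. 2 * (p y \<bullet> v) - y \<bullet> v) ` CB)"
      by (intro compact_imp_bounded compact_continuous_image) auto
    then obtain b where "\<forall>y\<in>CB. \<bar>2 * (p y \<bullet> v) - y \<bullet> v\<bar> \<le> b" by (auto simp: bounded_iff)
    then show ?thesis using Nv B2_sub(2) by (metis subsetD)
  qed
  then obtain b where b: "\<And>y. y \<in> B2 \<Longrightarrow> \<bar>Nv y\<bar> \<le> b" by blast
  have b0: "b \<ge> 0" using b[of y0] R(1) abs_ge_zero order_trans by fastforce
  \<comment> \<open>The kernel vanishes for \<open>norm w \<ge> e\<close>; the case distinction
    keeps the argument of \<open>Nv\<close> in \<open>B2\<close>, where \<open>p\<close> is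
    differentiable.\<close>
  let ?K = "\<lambda>t w. if norm w < e then Nv (y0 + t *\<^sub>R v + w) else 0"
  let ?K' = "\<lambda>t w s. if norm w < e then s * (2 * c (y0 + t *\<^sub>R v + w) - 1) else 0"
  have "((\<lambda>t :: real. LINT w|lborel. ?K t w *\<^sub>R moll e w) has_derivative (\<lambda>s. LINT w|lborel. ?K' 0 w s *\<^sub>R moll e w)) (at 0)"
  proof (rule has_derivative_lebesgue_integral[OF moll_integrable[OF e(1)] e(1), where K = ?K and K' = ?K' and B = b and C = 1])
    show "?K t \<in> borel_measurable lborel" for t by measurable
    show "\<bar>?K t w\<bar> \<le> b" if "t \<in> ball 0 e" for t w using b[OF in2[OF that]] b0 by simp
    show "((\<lambda>t. ?K t w) has_derivative ?K' t w) (at t)" if t: "t \<in> ball 0 e" for t w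
    proof (cases "norm w < e")
      case True
      have lin: "linear (D (y0 + t *\<^sub>R v + w))" by (rule D_linear[OF in2[OF t True]])
      have "((\<lambda>t. y0 + t *\<^sub>R v + w) has_derivative (\<lambda>s. s *\<^sub>R v)) (at t)"
        by (auto intro!: derivative_eq_intros)
      from has_derivative_compose[OF this p_derivative[OF in2[OF t True]]]
      have pd: "((\<lambda>t. p (y0 + t *\<^sub>R v + w)) has_derivative (\<lambda>s. D (y0 + t *\<^sub>R v + w) (s *\<^sub>R v))) (at t)" .
      have "((\<lambda>t. 2 * (p (y0 + t *\<^sub>R v + w) \<bullet> v) - (y0 + t *\<^sub>R v + w) \<bullet> v) has_derivative
          (\<lambda>s. 2 * (D (y0 + t *\<^sub>R v + w) (s *\<^sub>R v) \<bullet> v) - (s *\<^sub>R v) \<bullet> v)) (at t)"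
        by (intro has_derivative_diff has_derivative_mult_right has_derivative_inner_left pd)
          (auto intro!: derivative_eq_intros)
      moreover have "(\<lambda>s. 2 * (D (y0 + t *\<^sub>R v + w) (s *\<^sub>R v) \<bullet> v) - (s *\<^sub>R v) \<bullet> v) = ?K' t w"
        unfolding fun_eq_iff linear_scale[OF lin] c_def using True v(1)
        by (simp add: inner_commute dot_square_norm right_diff_distrib)
      ultimately have "((\<lambda>t. 2 * (p (y0 + t *\<^sub>R v + w) \<bullet> v) - (y0 + t *\<^sub>R v + w) \<bullet> v) has_derivative ?K' t w) (at t)"
        by simp
      moreover note open_ball t
      moreover have "2 * (p (y0 + s *\<^sub>R v + w) \<bullet> v) - (y0 + s *\<^sub>R v + w) \<bullet> v = ?K s w" if "s \<in> ball 0 e" for s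
        using True Nv[OF in2[OF that True]] by simp
      ultimately show ?thesis by (rule has_derivative_transform_within_open)
    qed simp
    show "\<bar>?K' t w s\<bar> \<le> 1 * norm s" if t: "t \<in> ball 0 e" for t w s
    proof (cases "norm w < e")
      case True
      have "\<bar>2 * c (y0 + t *\<^sub>R v + w) - 1\<bar> \<le> 1" using c0[OF in2[OF t True]] c1[OF in2[OF t True]] by auto
      then have "\<bar>s\<bar> * \<bar>2 * c (y0 + t *\<^sub>R v + w) - 1\<bar> \<le> \<bar>s\<bar> * 1" by (intro mult_left_mono) auto
      then show ?thesis using True by (simp add: abs_mult)
    qed simp
    show "(\<lambda>w. ?K' 0 w s) \<in> borel_measurable lborel" for s
    proof -
      have "continuous_on (ball 0 e) (\<lambda>w. c (y0 + w))"
        by (rule continuous_on_compose2[OF cc _ sh]) (intro continuous_intros)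
      then have "continuous_on (ball 0 e) (\<lambda>w. s * (2 * c (y0 + w) - 1))" by (intro continuous_intros)
      from borel_measurable_continuous_on_indicator[OF _ this]
      have "(\<lambda>w. indicator (ball 0 e) w *\<^sub>R (s * (2 * c (y0 + w) - 1))) \<in> borel_measurable borel" by simp
      also have "(\<lambda>w. indicator (ball 0 e) w *\<^sub>R (s * (2 * c (y0 + w) - 1))) = (\<lambda>w. ?K' 0 w s)"
        by (auto simp: fun_eq_iff indicator_def)
      finally show ?thesis by simp
    qed
  qed
  moreover note open_ball
  moreover have "(0 :: real) \<in> ball 0 e" using e by simp
  moreover have "(LINT w|lborel. ?K t w *\<^sub>R moll e w) = 2 * (p (y0 + t *\<^sub>R v) \<bullet> v) - (y0 + t *\<^sub>R v) \<bullet> v"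
    if "t \<in> ball 0 e" for t
  proof -
    have m: "y0 + t *\<^sub>R v \<in> B2" using in2[OF that, of 0] e(1) by simp
    have "(LINT w|lborel. ?K t w *\<^sub>R moll e w) = (LINT w|lborel. Nv (y0 + t *\<^sub>R v + w) * moll e w)"
      by (intro Bochner_Integration.integral_cong refl) (auto simp: moll_eq_0[OF e(1)] not_less)
    also have "\<dots> = Nv (y0 + t *\<^sub>R v)" using conv[OF m] by simp
    finally show ?thesis using Nv[OF m] by simp
  qed
  ultimately have d1: "((\<lambda>t :: real. 2 * (p (y0 + t *\<^sub>R v) \<bullet> v) - (y0 + t *\<^sub>R v) \<bullet> v) has_derivative
      (\<lambda>s. LINT w|lborel. ?K' 0 w s *\<^sub>R moll e w)) (at 0)"
    by (rule has_derivative_transform_within_open)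
  have y0B2: "y0 \<in> B2" using R(1) by simp
  have d2: "((\<lambda>t :: real. 2 * (p (y0 + t *\<^sub>R v) \<bullet> v) - (y0 + t *\<^sub>R v) \<bullet> v) has_derivative
      (\<lambda>s. 2 * (D y0 (s *\<^sub>R v) \<bullet> v) - (s *\<^sub>R v) \<bullet> v)) (at 0)"
  proof -
    have "((\<lambda>t :: real. y0 + t *\<^sub>R v) has_derivative (\<lambda>s. s *\<^sub>R v)) (at 0)"
      by (auto intro!: derivative_eq_intros)
    moreover have "(p has_derivative D y0) (at (y0 + 0 *\<^sub>R v))" using p_derivative[OF y0B2] by simp
    ultimately have "((\<lambda>t :: real. p (y0 + t *\<^sub>R v)) has_derivative (\<lambda>s. D y0 (s *\<^sub>R v))) (at 0)"
      by (rule has_derivative_compose)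
    then show ?thesis
      by (intro has_derivative_diff has_derivative_mult_right has_derivative_inner_left)
        (auto intro!: derivative_eq_intros)
  qed
  \<comment> \<open>The two derivatives at \<open>t = 0\<close> coincide. As
    \<open>D y0 v = 0\<close>, their value is -1, so the weighted average of
    \<open>2 * c - 1\<close> is -1 and that of the nonnegative function \<open>c\<close> is
    0.\<close>
  have "(LINT w|lborel. ?K' 0 w 1 *\<^sub>R moll e w) = -1"
    using fun_cong[OF has_derivative_unique[OF d1 d2], of 1] v by (simp add: dot_square_norm)
  \<comment> \<open>A function that is not integrable would have the default integral 0 instead of
    -1.\<close>
  moreover have ii: "integrable lborel (\<lambda>w. ?K' 0 w 1 *\<^sub>R moll e w)"
  proof (rule ccontr)
    assume "\<not> ?thesis"
    then show False using calculation by (simp add: not_integrable_integral_eq)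
  qed
  moreover have "(LINT w|lborel. moll e (w :: real^2)) = 1" by (rule moll_integral[OF e(1)])
  ultimately have "(LINT w|lborel. ?K' 0 w 1 *\<^sub>R moll e w + moll e w) = 0"
    using moll_integrable[OF e(1), where 'a = "real^2"] by simp
  moreover have eq: "?K' 0 w 1 *\<^sub>R moll e w + moll e w = (if norm w < e then 2 * c (y0 + w) * moll e w else 0)" for w
    by (simp add: moll_eq_0[OF e(1)] not_less algebra_simps)
  ultimately have "(LINT w|lborel. (if norm w < e then 2 * c (y0 + w) * moll e w else 0)) = 0" by simp
  moreover have "integrable lborel (\<lambda>w. if norm w < e then 2 * c (y0 + w) * moll e w else 0)"
    using Bochner_Integration.integrable_add[OF ii moll_integrable[OF e(1)]] unfolding eq .
  moreover have "AE w in lborel. 0 \<le> (if norm w < e then 2 * c (y0 + w) * moll e w else 0)"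
    using c0 in2[of 0] e(1) moll_nonneg[OF e(1), where 'a = "real^2"] by (intro AE_I2) simp
  ultimately have "AE w in lborel. (if norm w < e then 2 * c (y0 + w) * moll e w else 0) = 0"
    by (simp add: integral_nonneg_eq_0_iff_AE)
  then have ae: "AE w in lborel. w \<in> ball 0 e \<longrightarrow> c (y0 + w) = 0"
  proof eventually_elim
    case (elim w)
    then show ?case using moll_pos[OF e(1), of w] by (auto split: if_splits)
  qed
  have "c (y0 + (y - y0)) = 0"
  proof (rule AE_eq_continuous[OF open_ball _ continuous_on_const ae])
    show "continuous_on (ball 0 e) (\<lambda>w. c (y0 + w))"
      by (rule continuous_on_compose2[OF cc _ sh]) (intro continuous_intros)
    show "y - y0 \<in> ball 0 e" using y by (simp add: e_def dist_norm norm_minus_commute)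
  qed
  then show ?thesis by (simp add: c_def)
qed

end

section \<open>Invertibility of the derivative of the limit, by a comparison of areas\<close>

lemma closed_negligible_AE:
  assumes "closed Z" "negligible Z"
  shows "AE x in lborel. x \<notin> Z"
proof -
  have "Z \<in> null_sets lebesgue" using assms(2) negligible_iff_null_sets by blast
  then have "Z \<in> null_sets lborel" using assms(1) by (subst (asm) null_sets_completion_iff) auto
  then show ?thesis by (rule AE_not_in)
qed

context monge_ampere_limit
begin

abbreviation "B3 \<equiv> ball y0 (R / 32)"

lemma B3_sub: "B3 \<subseteq> B2" "B3 \<subseteq> CB"
  using R(1) by auto

text \<open>If \<open>D y0 v = 0\<close>, the limit maps \<open>B3\<close> into a line. But \<open>B3\<close> is the image under \<open>P (d k)\<close> of
  sets converging to this line, and the Jacobians of \<open>P (d k)\<close> are uniformly integrable.\<close>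
lemma B3_measure_le:
  "measure lborel B3 \<le> (LINT x|lborel. indicator (psi (d k) ` B3) x * (2 + (H x $ 1 $ 1 + H x $ 2 $ 2)))
     + (LINT x|lborel. indicator S x * \<bar>det (M (d k) x) - 1\<bar>)
     + (LINT x|lborel. indicator S x * norm (M (d k) x $ 1 $ 1 - H x $ 1 $ 1))
     + (LINT x|lborel. indicator S x * norm (M (d k) x $ 2 $ 2 - H x $ 2 $ 2))"
proof -
  let ?X = "psi (d k) ` B3" and ?J = "\<lambda>x. det (mat 1 + M (d k) x)"
  let ?h = "\<lambda>x. 2 + (H x $ 1 $ 1 + H x $ 2 $ 2)"
  have X: "open ?X" "?X \<subseteq> S" using psi_image_open[OF open_ball B3_sub(2)] psi_in_S[OF B3_sub(2)] by auto
  have Sm: "S \<in> sets borel" using S(1) by simp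
  note dM = det_M_tendsto_L1(1)[OF d(1) d(3) M_lim, of k]
  have iS: "integrable lborel (indicator S :: real^2 \<Rightarrow> real)"
    using emeasure_bounded_finite[OF S(2)] Sm by (intro integrable_real_indicator) auto
  have iSg: "integrable lborel (\<lambda>x. indicator S x * g x)" if "integrable lborel g" for g :: "real^2 \<Rightarrow> real"
    using integrable_real_mult_indicator[OF _ that, of S] Sm by (simp add: mult.commute)
  have Mint: "integrable lborel (\<lambda>x. M (d k) x $ i $ j)" for i j
    using conv_moll_norm(1)[OF entry_int d(1), of i j k] by (simp add: M_entry[OF d(1)] )
  have Jeq: "?J x = 1 + (M (d k) x $ 1 $ 1 + M (d k) x $ 2 $ 2) + det (M (d k) x)" for x
    by (rule det_id_plus)
  have Jc: "continuous_on UNIV ?J"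
    unfolding Jeq det_2 using M_continuous[OF d(1)] by (intro continuous_intros)
  have JS: "set_integrable lborel S ?J"
  proof -
    have "integrable lborel (\<lambda>x. 2 * indicator S x + indicator S x * (M (d k) x $ 1 $ 1 + M (d k) x $ 2 $ 2)
        + indicator S x *\<^sub>R (det (M (d k) x) - 1))"
      using iS iSg[OF Bochner_Integration.integrable_add[OF Mint Mint]] dM
      by (intro Bochner_Integration.integrable_add integrable_mult_right) (auto simp: set_integrable_def)
    then show ?thesis unfolding set_integrable_def Jeq by (simp add: algebra_simps)
  qed
  have JX: "set_integrable lborel ?X ?J" by (rule set_integrable_subset[OF JS]) (use X in auto)
  have der: "(psi (d k) has_derivative (\<lambda>v. inv2 (A k y) *v v)) (at y)" if "y \<in> B3" for y
    using psi_der B3_sub(2) that by blast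
  have dc: "continuous_on B3 (\<lambda>y. det (inv2 (A k y)))"
    unfolding det_2 by (intro continuous_on_diff continuous_on_mult continuous_on_subset[OF inv2_cont B3_sub(2)])
  note cv = change_of_variables[OF open_ball der dc inj_on_subset[OF inj_psi B3_sub(2)] X(1)
      borel_measurable_continuous_onI[OF Jc] JX]
  have one: "\<bar>det (inv2 (A k y))\<bar> * det (A k y) = 1" for y
    using A_pos[of k y] by (simp add: det_inv2)
  \<comment> \<open>The area formula for \<open>psi (d k)\<close> with the integrand
    \<open>det (mat 1 + M (d k) x)\<close>, which is the reciprocal of the Jacobian of
    \<open>psi (d k)\<close>.\<close>
  have "measure lborel B3 = (LINT y:B3|lborel. \<bar>det (inv2 (A k y))\<bar> * det (A k y))"
    unfolding one set_lebesgue_integral_def by simp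
  also have "\<dots> = (LINT x|lborel. indicator ?X x * ?J x)"
    using cv(2) by (simp add: set_lebesgue_integral_def)
  also have "\<dots> \<le> (LINT x|lborel. indicator ?X x * ?h x + indicator S x * \<bar>det (M (d k) x) - 1\<bar>
      + indicator S x * norm (M (d k) x $ 1 $ 1 - H x $ 1 $ 1)
      + indicator S x * norm (M (d k) x $ 2 $ 2 - H x $ 2 $ 2))" (is "_ \<le> (LINT x|lborel. ?a x + ?b x + ?c x + ?e x)")
  proof (rule integral_mono)
    show "integrable lborel (\<lambda>x. indicator ?X x * ?J x)" using JX by (simp add: set_integrable_def)
    have "integrable lborel ?a" "integrable lborel ?b" "integrable lborel ?c" "integrable lborel ?e"
    proof -
      have "integrable lborel (\<lambda>x. indicator S x * ?h x)"
        using Bochner_Integration.integrable_add[OF integrable_mult_right[OF iS, of 2]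
            iSg[OF Bochner_Integration.integrable_add[OF entry_int entry_int]], of 1 1 2 2]
        by (simp add: algebra_simps)
      then have "set_integrable lborel S ?h" by (simp add: set_integrable_def)
      from set_integrable_subset[OF this, of ?X] X show "integrable lborel ?a"
        by (simp add: set_integrable_def)
      show "integrable lborel ?b"
        using integrable_abs[OF dM[unfolded set_integrable_def]] by (simp add: abs_mult)
      show "integrable lborel ?c" "integrable lborel ?e"
        by (intro iSg integrable_norm Bochner_Integration.integrable_diff Mint entry_int)+
    qed
    then show "integrable lborel (\<lambda>x. ?a x + ?b x + ?c x + ?e x)" by (intro Bochner_Integration.integrable_add)
    \<comment> \<open>The integrand is \<open>2 + trace M + (det M - 1)\<close>. Every mollified
      trace entry is replaced by its limit at the price of an L1 error over all of
      \<open>S\<close>.\<close>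
    show "indicator ?X x * ?J x \<le> ?a x + ?b x + ?c x + ?e x" for x
    proof (cases "x \<in> ?X")
      case True
      moreover from True have "x \<in> S" using X(2) by blast
      ultimately show ?thesis unfolding Jeq by simp
    next
      case False
      then show ?thesis by simp
    qed
  qed
  also have "\<dots> = (LINT x|lborel. ?a x) + (LINT x|lborel. ?b x) + (LINT x|lborel. ?c x) + (LINT x|lborel. ?e x)"
  proof -
    have "integrable lborel (\<lambda>x. indicator S x * ?h x)"
      using Bochner_Integration.integrable_add[OF integrable_mult_right[OF iS, of 2]
          iSg[OF Bochner_Integration.integrable_add[OF entry_int entry_int]], of 1 1 2 2]
      by (simp add: algebra_simps)
    then have "set_integrable lborel S ?h" by (simp add: set_integrable_def)
    from set_integrable_subset[OF this, of ?X] X have a: "integrable lborel ?a"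
      by (simp add: set_integrable_def)
    have b: "integrable lborel ?b"
      using integrable_abs[OF dM[unfolded set_integrable_def]] by (simp add: abs_mult)
    have c: "integrable lborel ?c" "integrable lborel ?e"
      by (intro iSg integrable_norm Bochner_Integration.integrable_diff Mint entry_int)+
    show ?thesis using a b c by simp
  qed
  finally show ?thesis .
qed

lemma nondegenerate_unit:
  assumes v: "norm v = 1"
  shows "D y0 v \<noteq> 0"
proof
  assume v0: "D y0 v = 0"
  have z: "v \<bullet> D y v = 0" if "y \<in> B3" for y by (rule D_degenerate[OF v v0 that])
  have perp: "v \<bullet> D y w = 0" if y: "y \<in> B3" for y w
  proof (rule ccontr)
    have yB2: "y \<in> B2" using y B3_sub by blast
    have lin: "linear (D y)" by (rule D_linear[OF yB2])
    have "(norm (D y v))\<^sup>2 \<le> 0" using D_firm[OF yB2, of v] z[OF y] by simp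
    then have Dv: "D y v = 0" by simp
    assume ne: "v \<bullet> D y w \<noteq> 0"
    \<comment> \<open>\<open>D y v = 0\<close> leaves
      \<open>w \<bullet> D y w + s * (v \<bullet> D y w)\<close> of the form at
      \<open>w + s *\<^sub>R v\<close>; this \<open>s\<close> makes it -1.\<close>
    define s where "s = - (w \<bullet> D y w + 1) / (v \<bullet> D y w)"
    have "0 \<le> (w + s *\<^sub>R v) \<bullet> D y (w + s *\<^sub>R v)" by (rule D_nonneg[OF yB2])
    also have "\<dots> = w \<bullet> D y w + s * (v \<bullet> D y w)"
      by (simp add: linear_add[OF lin] linear_scale[OF lin] Dv inner_add_left)
    also have "\<dots> = -1" using ne by (simp add: s_def)
    finally show False by simp
  qed
  have const: "\<exists>c. \<forall>y\<in>B3. p y \<bullet> v = c"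
  proof (rule has_derivative_zero_constant[OF convex_ball])
    fix y assume y: "y \<in> B3"
    then have "(p has_derivative D y) (at y within B3)"
      using p_derivative has_derivative_at_withinI B3_sub by blast
    from has_derivative_inner_left[OF this, of v]
    show "((\<lambda>y. p y \<bullet> v) has_derivative (\<lambda>h. 0)) (at y within B3)"
      using perp[OF y] by (simp add: inner_commute)
  qed
  have y0B3: "y0 \<in> B3" using R(1) by simp
  \<comment> \<open>So \<open>p\<close> maps \<open>B3\<close> into the line through
    \<open>x0\<close> orthogonal to \<open>v\<close>, a null set.\<close>
  then have line: "p y \<bullet> v = x0 \<bullet> v" if "y \<in> B3" for y using const that p_y0 by metis
  let ?Z = "{x. v \<bullet> x = v \<bullet> x0}"
  let ?h = "\<lambda>x. 2 + (H x $ 1 $ 1 + H x $ 2 $ 2)"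
  have Zae: "AE x in lborel. x \<notin> ?Z"
    by (rule closed_negligible_AE[OF closed_hyperplane negligible_hyperplane]) (use v in auto)
  have Sm: "S \<in> sets borel" using S(1) by simp
  have iS: "integrable lborel (indicator S :: real^2 \<Rightarrow> real)"
    using emeasure_bounded_finite[OF S(2)] Sm by (intro integrable_real_indicator) auto
  have [measurable]: "?h \<in> borel_measurable borel"
    using borel_measurable_integrable[OF entry_int] by (intro borel_measurable_add) auto
  have "(\<lambda>k. LINT x|lborel. indicator (psi (d k) ` B3) x * ?h x) \<longlonglongrightarrow> (LINT x|(lborel :: (real^2) measure). (0 :: real))"
  proof (rule integral_dominated_convergence[where w = "\<lambda>x. indicator S x * \<bar>?h x\<bar>"])
    show "integrable lborel (\<lambda>x. indicator S x * \<bar>?h x\<bar>)"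
    proof -
      have "integrable lborel (\<lambda>x. indicator S x * (H x $ 1 $ 1 + H x $ 2 $ 2))"
        using integrable_real_mult_indicator[OF _ Bochner_Integration.integrable_add[OF entry_int entry_int], of S 1 1 2 2] Sm
        by (simp add: mult.commute)
      from integrable_abs[OF Bochner_Integration.integrable_add[OF integrable_mult_right[OF iS, of 2] this]]
      have "integrable lborel (\<lambda>x. \<bar>indicator S x * ?h x\<bar>)" by (simp add: algebra_simps)
      then show ?thesis by (simp add: abs_mult)
    qed
    show "(\<lambda>x. indicator (psi (d k) ` B3) x * ?h x) \<in> borel_measurable lborel" for k
    proof -
      have "psi (d k) ` B3 \<in> sets borel" using psi_image_open[OF open_ball B3_sub(2)] by simp
      then show ?thesis by (intro borel_measurable_times borel_measurable_indicator) auto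
    qed
    show "AE x in lborel. norm (indicator (psi (d k) ` B3) x * ?h x) \<le> indicator S x * \<bar>?h x\<bar>" for k
      using psi_in_S[OF B3_sub(2), of k] by (intro AE_I2) (auto simp: indicator_def)
    show "AE x in lborel. (\<lambda>k. indicator (psi (d k) ` B3) x * ?h x) \<longlonglongrightarrow> 0"
      using Zae
    proof eventually_elim
      case (elim x)
      \<comment> \<open>By uniform convergence a point at distance \<open>e > 0\<close> from the
        line is eventually missed by the images of \<open>B3\<close>, so their indicators tend to 0
        almost everywhere.\<close>
      define e where "e = \<bar>v \<bullet> x - v \<bullet> x0\<bar>"
      have "e > 0" using elim by (simp add: e_def)
      with p_lim have "\<forall>\<^sub>F k in sequentially. \<forall>y\<in>CB. dist (psi (d k) y) (p y) < e"
        by (rule uniform_limitD)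
      then have "\<forall>\<^sub>F k in sequentially. indicator (psi (d k) ` B3) x * ?h x = 0"
      proof eventually_elim
        case (elim k)
        have "x \<notin> psi (d k) ` B3"
        proof
          assume "x \<in> psi (d k) ` B3"
          then obtain y where y: "y \<in> B3" "x = psi (d k) y" by blast
          have "e = \<bar>v \<bullet> (psi (d k) y - p y)\<bar>"
            using line[OF y(1)] y(2) by (simp add: e_def inner_diff_right inner_commute)
          also have "\<dots> \<le> norm (psi (d k) y - p y)"
            using Cauchy_Schwarz_ineq2[of v "psi (d k) y - p y"] v by simp
          also have "\<dots> < e" using elim y(1) B3_sub(2) by (auto simp: dist_norm)
          finally show False by simp
        qed
        then show ?case by simp
      qed
      then show ?case by (rule tendsto_eventually)
    qed
  qed simp
  moreover have "(\<lambda>k. LINT x|lborel. indicator S x * \<bar>det (M (d k) x) - 1\<bar>) \<longlonglongrightarrow> 0"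
    by (rule det_M_tendsto_L1(2)[OF d(1) d(3) M_lim])
  moreover have "(\<lambda>k. LINT x|lborel. indicator S x * norm (M (d k) x $ i $ j - H x $ i $ j)) \<longlonglongrightarrow> 0" for i j
    using conv_moll_tendsto_L1[OF entry_int S(2) Sm d(1) d(3), of i j] by (simp add: M_entry[OF d(1)])
  ultimately have "(\<lambda>k. (LINT x|lborel. indicator (psi (d k) ` B3) x * ?h x)
     + (LINT x|lborel. indicator S x * \<bar>det (M (d k) x) - 1\<bar>)
     + (LINT x|lborel. indicator S x * norm (M (d k) x $ 1 $ 1 - H x $ 1 $ 1))
     + (LINT x|lborel. indicator S x * norm (M (d k) x $ 2 $ 2 - H x $ 2 $ 2))) \<longlonglongrightarrow> 0 + 0 + 0 + 0"
    by (intro tendsto_add) simp_all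
  then have "measure lborel B3 \<le> 0 + 0 + 0 + 0"
    by (rule LIMSEQ_le_const) (use B3_measure_le in blast)
  moreover have "measure lborel B3 > 0"
    using content_ball_pos[of "R / 32" y0] R(1) by simp
  ultimately show False by simp
qed

lemma nondegenerate: "D y0 v = 0 \<Longrightarrow> v = 0"
proof (rule ccontr)
  assume v: "D y0 v = 0" "v \<noteq> 0"
  have "linear (D y0)" using R(1) by (intro D_linear) simp
  then have "D y0 ((1 / norm v) *\<^sub>R v) = 0" using v by (simp add: linear_scale)
  moreover have "norm ((1 / norm v) *\<^sub>R v) = 1" using v by simp
  ultimately show False using nondegenerate_unit by blast
qed

section \<open>The inverse of the limit map and its identification with the Lewy map\<close>

definition Dm :: "real^2 \<Rightarrow> real^2^2" where
  "Dm y = matrix (D y)"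

lemma Dm: "y \<in> B2 \<Longrightarrow> D y v = Dm y *v v"
  unfolding Dm_def using matrix_works[OF D_linear[folded linear_matrix_vector_mul_eq]] by simp

lemma Dm_smooth: "smooth_on B2 (\<lambda>y. Dm y $ i $ j)"
  unfolding Dm_def D_def matrix_def
  using smooth_on_linear[OF bounded_linear_vec_nth open_ball smooth_on_derivative[OF p_smooth]] by simp

lemma det_Dm_smooth: "smooth_on B2 (\<lambda>y. det (Dm y))"
  unfolding det_2 by (intro smooth_on_diff smooth_on_mult Dm_smooth open_ball)

lemma det_Dm_y0: "det (Dm y0) \<noteq> 0"
proof
  assume z: "det (Dm y0) = 0"
  have y0: "y0 \<in> B2" using R(1) by simp
  let ?M = "Dm y0"
  \<comment> \<open>The columns of the adjugate of a singular matrix lie in its kernel; by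
    nondegeneracy they are 0, and so is the matrix.\<close>
  have "?M *v vector [?M $ 2 $ 2, - (?M $ 2 $ 1)] = 0" "?M *v vector [- (?M $ 1 $ 2), ?M $ 1 $ 1] = 0"
    using z by (simp_all add: det_2 vec_eq_iff forall_2 matrix_vector_mult_def sum_2 algebra_simps)
  then have "(vector [?M $ 2 $ 2, - (?M $ 2 $ 1)] :: real^2) = 0" "(vector [- (?M $ 1 $ 2), ?M $ 1 $ 1] :: real^2) = 0"
    using nondegenerate Dm[OF y0] by metis+
  then have "?M = 0" by (simp add: vec_eq_iff forall_2)
  then have "D y0 (axis 1 1) = 0" using Dm[OF y0] by simp
  then have "axis 1 1 = (0 :: real^2)" by (rule nondegenerate)
  then show False by simp
qed

text \<open>Minty's argument: a maximal monotone map is determined by its monotonicity relative to the graph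
  of the inverse.\<close>
lemma minty:
  assumes x: "x \<in> cball x0 R" "(\<lambda>k. P (d k) x) \<longlonglongrightarrow> z"
    and V: "open V" "x \<in> V" "isCont g x" and g: "\<And>x'. x' \<in> V \<Longrightarrow> g x' \<in> CB \<and> p (g x') = x'"
  shows "z = g x"
proof -
  have mono: "(z - y) \<bullet> (x - p y) \<ge> 0" if "y \<in> CB" for y
  proof (rule tendsto_lowerbound)
    show "(\<lambda>k. (P (d k) x - y) \<bullet> (x - psi (d k) y)) \<longlonglongrightarrow> (z - y) \<bullet> (x - p y)"
      by (intro tendsto_intros x(2) psi_lim that)
    have "(P (d k) x - y) \<bullet> (x - psi (d k) y) \<ge> 0" for k
    proof -
      have "psi (d k) y \<in> cball x0 R" using psi_mem(1)[OF that, of k] by simp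
      from P_expanding'[OF d(1,2) x(1) this, of k] psi_mem(2)[OF that, of k]
      show ?thesis using order_trans[OF zero_le_power2] by simp
    qed
    then show "\<forall>\<^sub>F k in sequentially. (P (d k) x - y) \<bullet> (x - psi (d k) y) \<ge> 0" by simp
  qed simp
  \<comment> \<open>Testing monotonicity with \<open>g (x - t *\<^sub>R ?u)\<close> and dividing by
    \<open>t > 0\<close> leaves \<open>(z - g x) \<bullet> (g x - z) \<ge> 0\<close> as
    \<open>t\<close> tends to 0.\<close>
  let ?u = "g x - z"
  have "(z - g x) \<bullet> ?u \<ge> 0"
  proof (rule tendsto_lowerbound)
    let ?F = "at_right (0 :: real)"
    have l: "((\<lambda>t :: real. x - t *\<^sub>R ?u) \<longlongrightarrow> x - 0 *\<^sub>R ?u) ?F" by (intro tendsto_intros)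
    then have l': "((\<lambda>t :: real. x - t *\<^sub>R ?u) \<longlongrightarrow> x) ?F" by simp
    show "((\<lambda>t. (z - g (x - t *\<^sub>R ?u)) \<bullet> ?u) \<longlongrightarrow> (z - g x) \<bullet> ?u) ?F"
      by (intro tendsto_intros isCont_tendsto_compose[OF V(3) l'])
    have "\<forall>\<^sub>F t in ?F. x - t *\<^sub>R ?u \<in> V" by (rule topological_tendstoD[OF l' V(1,2)])
    moreover have "\<forall>\<^sub>F t in ?F. t > 0" by (simp add: eventually_at_filter)
    ultimately show "\<forall>\<^sub>F t in ?F. (z - g (x - t *\<^sub>R ?u)) \<bullet> ?u \<ge> 0"
    proof eventually_elim
      case (elim t)
      have "(z - g (x - t *\<^sub>R ?u)) \<bullet> (x - (x - t *\<^sub>R ?u)) \<ge> 0"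
        using mono[of "g (x - t *\<^sub>R ?u)"] g[OF elim(1)] by simp
      then show ?case using elim(2) by (simp add: zero_le_mult_iff)
    qed
  qed simp
  moreover have "(z - g x) \<bullet> ?u = - ((z - g x) \<bullet> (z - g x))"
    by (metis inner_minus_right minus_diff_eq)
  ultimately have "(z - g x) \<bullet> (z - g x) \<le> 0" by linarith
  then have "z - g x = 0" by (meson inner_gt_zero_iff not_le)
  then show ?thesis by simp
qed

text \<open>At \<open>y0\<close> the derivative is invertible, so the inverse function theorem
  yields \<open>g\<close>. Minty's argument applies at each point where the mollified maps converge,
  hence almost everywhere.\<close>

lemma local_inverse:
  "\<exists>V W g. open V \<and> open W \<and> x0 \<in> V \<and> V \<subseteq> S \<and> W \<subseteq> B2 \<and>
     g ` V \<subseteq> W \<and> p ` W \<subseteq> V \<and> (\<forall>x\<in>V. p (g x) = x) \<and> (\<forall>y\<in>W. g (p y) = y) \<and>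
     (\<forall>y\<in>W. det (Dm y) \<noteq> 0) \<and>
     (\<forall>x\<in>V. (g has_derivative (\<lambda>v. inv2 (Dm (g x)) *v v)) (at x)) \<and>
     (AE x in lborel. x \<in> V \<longrightarrow> \<phi> x = g x - x)"
proof -
  have y0: "y0 \<in> B2" using R(1) by simp
  have blin: "bounded_linear (D y)" if "y \<in> B2" for y
    using D_linear[OF that] linear_conv_bounded_linear by blast
  have ap: "blinfun_apply (Blinfun (D y)) = D y" if "y \<in> B2" for y
    using bounded_linear_Blinfun_apply[OF blin[OF that]] .
  have cont: "continuous_on B2 (\<lambda>y. Blinfun (D y))"
  proof (rule continuous_on_blinfun_componentwise)
    fix i :: "real^2" assume "i \<in> Basis"
    show "continuous_on B2 (\<lambda>y. blinfun_apply (Blinfun (D y)) i)"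
      using D_cont[of i] by (rule continuous_on_eq) (simp add: ap)
  qed
  have apI: "blinfun_apply (Blinfun ((*v) (inv2 (Dm y0)))) = (*v) (inv2 (Dm y0))"
    by (rule bounded_linear_Blinfun_apply[OF matrix_vector_mul_bounded_linear])
  have inv: "Blinfun ((*v) (inv2 (Dm y0))) o\<^sub>L Blinfun (D y0) = id_blinfun"
    by (rule blinfun_eqI) (simp add: apI ap[OF y0] Dm[OF y0] matrix_vector_mul_assoc inv2_mult[OF det_Dm_y0])
  have der: "(p has_derivative blinfun_apply (Blinfun (D y))) (at y)" if "y \<in> B2" for y
    unfolding ap[OF that] by (rule p_derivative[OF that])
  obtain U V g g' where U: "open U" "U \<subseteq> B2" "y0 \<in> U" and V: "open V" "p y0 \<in> V"
      and hom: "homeomorphism U V p g"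
      and g': "\<And>x. x \<in> V \<Longrightarrow> (g has_derivative g' x) (at x)"
        "\<And>x. x \<in> V \<Longrightarrow> g' x = inv (blinfun_apply (Blinfun (D (g x))))"
    by (rule inverse_function_theorem[OF open_ball der cont y0 inv]) blast+
  have gU: "g x \<in> U" "p (g x) = x" if "x \<in> V" for x using hom that by (auto simp: homeomorphism_def)
  have pV: "p y \<in> V" "g (p y) = y" if "y \<in> U" for y using hom that by (auto simp: homeomorphism_def)
  define Z where "Z = {y \<in> B2. det (Dm y) \<noteq> 0}"
  have Z: "open Z"
  proof -
    have "Z = B2 \<inter> (\<lambda>y. det (Dm y)) -` (- {0})" by (auto simp: Z_def)
    then show ?thesis
      using continuous_open_preimage[OF smooth_on_continuous[OF det_Dm_smooth] open_ball, of "- {0}"] by auto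
  qed
  \<comment> \<open>Three requirements: \<open>p\<close> is invertible, its derivative is invertible
    at every point, and its values lie in the ball in which \<open>minty\<close> compares with
    \<open>P (d k)\<close>.\<close>
  define W where "W = U \<inter> Z \<inter> (B2 \<inter> p -` (ball x0 R))"
  define V' where "V' = V \<inter> g -` W"
  have pc: "continuous_on B2 p" by (rule continuous_on_subset[OF p_cont B2_sub(2)])
  have W: "open W" unfolding W_def
    by (intro open_Int U(1) Z continuous_open_preimage[OF pc open_ball open_ball])
  have gc: "continuous_on V g" using hom by (auto simp: homeomorphism_def)
  have V': "open V'" unfolding V'_def by (rule continuous_open_preimage[OF gc V(1) W])
  have y0W: "y0 \<in> W" using U(3) y0 det_Dm_y0 p_y0 R(1) by (simp add: W_def Z_def)
  have x0V: "x0 \<in> V'" using pV[OF U(3)] y0W p_y0 by (simp add: V'_def)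
  have V'b: "x \<in> ball x0 R" if "x \<in> V'" for x
    using that gU(2)[of x] by (auto simp: V'_def W_def)
  have gd: "(g has_derivative (\<lambda>v. inv2 (Dm (g x)) *v v)) (at x)" if "x \<in> V'" for x
  proof -
    have x: "x \<in> V" "g x \<in> B2" "det (Dm (g x)) \<noteq> 0" using that by (auto simp: V'_def W_def Z_def)
    have "inv (D (g x)) = (\<lambda>v. inv2 (Dm (g x)) *v v)"
      by (rule inv_unique_comp)
        (simp_all add: fun_eq_iff Dm[OF x(2)] matrix_vector_mul_assoc inv2_mult[OF x(3)])
    then show ?thesis using g'[OF x(1)] ap[OF x(2)] by simp
  qed
  have ae: "AE x in lborel. x \<in> V' \<longrightarrow> \<phi> x = g x - x"
    using P_lim
  proof eventually_elim
    case (elim x)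
    show ?case
    proof
      assume x: "x \<in> V'"
      then have xb: "x \<in> cball x0 R" using V'b[OF x] by simp
      then have "x \<in> S" using cball_in[of R x] R(1) by auto
      with elim have l: "(\<lambda>k. P (d k) x) \<longlonglongrightarrow> x + \<phi> x" by blast
      have "isCont g x" using gd[OF x] has_derivative_continuous by blast
      then have "x + \<phi> x = g x"
        by (rule minty[OF xb l V' x]) (use B2_sub(2) gU(2) in \<open>auto simp: V'_def W_def\<close>)
      then show "\<phi> x = g x - x" by (simp add: algebra_simps)
    qed
  qed
  have V'S: "V' \<subseteq> S"
  proof
    fix x assume "x \<in> V'"
    from V'b[OF this] have "x \<in> cball x0 R" by simp
    then show "x \<in> S" using cball_in[of R x] R(1) by auto
  qed
  show ?thesis
  proof (rule exI[of _ V'], rule exI[of _ W], rule exI[of _ g], intro conjI)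
    show "p ` W \<subseteq> V'" using pV by (auto simp: V'_def W_def)
    show "open V'" "open W" "x0 \<in> V'" "V' \<subseteq> S" by (fact V' W x0V V'S)+
    show "AE x in lborel. x \<in> V' \<longrightarrow> \<phi> x = g x - x" by (rule ae)
  qed (use gd gU(2) pV(2) in \<open>auto simp: V'_def W_def Z_def\<close>)
qed

end

section \<open>Conformal charts\<close>

text \<open>Conformality is no assumption here; it comes later from
  \<open>H = inv2 (Dp (g x)) - mat 1\<close>. The constant \<open>C\<close> serves twice: bounding
  the inverse determinant, it carries L1 convergence from \<open>V\<close> to \<open>W\<close>;
  bounding the entries, it controls the coefficients of the transformed system.\<close>

locale chart =
  fixes V W :: "(real^2) set" and g p :: "real^2 \<Rightarrow> real^2" and Dp :: "real^2 \<Rightarrow> real^2^2" and C :: real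
  assumes V: "open V" and W: "open W" "bounded W"
    and g: "\<And>x. x \<in> V \<Longrightarrow> g x \<in> W" "\<And>x. x \<in> V \<Longrightarrow> p (g x) = x"
    and p: "\<And>y. y \<in> W \<Longrightarrow> p y \<in> V" "\<And>y. y \<in> W \<Longrightarrow> g (p y) = y"
    and Dp_smooth: "\<And>i j. smooth_on W (\<lambda>y. Dp y $ i $ j)"
    and p_der: "\<And>y. y \<in> W \<Longrightarrow> (p has_derivative (\<lambda>v. Dp y *v v)) (at y)"
    and det: "\<And>y. y \<in> W \<Longrightarrow> det (Dp y) \<noteq> 0"
    and g_der: "\<And>x. x \<in> V \<Longrightarrow> (g has_derivative (\<lambda>v. inv2 (Dp (g x)) *v v)) (at x)"
    and C: "\<And>y. y \<in> W \<Longrightarrow> 1 / \<bar>det (Dp y)\<bar> \<le> C" "\<And>y i j. y \<in> W \<Longrightarrow> \<bar>Dp y $ i $ j\<bar> \<le> C" "C \<ge> 0"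
begin

lemma images: "p ` W = V" "g ` V = W"
  using g p by (auto intro: image_eqI[of _ _ "g _"] image_eqI[of _ _ "p _"]) (metis image_eqI)+

lemma g_cont: "continuous_on V g"
  using has_derivative_continuous[OF g_der] by (simp add: continuous_at_imp_continuous_on)

lemma p_cont: "continuous_on W p"
  using has_derivative_continuous[OF p_der] by (simp add: continuous_at_imp_continuous_on)

lemma smooth_compose:
  fixes G :: "real^2 \<Rightarrow> real"
  assumes "open W'" "W' \<subseteq> W" "smooth_on W' G"
  shows "smooth_on (V \<inter> g -` W') (\<lambda>x. G (g x))"
proof (rule smooth_on_compose_inverse[OF _ assms(1) _ _ _ assms(3), where Q = "\<lambda>y v. inv2 (Dp y) *v v"])
  show "open (V \<inter> g -` W')" by (rule continuous_open_preimage[OF g_cont V assms(1)])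
  show "g ` (V \<inter> g -` W') \<subseteq> W'" by auto
  show "(g has_derivative (\<lambda>v. inv2 (Dp (g x)) *v v)) (at x)" if "x \<in> V \<inter> g -` W'" for x
    using that by (intro g_der) auto
  have Ds: "smooth_on W' (\<lambda>y. Dp y $ i $ j)" for i j by (rule smooth_on_subset[OF Dp_smooth assms(2)])
  have "smooth_on W' (\<lambda>y. inverse (det (Dp y)))"
    using det assms(2) unfolding det_2
    by (intro smooth_on_inverse smooth_on_diff smooth_on_mult Ds assms(1)) auto
  then have i: "smooth_on W' (\<lambda>y. inv2 (Dp y) $ i $ j)" for i j
    using exhaust_2[of i] exhaust_2[of j]
    by (elim disjE) (simp_all add: inv2_nth divide_inverse smooth_on_mult smooth_on_minus Ds assms(1))
  fix b v :: "real^2" assume "b \<in> Basis"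
  have "(inv2 (Dp y) *v v) \<bullet> b = (inv2 (Dp y) $ 1 $ 1 * v $ 1 + inv2 (Dp y) $ 1 $ 2 * v $ 2) * b $ 1 +
      (inv2 (Dp y) $ 2 $ 1 * v $ 1 + inv2 (Dp y) $ 2 $ 2 * v $ 2) * b $ 2" for y
    by (simp add: inner_vec_def matrix_vector_mult_def sum_2)
  then show "smooth_on W' (\<lambda>y. (inv2 (Dp y) *v v) \<bullet> b)"
    by (simp add: smooth_on_add smooth_on_mult i assms(1))
qed

lemma transfer:
  assumes F: "F \<in> borel_measurable borel" "set_integrable lborel V F"
  shows "set_integrable lborel W (\<lambda>y. F (p y))"
    "(LINT y|lborel. indicator W y * \<bar>F (p y)\<bar>) \<le> C * (LINT x|lborel. indicator V x * \<bar>F x\<bar>)"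
proof -
  \<comment> \<open>Dividing by the Jacobian beforehand makes it cancel in the change of variables,
    which leaves the plain composition with \<open>p\<close>.\<close>
  define w where "w x = indicator V x *\<^sub>R (1 / \<bar>det (Dp (g x))\<bar>)" for x
  have gc: "continuous_on V (\<lambda>x. Dp (g x) $ i $ j)" for i j
    by (rule continuous_on_compose2[OF smooth_on_continuous[OF Dp_smooth] g_cont]) (use g in auto)
  have wc: "continuous_on V (\<lambda>x. 1 / \<bar>det (Dp (g x))\<bar>)"
    using det g unfolding det_2 by (intro continuous_intros gc) auto
  have wm: "w \<in> borel_measurable borel"
    unfolding w_def[abs_def] using borel_measurable_continuous_on_indicator[OF _ wc] V by simp
  have w0: "0 \<le> w x" "w x \<le> C" for x using C(1)[OF g(1), of x] C(3) by (auto simp: w_def indicator_def)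
  have wF: "(\<lambda>x. w x * F x) \<in> borel_measurable borel" using wm F(1) by simp
  have iF: "integrable lborel (\<lambda>x. indicator V x * \<bar>F x\<bar>)"
    using integrable_abs[OF F(2)[unfolded set_integrable_def]] by (simp add: abs_mult)
  have si: "set_integrable lborel (p ` W) (\<lambda>x. w x * F x)"
    unfolding set_integrable_def images
  proof (rule Bochner_Integration.integrable_bound)
    show "integrable lborel (\<lambda>x. C * (indicator V x * \<bar>F x\<bar>))" using iF by simp
    show "AE x in lborel. norm (indicator V x *\<^sub>R (w x * F x)) \<le> norm (C * (indicator V x * \<bar>F x\<bar>))"
      using w0 C(3) by (intro AE_I2) (auto simp: abs_mult indicator_def intro!: mult_right_mono)
    show "(\<lambda>x. indicator V x *\<^sub>R (w x * F x)) \<in> borel_measurable lborel" using wF V by simp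
  qed
  have dc: "continuous_on W (\<lambda>y. det (Dp y))"
    unfolding det_2 by (intro continuous_intros smooth_on_continuous[OF Dp_smooth])
  have inj: "inj_on p W" by (rule inj_on_inverseI[of _ g]) (rule p(2))
  note cv = change_of_variables[OF W(1) p_der dc inj]
  have eq: "\<bar>det (Dp y)\<bar> * (w (p y) * f) = f" if "y \<in> W" for y f
    using that p det by (simp add: w_def)
  have "set_integrable lborel W (\<lambda>y. \<bar>det (Dp y)\<bar> * (w (p y) * F (p y)))"
    by (rule cv(1)[OF _ _ wF si]) (auto simp: images V)
  also have "?this \<longleftrightarrow> set_integrable lborel W (\<lambda>y. F (p y))"
    by (rule set_integrable_cong) (simp_all only: eq)
  finally show "set_integrable lborel W (\<lambda>y. F (p y))" .
  have si': "set_integrable lborel (p ` W) (\<lambda>x. w x * \<bar>F x\<bar>)"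
    using set_integrable_abs[OF si] w0 by (simp add: abs_mult)
  have wF': "(\<lambda>x. w x * \<bar>F x\<bar>) \<in> borel_measurable borel" using wm F(1) by simp
  have "(LINT y|lborel. indicator W y * \<bar>F (p y)\<bar>) = (LINT y:W|lborel. \<bar>det (Dp y)\<bar> * (w (p y) * \<bar>F (p y)\<bar>))"
    unfolding set_lebesgue_integral_def
    using eq by (intro Bochner_Integration.integral_cong refl) (metis indicator_simps(2) mult_zero_left real_scaleR_def)
  also have "\<dots> = (LINT x:V|lborel. w x * \<bar>F x\<bar>)"
    using cv(2)[OF _ _ wF' si'] by (simp add: images V)
  also have "\<dots> \<le> (LINT x|lborel. C * (indicator V x * \<bar>F x\<bar>))"
    unfolding set_lebesgue_integral_def
  proof (rule integral_mono)
    show "integrable lborel (\<lambda>x. indicator V x *\<^sub>R (w x * \<bar>F x\<bar>))"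
      using si' by (simp add: set_integrable_def images)
    show "indicator V x *\<^sub>R (w x * \<bar>F x\<bar>) \<le> C * (indicator V x * \<bar>F x\<bar>)" for x
      using w0 by (auto simp: indicator_def intro!: mult_right_mono)
  qed (use iF in simp)
  finally show "(LINT y|lborel. indicator W y * \<bar>F (p y)\<bar>) \<le> C * (LINT x|lborel. indicator V x * \<bar>F x\<bar>)"
    by simp
qed

text \<open>Differentiable maps between spaces of equal dimension send null sets to null sets;
  \<open>p\<close> carries the exceptional set from \<open>W\<close> to \<open>V\<close>.\<close>

lemma AE_transfer:
  assumes "AE y in lborel. y \<in> W' \<longrightarrow> Q y" "W' \<subseteq> W"
  shows "AE x in lborel. x \<in> V \<inter> g -` W' \<longrightarrow> Q (g x)"
proof -
  obtain Z where Z: "\<And>y. y \<in> space lborel - Z \<Longrightarrow> y \<in> W' \<longrightarrow> Q y" "Z \<in> null_sets lborel"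
    using AE_E3[OF assms(1)] by blast
  have "negligible Z" using Z(2) negligible_iff_null_sets null_sets_completionI by blast
  then have n: "negligible (Z \<inter> W)" by (rule negligible_subset) auto
  have "p differentiable_on (Z \<inter> W)"
    unfolding differentiable_on_def using p_der has_derivative_at_withinI differentiableI by blast
  then have "negligible (p ` (Z \<inter> W))"
    by (intro negligible_differentiable_image_negligible[OF _ n]) simp_all
  then have "AE x in lebesgue. x \<notin> p ` (Z \<inter> W)"
    using negligible_iff_null_sets AE_not_in by blast
  then have "AE x in lborel. x \<notin> p ` (Z \<inter> W)" by (simp add: AE_completion_iff)
  then show ?thesis
  proof eventually_elim
    case (elim x)
    show ?case
    proof
      assume x: "x \<in> V \<inter> g -` W'"
      then have "x = p (g x)" "g x \<in> W" using g by auto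
      with elim have "g x \<notin> Z" by blast
      then show "Q (g x)" using Z(1)[of "g x"] x by simp
    qed
  qed
qed

text \<open>In \<open>W\<close>, Weyl's lemma equates the function with its own mollification of a
  fixed radius, which is smooth; the composition with \<open>g\<close> stays smooth, and the
  exceptional set stays null.\<close>

lemma harmonic_regularity:
  assumes x0: "x0 \<in> V" and u: "u \<in> borel_measurable borel" "set_integrable lborel V u"
    and h: "weakly_harmonic W (\<lambda>y. indicator W y * u (p y))"
  shows "\<exists>N w. open N \<and> x0 \<in> N \<and> smooth_on N w \<and> (AE x in lborel. x \<in> N \<longrightarrow> u x = w x)"
proof -
  let ?f = "\<lambda>y. indicator W y * u (p y)"
  have f: "integrable lborel ?f" using transfer(1)[OF u] by (simp add: set_integrable_def)
  have "g x0 \<in> W" by (rule g(1)[OF x0])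
  then obtain e where e: "e > 0" "cball (g x0) e \<subseteq> W" using W(1) open_contains_cball by blast
  let ?G = "conv ?f (moll (e / 2))" and ?W' = "ball (g x0) (e / 2)"
  have e2: "e / 2 > 0" using e by simp
  have sub: "?W' \<subseteq> W" using e by (auto simp: subset_iff)
  have G: "smooth_on ?W' ?G"
    using smooth_on_subset[OF conv_smooth[OF f test_function_moll[OF e2]]] by simp
  have "AE y in lborel. y \<in> ?W' \<longrightarrow> u (p y) = ?G y"
    using weyl_lemma[OF f W h]
  proof eventually_elim
    case (elim y)
    show ?case
    proof
      assume y: "y \<in> ?W'"
      have "cball y (e / 2) \<subseteq> W"
      proof
        fix z assume "z \<in> cball y (e / 2)"
        then have "z \<in> cball (g x0) e" using y dist_triangle[of "g x0" z y] by simp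
        then show "z \<in> W" using e by blast
      qed
      then have "?f y = ?G y" using elim e2 by blast
      moreover have "y \<in> W" using y sub by blast
      ultimately show "u (p y) = ?G y" by simp
    qed
  qed
  from AE_transfer[OF this sub]
  have "AE x in lborel. x \<in> V \<inter> g -` ?W' \<longrightarrow> u x = ?G (g x)"
    by eventually_elim (use g in auto)
  moreover have "open (V \<inter> g -` ?W')" by (rule continuous_open_preimage[OF g_cont V open_ball])
  moreover have "x0 \<in> V \<inter> g -` ?W'" using x0 e by simp
  moreover have "smooth_on (V \<inter> g -` ?W') (\<lambda>x. ?G (g x))" by (rule smooth_compose[OF open_ball sub G])
  ultimately show ?thesis by blast
qed

end

lemma continuous_compact_bound:
  fixes f :: "'a::euclidean_space \<Rightarrow> real"
  assumes "continuous_on K f" "compact K"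
  shows "\<exists>B\<ge>0. \<forall>x\<in>K. \<bar>f x\<bar> \<le> B"
proof -
  have "bounded (f ` K)" using compact_imp_bounded[OF compact_continuous_image[OF assms]] .
  then obtain B where "\<forall>x\<in>K. \<bar>f x\<bar> \<le> B" by (auto simp: bounded_iff)
  then show ?thesis by (intro exI[of _ "max B 0"]) (auto intro: order_trans)
qed

lemma (in monge_ampere) chart_exists:
  assumes "x0 \<in> S"
  shows "\<exists>V W g p Dp C e. chart V W g p Dp C \<and> x0 \<in> V \<and> e > 0 \<and> (\<forall>x\<in>V. cball x e \<subseteq> S) \<and>
    (AE x in lborel. x \<in> V \<longrightarrow> \<phi> x = g x - x)"
proof -
  obtain e0 where e0: "e0 > 0" "cball x0 e0 \<subseteq> S" using S(1) assms open_contains_cball by blast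
  define R where "R = e0 / 2"
  interpret A: monge_ampere_at S \<phi> H x0 R
    by unfold_locales (use e0 in \<open>auto simp: R_def\<close>)
  obtain d y0 p where lim: "\<And>k. 0 < d k" "\<And>k. d k \<le> R" "d \<longlonglongrightarrow> 0"
    "AE x in lborel. x \<in> S \<longrightarrow> (\<lambda>k. P (d k) x) \<longlonglongrightarrow> x + \<phi> x"
    "AE x in lborel. x \<in> S \<longrightarrow> (\<lambda>k. M (d k) x) \<longlonglongrightarrow> H x"
    "(\<lambda>k. P (d k) x0) \<longlonglongrightarrow> y0" "\<And>k. cball y0 (R / 8) \<subseteq> ball (P (d k) x0) (R / 2)"
    "continuous_on (cball y0 (R / 8)) p"
    "uniform_limit (cball y0 (R / 8)) (\<lambda>k. A.psi (d k)) p sequentially"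
    by (rule A.limit_map) blast
  interpret L: monge_ampere_limit S \<phi> H x0 R d y0 p
    by unfold_locales (fact lim)+
  obtain V W g where loc: "open V" "open W" "x0 \<in> V" "V \<subseteq> S" "W \<subseteq> L.B2"
     "g ` V \<subseteq> W" "p ` W \<subseteq> V" "\<And>x. x \<in> V \<Longrightarrow> p (g x) = x" "\<And>y. y \<in> W \<Longrightarrow> g (p y) = y"
     "\<And>y. y \<in> W \<Longrightarrow> det (L.Dm y) \<noteq> 0"
     "\<And>x. x \<in> V \<Longrightarrow> (g has_derivative (\<lambda>v. inv2 (L.Dm (g x)) *v v)) (at x)"
     "AE x in lborel. x \<in> V \<longrightarrow> \<phi> x = g x - x"
    using L.local_inverse by auto
  obtain r0 where r0: "r0 > 0" "cball x0 r0 \<subseteq> V" using loc(1,3) open_contains_cball by blast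
  \<comment> \<open>The closed ball of radius \<open>r\<close> is compact in \<open>V\<close>, which
    gives the bound \<open>C\<close>; closed balls of radius \<open>r\<close> around points of
    \<open>V'\<close> stay in \<open>cball x0 r0\<close>, so \<open>e\<close> can be taken as
    \<open>r\<close>.\<close>
  define r where "r = r0 / 2"
  have r: "r > 0" "cball x0 r \<subseteq> V" using r0 by (auto simp: r_def)
  define V' where "V' = ball x0 r"
  define W' where "W' = W \<inter> p -` V'"
  have pd: "(p has_derivative (\<lambda>v. L.Dm y *v v)) (at y)" if "y \<in> W" for y
    using L.p_derivative[of y] L.Dm[of y] that loc(5) by (metis (no_types, lifting) ext subsetD)
  have pc: "continuous_on W p"
    using has_derivative_continuous[OF pd] by (simp add: continuous_at_imp_continuous_on)
  have gc: "continuous_on V g"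
    using has_derivative_continuous[OF loc(11)] by (simp add: continuous_at_imp_continuous_on)
  have Dc: "continuous_on V (\<lambda>x. L.Dm (g x) $ i $ j)" for i j
    by (rule continuous_on_compose2[OF smooth_on_continuous[OF L.Dm_smooth] gc]) (use loc in auto)
  have dc: "continuous_on V (\<lambda>x. 1 / \<bar>det (L.Dm (g x))\<bar>)"
  proof -
    have "det (L.Dm (g x)) \<noteq> 0" if "x \<in> V" for x using loc(6,10) that by blast
    then show ?thesis unfolding det_2 by (intro continuous_intros Dc) auto
  qed
  have ck: "compact (cball x0 r)" by simp
  obtain B where B: "B \<ge> 0" "\<And>x. x \<in> cball x0 r \<Longrightarrow> \<bar>1 / \<bar>det (L.Dm (g x))\<bar>\<bar> \<le> B"
    using continuous_compact_bound[OF continuous_on_subset[OF dc r(2)] ck] by blast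
  obtain E where E: "\<And>i j. E i j \<ge> 0" "\<And>i j x. x \<in> cball x0 r \<Longrightarrow> \<bar>L.Dm (g x) $ i $ j\<bar> \<le> E i j"
    using continuous_compact_bound[OF continuous_on_subset[OF Dc r(2)] ck] by metis
  define C where "C = B + (\<Sum>i\<in>UNIV. \<Sum>j\<in>UNIV. E i j)"
  have Eij: "E i j \<le> (\<Sum>i\<in>UNIV. \<Sum>j\<in>UNIV. E i j)" for i j
    using member_le_sum[of j UNIV "E i"] member_le_sum[of i UNIV "\<lambda>i. \<Sum>j\<in>UNIV. E i j"] E(1)
    by (auto simp: sum_nonneg intro: order_trans)
  have sE: "0 \<le> (\<Sum>i\<in>UNIV. \<Sum>j\<in>UNIV. E i j)" using E(1) by (intro sum_nonneg)
  have W'p: "p y \<in> cball x0 r" "g (p y) = y" "y \<in> W" if "y \<in> W'" for y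
    using that loc(9) by (auto simp: W'_def V'_def)
  have V'V: "V' \<subseteq> V" using r(2) by (auto simp: V'_def)
  have "chart V' W' g p L.Dm C"
  proof
    show "open V'" by (simp add: V'_def)
    show "open W'" unfolding W'_def by (rule continuous_open_preimage[OF pc loc(2)]) (simp add: V'_def)
    show "bounded W'"
      by (rule bounded_subset[OF bounded_ball[of y0 "R / 16"]]) (use loc(5) in \<open>auto simp: W'_def\<close>)
    show "g x \<in> W'" "p (g x) = x" if "x \<in> V'" for x
      using that V'V loc(6,8) by (auto simp: W'_def)
    show "p y \<in> V'" "g (p y) = y" if "y \<in> W'" for y using that loc(9) by (auto simp: W'_def)
    show "smooth_on W' (\<lambda>y. L.Dm y $ i $ j)" for i j
      by (rule smooth_on_subset[OF L.Dm_smooth]) (use loc(5) in \<open>auto simp: W'_def\<close>)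
    show "(p has_derivative (\<lambda>v. L.Dm y *v v)) (at y)" if "y \<in> W'" for y using pd W'p(3) that by blast
    show "det (L.Dm y) \<noteq> 0" if "y \<in> W'" for y using loc(10) W'p(3) that by blast
    show "(g has_derivative (\<lambda>v. inv2 (L.Dm (g x)) *v v)) (at x)" if "x \<in> V'" for x using loc(11) V'V that by blast
    show "1 / \<bar>det (L.Dm y)\<bar> \<le> C" if "y \<in> W'" for y
      using B(2)[OF W'p(1)[OF that]] W'p(2)[OF that] sE by (simp add: C_def)
    show "\<bar>L.Dm y $ i $ j\<bar> \<le> C" if "y \<in> W'" for y i j
      using E(2)[OF W'p(1)[OF that], of i j] W'p(2)[OF that] Eij[of i j] B(1) by (simp add: C_def)
    show "C \<ge> 0" using B(1) sE by (simp add: C_def)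
  qed
  moreover have "x0 \<in> V'" using r by (simp add: V'_def)
  moreover have "\<forall>x\<in>V'. cball x r \<subseteq> S"
  proof (intro ballI subsetI)
    fix x z assume "x \<in> V'" "z \<in> cball x r"
    then have "z \<in> cball x0 r0" using dist_triangle[of x0 z x] by (simp add: V'_def r_def)
    then show "z \<in> S" using r0(2) loc(4) by blast
  qed
  moreover have "AE x in lborel. x \<in> V' \<longrightarrow> \<phi> x = g x - x"
    using loc(12) by eventually_elim (use V'V in blast)
  ultimately show ?thesis using r(1) by blast
qed

section \<open>The Cauchy--Riemann system\<close>

text \<open>Measurability and integrability are bundled with the convergence because all three have
  to survive sums, bounded factors and charts together.\<close>

definition L1_null :: "'a::euclidean_space set \<Rightarrow> (nat \<Rightarrow> 'a \<Rightarrow> real) \<Rightarrow> bool" where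
  "L1_null V F \<longleftrightarrow> (\<forall>k. F k \<in> borel_measurable borel \<and> set_integrable lborel V (F k)) \<and>
     (\<lambda>k. LINT x|lborel. indicator V x * \<bar>F k x\<bar>) \<longlonglongrightarrow> 0"

lemma L1_null_bound:
  assumes F: "L1_null V F" and V: "V \<in> sets borel" and G: "\<And>k. G k \<in> borel_measurable borel"
    and le: "\<And>k. AE x in lborel. x \<in> V \<longrightarrow> \<bar>G k x\<bar> \<le> B * \<bar>F k x\<bar>"
  shows "L1_null V G"
proof -
  have iF: "integrable lborel (\<lambda>x. indicator V x * \<bar>F k x\<bar>)" for k
    using F integrable_abs[of lborel "\<lambda>x. indicator V x * F k x"] by (auto simp: L1_null_def set_integrable_def abs_mult)
  have Gm: "(\<lambda>x. indicator V x * G k x) \<in> borel_measurable lborel" for k using G V by simp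
  have le': "AE x in lborel. \<bar>indicator V x * G k x\<bar> \<le> B * (indicator V x * \<bar>F k x\<bar>)" for k
    using le[of k] by eventually_elim (auto simp: indicator_def)
  have iG: "integrable lborel (\<lambda>x. indicator V x * G k x)" for k
  proof (rule Bochner_Integration.integrable_bound)
    show "integrable lborel (\<lambda>x. B * (indicator V x * \<bar>F k x\<bar>))" using iF by simp
    show "AE x in lborel. norm (indicator V x * G k x) \<le> norm (B * (indicator V x * \<bar>F k x\<bar>))"
      using le'[of k] by eventually_elim simp
  qed (rule Gm)
  have "(\<lambda>k. LINT x|lborel. indicator V x * \<bar>G k x\<bar>) \<longlonglongrightarrow> 0"
  proof (rule tendsto_sandwich[OF _ _ tendsto_const])
    show "\<forall>\<^sub>F k in sequentially. 0 \<le> (LINT x|lborel. indicator V x * \<bar>G k x\<bar>)"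
      by (auto intro!: always_eventually integral_nonneg_AE)
    have "(LINT x|lborel. indicator V x * \<bar>G k x\<bar>) \<le> (LINT x|lborel. B * (indicator V x * \<bar>F k x\<bar>))" for k
    proof (rule integral_mono_AE)
      show "integrable lborel (\<lambda>x. indicator V x * \<bar>G k x\<bar>)"
        using integrable_abs[OF iG] by (simp add: abs_mult)
      show "AE x in lborel. indicator V x * \<bar>G k x\<bar> \<le> B * (indicator V x * \<bar>F k x\<bar>)"
        using le'[of k] by eventually_elim (simp add: abs_mult)
    qed (use iF in simp)
    then show "\<forall>\<^sub>F k in sequentially. (LINT x|lborel. indicator V x * \<bar>G k x\<bar>) \<le>
        B * (LINT x|lborel. indicator V x * \<bar>F k x\<bar>)" by simp
    show "(\<lambda>k. B * (LINT x|lborel. indicator V x * \<bar>F k x\<bar>)) \<longlonglongrightarrow> 0"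
      using F tendsto_mult_right_zero unfolding L1_null_def by blast
  qed
  with iG G show ?thesis by (simp add: L1_null_def set_integrable_def)
qed

lemma L1_null_add:
  assumes F: "L1_null V F" and G: "L1_null V G" and V: "V \<in> sets borel"
  shows "L1_null V (\<lambda>k x. F k x + G k x)"
proof -
  have m [measurable]: "F k \<in> borel_measurable borel" "G k \<in> borel_measurable borel" for k
    using F G by (simp_all add: L1_null_def)
  have F': "L1_null V (\<lambda>k x. \<bar>F k x\<bar>)"
    by (rule L1_null_bound[OF F V, where B = 1]) simp_all
  have G': "L1_null V (\<lambda>k x. \<bar>G k x\<bar>)"
    by (rule L1_null_bound[OF G V, where B = 1]) simp_all
  have i: "integrable lborel (\<lambda>x. indicator V x * \<bar>F k x\<bar>)" "integrable lborel (\<lambda>x. indicator V x * \<bar>G k x\<bar>)" for k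
    using F' G' by (auto simp: L1_null_def set_integrable_def)
  have eq: "indicator V x * \<bar>\<bar>F k x\<bar> + \<bar>G k x\<bar>\<bar> = indicator V x * \<bar>F k x\<bar> + indicator V x * \<bar>G k x\<bar>" for k x
    by (simp add: distrib_left)
  have "L1_null V (\<lambda>k x. \<bar>F k x\<bar> + \<bar>G k x\<bar>)"
    unfolding L1_null_def
  proof (intro conjI allI)
    show "(\<lambda>x. \<bar>F k x\<bar> + \<bar>G k x\<bar>) \<in> borel_measurable borel" for k using F G by (simp add: L1_null_def)
    show "set_integrable lborel V (\<lambda>x. \<bar>F k x\<bar> + \<bar>G k x\<bar>)" for k
      using Bochner_Integration.integrable_add[OF i] by (simp add: set_integrable_def distrib_left)
    show "(\<lambda>k. LINT x|lborel. indicator V x * \<bar>\<bar>F k x\<bar> + \<bar>G k x\<bar>\<bar>) \<longlonglongrightarrow> 0"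
      unfolding eq Bochner_Integration.integral_add[OF i]
      using tendsto_add[of "\<lambda>k. LINT x|lborel. indicator V x * \<bar>F k x\<bar>" 0 _ "\<lambda>k. LINT x|lborel. indicator V x * \<bar>G k x\<bar>" 0] F G
      by (simp add: L1_null_def)
  qed
  then show ?thesis
    by (rule L1_null_bound[OF _ V, where B = 1]) (simp_all add: abs_triangle_ineq)
qed

lemma L1_null_conv:
  fixes f :: "'a::euclidean_space \<Rightarrow> real"
  assumes f: "integrable lborel f" and V: "bounded V" "V \<in> sets borel" and d: "\<And>k. d k > 0" "d \<longlonglongrightarrow> 0"
  shows "L1_null V (\<lambda>k x. conv f (moll (d k)) x - f x)"
  unfolding L1_null_def
proof (intro conjI allI)
  have i: "integrable lborel (\<lambda>x. conv f (moll (d k)) x - f x)" for k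
    using conv_moll_norm(1)[OF f d(1)] f by (rule Bochner_Integration.integrable_diff)
  then show "(\<lambda>x. conv f (moll (d k)) x - f x) \<in> borel_measurable borel" for k
    using borel_measurable_integrable by fastforce
  show "set_integrable lborel V (\<lambda>x. conv f (moll (d k)) x - f x)" for k
    using integrable_real_mult_indicator[OF _ i, of V] V(2) by (simp add: set_integrable_def mult.commute)
  show "(\<lambda>k. LINT x|lborel. indicator V x * \<bar>conv f (moll (d k)) x - f x\<bar>) \<longlonglongrightarrow> 0"
    using conv_moll_tendsto_L1[OF f V d] by simp
qed

lemma (in chart) L1_null_transfer:
  assumes F: "L1_null V F" and G: "\<And>k y. y \<in> W \<Longrightarrow> G k y = F k (p y)"
  shows "set_integrable lborel W (G k)" "(\<lambda>k. LINT y|lborel. indicator W y * \<bar>G k y\<bar>) \<longlonglongrightarrow> 0"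
proof -
  have Fk: "F k \<in> borel_measurable borel" "set_integrable lborel V (F k)" for k using F by (auto simp: L1_null_def)
  have eq: "indicator W y *\<^sub>R G k y = indicator W y *\<^sub>R F k (p y)" "indicator W y * \<bar>G k y\<bar> = indicator W y * \<bar>F k (p y)\<bar>" for y k
    using G[of y k] by (auto simp: indicator_def)
  show "set_integrable lborel W (G k)"
    using transfer(1)[OF Fk] unfolding set_integrable_def eq(1) .
  show "(\<lambda>k. LINT y|lborel. indicator W y * \<bar>G k y\<bar>) \<longlonglongrightarrow> 0"
    unfolding eq(2)
  proof (rule tendsto_sandwich[OF _ _ tendsto_const])
    show "\<forall>\<^sub>F k in sequentially. 0 \<le> (LINT y|lborel. indicator W y * \<bar>F k (p y)\<bar>)"
      by (auto intro!: always_eventually integral_nonneg_AE)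
    show "\<forall>\<^sub>F k in sequentially. (LINT y|lborel. indicator W y * \<bar>F k (p y)\<bar>) \<le> C * (LINT x|lborel. indicator V x * \<bar>F k x\<bar>)"
      using transfer(2)[OF Fk] by simp
    show "(\<lambda>k. C * (LINT x|lborel. indicator V x * \<bar>F k x\<bar>)) \<longlonglongrightarrow> 0"
      using F tendsto_mult_right_zero unfolding L1_null_def by blast
  qed
qed

section \<open>Gluing local smooth representatives\<close>

lemma AE_locally:
  fixes S :: "'a::euclidean_space set"
  assumes "\<And>x. x \<in> S \<Longrightarrow> \<exists>N. open N \<and> x \<in> N \<and> (AE z in lebesgue. z \<in> N \<longrightarrow> z \<in> S \<longrightarrow> Q z)"
  shows "AE x in lebesgue. x \<in> S \<longrightarrow> Q x"
proof -
  define E where "E = {x \<in> S. \<not> Q x}"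
  have "negligible E"
  \<comment> \<open>Uncountably many neighbourhoods occur; that a locally negligible set is
    negligible reduces them to countably many.\<close>
  proof (rule locally_negligible_alt[THEN iffD2], rule ballI)
    fix x assume x: "x \<in> E"
    then obtain N where N: "open N" "x \<in> N" "AE z in lebesgue. z \<in> N \<longrightarrow> z \<in> S \<longrightarrow> Q z"
      using assms by (auto simp: E_def)
    obtain Z where Z: "\<And>z. z \<in> space lebesgue - Z \<Longrightarrow> z \<in> N \<longrightarrow> z \<in> S \<longrightarrow> Q z" "Z \<in> null_sets lebesgue"
      using AE_E3[OF N(3)] by blast
    have "negligible (E \<inter> N)"
    proof (rule negligible_subset)
      show "negligible Z" using Z(2) negligible_iff_null_sets by blast
      show "E \<inter> N \<subseteq> Z" using Z(1) by (auto simp: E_def)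
    qed
    moreover have "openin (top_of_set E) (E \<inter> N)" using N(1) by (simp add: openin_open_Int)
    ultimately show "\<exists>U. openin (top_of_set E) U \<and> x \<in> U \<and> negligible U"
      using x N(2) by blast
  qed
  then have "AE x in lebesgue. x \<notin> E" using negligible_iff_null_sets AE_not_in by blast
  then show ?thesis by eventually_elim (auto simp: E_def)
qed

text \<open>Two local representatives agree almost everywhere on their overlap, hence everywhere by
  continuity. So the diagonal choice coincides near each point with a single local
  representative.\<close>

lemma smooth_glue:
  fixes f :: "'a::euclidean_space \<Rightarrow> real"
  assumes S: "open S"
    and loc: "\<And>x. x \<in> S \<Longrightarrow> \<exists>N w. open N \<and> x \<in> N \<and> smooth_on N w \<and> (AE z in lborel. z \<in> N \<longrightarrow> f z = w z)"
  shows "\<exists>w. smooth_on S w \<and> (AE x in lebesgue. x \<in> S \<longrightarrow> f x = w x)"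
proof -
  obtain N w where N: "\<And>x. x \<in> S \<Longrightarrow> open (N x)" "\<And>x. x \<in> S \<Longrightarrow> x \<in> N x" "\<And>x. x \<in> S \<Longrightarrow> smooth_on (N x) (w x)"
    "\<And>x. x \<in> S \<Longrightarrow> AE z in lborel. z \<in> N x \<longrightarrow> f z = w x z"
    using loc by metis
  have eq: "w y y = w x y" if x: "x \<in> S" and y: "y \<in> S" "y \<in> N x" for x y
  proof (rule AE_eq_continuous[of "N x \<inter> N y" "w y" "w x"])
    show "open (N x \<inter> N y)" using N(1) x y by blast
    show "continuous_on (N x \<inter> N y) (w y)" "continuous_on (N x \<inter> N y) (w x)"
      using smooth_on_continuous[OF N(3)] x y by (auto intro: continuous_on_subset)
    show "AE z in lborel. z \<in> N x \<inter> N y \<longrightarrow> w y z = w x z"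
      using N(4)[OF x] N(4)[OF y(1)] by eventually_elim auto
    show "y \<in> N x \<inter> N y" using N(2) y by blast
  qed
  have "smooth_on S (\<lambda>x. w x x)"
  proof (rule smooth_on_local[OF S])
    fix x assume x: "x \<in> S"
    have op: "open (S \<inter> N x)" using S N(1)[OF x] by blast
    have "smooth_on (S \<inter> N x) (w x)" by (rule smooth_on_subset[OF N(3)[OF x]]) auto
    then have "smooth_on (S \<inter> N x) (\<lambda>x. w x x)"
      by (subst smooth_on_cong[OF op, of _ "w x"]) (use eq[OF x] in auto)
    with op x N(2)[OF x] show "\<exists>T. open T \<and> x \<in> T \<and> smooth_on T (\<lambda>x. w x x)" by blast
  qed
  moreover have "AE x in lebesgue. x \<in> S \<longrightarrow> f x = w x x"
  proof (rule AE_locally)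
    fix x assume x: "x \<in> S"
    have "AE z in lebesgue. z \<in> N x \<longrightarrow> f z = w x z" using N(4)[OF x] by (simp add: AE_completion_iff)
    then have "AE z in lebesgue. z \<in> N x \<longrightarrow> z \<in> S \<longrightarrow> f z = w z z"
      by eventually_elim (use eq[OF x] in auto)
    then show "\<exists>N. open N \<and> x \<in> N \<and> (AE z in lebesgue. z \<in> N \<longrightarrow> z \<in> S \<longrightarrow> f z = w z z)"
      using N(1,2)[OF x] by blast
  qed
  ultimately show ?thesis by blast
qed

text \<open>In matrix form, with \<open>P\<close> symmetric of trace 1 and
  \<open>h = P^(-1) - I\<close>: the gradient of \<open>v\<close> is that of \<open>u\<close> times
  \<open>J h\<close>, and \<open>J h P = J (I - P) = P J\<close>, because \<open>I - P\<close> is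
  the adjugate \<open>- J P J\<close>. Thus the gradients in the chart differ by \<open>J\<close>
  alone. The calculation clears the denominator \<open>D\<close> and inserts the trace.\<close>

lemma cauchy_riemann_algebra:
  fixes P11 P12 P22 D :: real
  assumes D: "D = P11 * P22 - P12 * P12" "D \<noteq> 0" and t: "P11 + P22 = 1"
    and h: "h11 = P22 / D - 1" "h12 = - P12 / D" "h22 = P11 / D - 1"
  shows "u1 * P11 + u2 * P12 - (h12 * u1 - h11 * u2) * P12 - (h22 * u1 - h12 * u2) * P22 = 0"
    "u1 * P12 + u2 * P22 + (h12 * u1 - h11 * u2) * P11 + (h22 * u1 - h12 * u2) * P12 = 0"
proof -
  have r: "h11 * D = P22 - D" "h12 * D = - P12" "h22 * D = P11 - D" using D(2) h by (simp_all add: field_simps)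
  have P22: "P22 = 1 - P11" using t by simp
  have "D * (u1 * P11 + u2 * P12 - (h12 * u1 - h11 * u2) * P12 - (h22 * u1 - h12 * u2) * P22) =
      u1 * (D * P11 - (h12 * D) * P12 - (h22 * D) * P22) + u2 * (D * P12 + (h11 * D) * P12 + (h12 * D) * P22)"
    by (simp add: algebra_simps)
  also have "\<dots> = u1 * (D * P11 - (- P12) * P12 - (P11 - D) * P22) + u2 * (D * P12 + (P22 - D) * P12 + (- P12) * P22)"
    by (simp only: r)
  also have "\<dots> = 0" unfolding D(1) P22 by (simp add: algebra_simps)
  finally show "u1 * P11 + u2 * P12 - (h12 * u1 - h11 * u2) * P12 - (h22 * u1 - h12 * u2) * P22 = 0"
    using D(2) by simp
  have "D * (u1 * P12 + u2 * P22 + (h12 * u1 - h11 * u2) * P11 + (h22 * u1 - h12 * u2) * P12) =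
      u1 * (D * P12 + (h12 * D) * P11 + (h22 * D) * P12) + u2 * (D * P22 - (h11 * D) * P11 - (h12 * D) * P12)"
    by (simp add: algebra_simps)
  also have "\<dots> = u1 * (D * P12 + (- P12) * P11 + (P11 - D) * P12) + u2 * (D * P22 - (P22 - D) * P11 - (- P12) * P12)"
    by (simp only: r)
  also have "\<dots> = 0" unfolding D(1) P22 by (simp add: algebra_simps)
  finally show "u1 * P12 + u2 * P22 + (h12 * u1 - h11 * u2) * P11 + (h22 * u1 - h12 * u2) * P12 = 0"
    using D(2) by simp
qed

section \<open>Regularity of the Monge--Ampere map and of its conjugate pairs\<close>

context monge_ampere
begin

text \<open>On \<open>V\<close> the weakly differentiable \<open>\<phi>\<close> equals the
  classically differentiable \<open>g - id\<close> almost everywhere; both Jacobians have the same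
  integrals against test functions.\<close>

lemma chart_inverse_derivative:
  assumes "chart V W g p Dp C" "V \<subseteq> S" and ae: "AE x in lborel. x \<in> V \<longrightarrow> \<phi> x = g x - x"
  shows "AE x in lborel. x \<in> V \<longrightarrow> H x = inv2 (Dp (g x)) - mat 1"
proof -
  interpret chart V W g p Dp C by fact
  define A where "A x = inv2 (Dp (g x))" for x
  have Dc: "continuous_on V (\<lambda>x. Dp (g x) $ i $ j)" for i j
    by (rule continuous_on_compose2[OF smooth_on_continuous[OF Dp_smooth] g_cont]) (use g in auto)
  have nz: "det (Dp (g x)) \<noteq> 0" if "x \<in> V" for x using det g that by blast
  have dc: "continuous_on V (\<lambda>x. det (Dp (g x)))" unfolding det_2 by (intro continuous_intros Dc)
  have Ac: "continuous_on V (\<lambda>x. A x $ i $ j)" for i j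
    using exhaust_2[of i] exhaust_2[of j] unfolding A_def
    by (elim disjE) (simp_all add: inv2_nth nz continuous_on_divide[OF Dc dc]
        continuous_on_minus[OF continuous_on_divide[OF Dc dc]])
  have Ab: "\<bar>A x $ i $ j\<bar> \<le> C * C" if "x \<in> V" for x i j
  proof -
    have "\<bar>Dp (g x) $ i' $ j'\<bar> * (1 / \<bar>det (Dp (g x))\<bar>) \<le> C * C" for i' j'
      using C g(1)[OF that] by (intro mult_mono) auto
    then show ?thesis using exhaust_2[of i] exhaust_2[of j]
      by (elim disjE) (simp_all add: A_def inv2_nth)
  qed
  have Vb: "V \<in> sets borel" using V by simp
  have Vbd: "bounded V" using S(2) assms(2) bounded_subset by blast
  have iV: "integrable lborel (indicator V :: real^2 \<Rightarrow> real)"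
    using emeasure_bounded_finite[OF Vbd] Vb by (intro integrable_real_indicator) auto
  have entry: "AE x in lborel. x \<in> V \<longrightarrow> indicator V x * (H x $ i $ j - (A x - mat 1) $ i $ j) = 0" for i j
  proof (rule AE_zero_weak[OF _ V Vbd])
    let ?q = "\<lambda>x. (A x - mat 1) $ i $ j"
    have qc: "continuous_on V ?q" by (simp, intro continuous_on_diff Ac continuous_on_const)
    have iq: "integrable lborel (\<lambda>x. indicator V x * ?q x)"
    proof (rule Bochner_Integration.integrable_bound)
      show "integrable lborel (\<lambda>x. (C * C + 1) * (indicator V x :: real))" using iV by simp
      show "(\<lambda>x. indicator V x * ?q x) \<in> borel_measurable lborel"
        using borel_measurable_continuous_on_indicator[OF Vb qc] by simp
      show "AE x in lborel. norm (indicator V x * ?q x) \<le> norm ((C * C + 1) * (indicator V x :: real))"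
      proof (rule AE_I2)
        fix x
        have "\<bar>mat 1 $ i $ j\<bar> \<le> (1 :: real)" by (simp add: mat_def)
        then have "\<bar>?q x\<bar> \<le> C * C + 1" if "x \<in> V" using Ab[OF that, of i j] by simp
        then show "norm (indicator V x * ?q x) \<le> norm ((C * C + 1) * (indicator V x :: real))"
          by (auto simp: indicator_def)
      qed
    qed
    have iH: "integrable lborel (\<lambda>x. indicator V x * H x $ i $ j)"
      using integrable_real_mult_indicator[OF _ entry_int, of V i j] Vb by (simp add: mult.commute)
    show "integrable lborel (\<lambda>x. indicator V x * (H x $ i $ j - ?q x))"
      using Bochner_Integration.integrable_diff[OF iH iq] by (simp add: right_diff_distrib)
    fix \<zeta> :: "real^2 \<Rightarrow> real" assume \<zeta>: "test_function V \<zeta>"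
    obtain K where K: "compact K" "K \<subseteq> V" "\<And>x. x \<notin> K \<Longrightarrow> \<zeta> x = 0"
      "\<And>x v. x \<notin> K \<Longrightarrow> frechet_derivative \<zeta> (at x) v = 0"
      by (rule test_functionE[OF \<zeta>]) blast
    have off: "\<zeta> x = 0" "frechet_derivative \<zeta> (at x) v = 0" if "x \<notin> V" for x v using K that by blast+
    have gd: "((\<lambda>x. g x $ i - x $ i) has_derivative (\<lambda>v. (A x *v v) $ i - v $ i)) (at x)" if "x \<in> V" for x
      unfolding A_def
      by (intro has_derivative_diff bounded_linear.has_derivative[OF bounded_linear_vec_nth] g_der that has_derivative_ident)
    have e: "(A x *v axis j 1) $ i - axis j 1 $ i = ?q x" for x
      unfolding matrix_vector_mult_basis column_def by (simp add: mat_def axis_def)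
    have cont: "continuous_on V (\<lambda>x. (A x *v axis j 1) $ i - axis j 1 $ i)" unfolding e by (rule qc)
    note ip = integral_by_parts[OF V \<zeta> gd cont, unfolded e]
    have "(LINT x|lborel. \<phi> x $ i * frechet_derivative \<zeta> (at x) (axis j 1)) =
        (LINT x|lborel. (g x $ i - x $ i) * frechet_derivative \<zeta> (at x) (axis j 1))"
    proof (rule integral_cong_AE)
      have "integrable lborel (\<lambda>x. \<phi> x $ i)"
        by (rule integrable_bounded_linear[OF bounded_linear_vec_nth \<phi>_int])
      then show "(\<lambda>x. \<phi> x $ i * frechet_derivative \<zeta> (at x) (axis j 1)) \<in> borel_measurable lborel"
        using test_function_measurable[OF test_function_derivative[OF \<zeta>]] by simp
      show "(\<lambda>x. (g x $ i - x $ i) * frechet_derivative \<zeta> (at x) (axis j 1)) \<in> borel_measurable lborel"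
        using ip(1) by (rule borel_measurable_integrable)
      show "AE x in lborel. \<phi> x $ i * frechet_derivative \<zeta> (at x) (axis j 1) =
          (g x $ i - x $ i) * frechet_derivative \<zeta> (at x) (axis j 1)"
        using ae
      proof eventually_elim
        case (elim x)
        then show ?case using off(2)[of x "axis j 1"] by (cases "x \<in> V") auto
      qed
    qed
    moreover have "(LINT x|lborel. \<phi> x $ i * frechet_derivative \<zeta> (at x) (axis j 1)) = - (LINT x|lborel. H x $ i $ j * \<zeta> x)"
      using weak[of i j] test_function_subset[OF \<zeta> assms(2)] by (simp add: weak_deriv_def)
    ultimately have "(LINT x|lborel. H x $ i $ j * \<zeta> x) = (LINT x|lborel. ?q x * \<zeta> x)"
      using ip(3) by simp
    moreover have iHz: "integrable lborel (\<lambda>x. H x $ i $ j * \<zeta> x)"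
    proof -
      obtain B where B: "\<And>x. \<bar>\<zeta> x\<bar> \<le> B" "B \<ge> 0" by (rule test_function_bounded[OF \<zeta>]) blast
      show ?thesis
      proof (rule Bochner_Integration.integrable_bound)
        show "integrable lborel (\<lambda>x. B * H x $ i $ j)" using entry_int by simp
        show "(\<lambda>x. H x $ i $ j * \<zeta> x) \<in> borel_measurable lborel"
          using borel_measurable_integrable[OF entry_int] test_function_measurable[OF \<zeta>] by simp
        show "AE x in lborel. norm (H x $ i $ j * \<zeta> x) \<le> norm (B * H x $ i $ j)"
          using B by (intro AE_I2) (auto simp: abs_mult mult.commute[of B] intro!: mult_left_mono)
      qed
    qed
    moreover have "indicator V x * (H x $ i $ j - ?q x) * \<zeta> x = H x $ i $ j * \<zeta> x - ?q x * \<zeta> x" for x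
      using off(1)[of x] by (cases "x \<in> V") (simp_all add: left_diff_distrib)
    ultimately show "(LINT x|lborel. indicator V x * (H x $ i $ j - ?q x) * \<zeta> x) = 0"
      using ip(2) by simp
  qed
  have "AE x in lborel. \<forall>i\<in>UNIV. \<forall>j\<in>UNIV. x \<in> V \<longrightarrow> indicator V x * (H x $ i $ j - (A x - mat 1) $ i $ j) = 0"
    by (intro AE_finite_allI finite entry)
  then show ?thesis by eventually_elim (auto simp: vec_eq_iff A_def)
qed

lemma map_regularity:
  assumes "x0 \<in> S"
  shows "\<exists>N w. open N \<and> x0 \<in> N \<and> smooth_on N w \<and> (AE x in lborel. x \<in> N \<longrightarrow> \<phi> x $ i = w x)"
proof -
  obtain V W g p Dp C e where ch: "chart V W g p Dp C" "x0 \<in> V" "AE x in lborel. x \<in> V \<longrightarrow> \<phi> x = g x - x"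
    using chart_exists[OF assms] by blast
  interpret chart V W g p Dp C by fact
  have "smooth_on (V \<inter> g -` W) (\<lambda>x. g x $ i)"
    by (rule smooth_compose[OF W(1) order_refl])
      (rule smooth_on_linear[OF bounded_linear_vec_nth W(1) smooth_on_id[OF W(1)]])
  moreover have "V \<inter> g -` W = V" using g by auto
  ultimately have "smooth_on V (\<lambda>x. g x $ i - x $ i)"
    using smooth_on_diff[OF V _ smooth_on_linear[OF bounded_linear_vec_nth V smooth_on_id[OF V]]] by simp
  moreover have "AE x in lborel. x \<in> V \<longrightarrow> \<phi> x $ i = g x $ i - x $ i"
    using ch(3) by eventually_elim auto
  ultimately show ?thesis using ch(2) V by blast
qed

text \<open>\<open>u\<close> and \<open>v\<close> are mollified before the composition with
  \<open>p\<close>, so that the classical chain rule suffices. Mollification does not commute with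
  the coefficients \<open>h\<close>, but the errors \<open>E1\<close> and \<open>E2\<close> tend to
  0 in L1, which \<open>weakly_harmonic_limit\<close> tolerates.\<close>

lemma cauchy_riemann_regularity:
  fixes u v :: "real^2 \<Rightarrow> real" and X Y :: "2 \<Rightarrow> real^2 \<Rightarrow> real"
  assumes x0: "x0 \<in> S" and int: "integrable lborel u" "integrable lborel v"
      "\<And>j. integrable lborel (X j)" "\<And>j. integrable lborel (Y j)"
    and w: "\<And>j. weak_deriv S u (axis j 1) (X j)" "\<And>j. weak_deriv S v (axis j 1) (Y j)"
    and rel: "AE x in lborel. x \<in> S \<longrightarrow> Y 1 x = H x $ 1 $ 2 * X 1 x - H x $ 1 $ 1 * X 2 x \<and>
      Y 2 x = H x $ 2 $ 2 * X 1 x - H x $ 1 $ 2 * X 2 x"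
  shows "\<exists>N w. open N \<and> x0 \<in> N \<and> smooth_on N w \<and> (AE x in lborel. x \<in> N \<longrightarrow> u x = w x)"
    "\<exists>N w. open N \<and> x0 \<in> N \<and> smooth_on N w \<and> (AE x in lborel. x \<in> N \<longrightarrow> v x = w x)"
proof -
  obtain V W g p Dp C e where ch: "chart V W g p Dp C" "x0 \<in> V" "e > 0" "\<And>x. x \<in> V \<Longrightarrow> cball x e \<subseteq> S"
      "AE x in lborel. x \<in> V \<longrightarrow> \<phi> x = g x - x"
    using chart_exists[OF x0] by blast
  interpret chart V W g p Dp C by fact
  have VS: "V \<subseteq> S"
  proof
    fix x assume "x \<in> V"
    from ch(4)[OF this] ch(3) show "x \<in> S" by (auto simp: subset_iff)
  qed
  note Heq = chart_inverse_derivative[OF ch(1) VS ch(5)]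
  have Vb: "V \<in> sets borel" using V by simp
  have Vbd: "bounded V" using S(2) VS bounded_subset by blast
  define h where "h i j x = (inv2 (Dp (g x)) - mat 1) $ i $ j" for i j x
  have Dc: "continuous_on V (\<lambda>x. Dp (g x) $ i $ j)" for i j
    by (rule continuous_on_compose2[OF smooth_on_continuous[OF Dp_smooth] g_cont]) (use g in auto)
  have nz: "det (Dp (g x)) \<noteq> 0" if "x \<in> V" for x using det g that by blast
  have dc: "continuous_on V (\<lambda>x. det (Dp (g x)))" unfolding det_2 by (intro continuous_intros Dc)
  have h_eq: "h 1 1 x = Dp (g x) $ 2 $ 2 / det (Dp (g x)) - 1" "h 1 2 x = - (Dp (g x) $ 1 $ 2) / det (Dp (g x))"
    "h 2 1 x = - (Dp (g x) $ 2 $ 1) / det (Dp (g x))" "h 2 2 x = Dp (g x) $ 1 $ 1 / det (Dp (g x)) - 1" for x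
    by (simp_all add: h_def inv2_nth mat_def)
  have hc: "continuous_on V (h i j)" for i j
    using exhaust_2[of i] exhaust_2[of j]
    by (elim disjE) (simp_all add: h_eq[abs_def] nz continuous_on_diff continuous_on_divide[OF Dc dc]
        continuous_on_minus[OF continuous_on_divide[OF Dc dc]])
  define B where "B = C * C + 1"
  have hb: "\<bar>h i j x\<bar> \<le> B" if "x \<in> V" for i j x
  proof -
    have *: "\<bar>Dp (g x) $ i' $ j' / det (Dp (g x))\<bar> \<le> C * C" for i' j'
    proof -
      have "\<bar>Dp (g x) $ i' $ j'\<bar> * (1 / \<bar>det (Dp (g x))\<bar>) \<le> C * C"
        using C g(1)[OF that] by (intro mult_mono) auto
      then show ?thesis by simp
    qed
    have "\<bar>h 1 1 x\<bar> \<le> B" "\<bar>h 2 2 x\<bar> \<le> B"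
      using *[of 2 2] *[of 1 1] unfolding h_eq B_def by linarith+
    moreover have "\<bar>h 1 2 x\<bar> \<le> B" "\<bar>h 2 1 x\<bar> \<le> B"
      using *[of 1 2] *[of 2 1] unfolding h_eq B_def minus_divide_left[symmetric] by linarith+
    ultimately show ?thesis using exhaust_2[of i] exhaust_2[of j] by (elim disjE) simp_all
  qed
  have B1: "B \<ge> 1" by (simp add: B_def)
  \<comment> \<open>The algebraic properties of \<open>H\<close> hold almost everywhere only; its
    continuous version \<open>h\<close> has them at every point of \<open>V\<close>.\<close>
  have sym: "h 1 2 x = h 2 1 x" if "x \<in> V" for x
  proof (rule AE_eq_continuous[OF V hc hc _ that])
    show "AE x in lborel. x \<in> V \<longrightarrow> h 1 2 x = h 2 1 x"
      using Heq ma
    proof eventually_elim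
      case (elim x)
      then show ?case using VS by (auto simp: h_def)
    qed
  qed
  have det1: "h 1 1 x * h 2 2 x - h 1 2 x * h 2 1 x = 1" if "x \<in> V" for x
  proof (rule AE_eq_continuous[OF V _ continuous_on_const _ that])
    show "continuous_on V (\<lambda>x. h 1 1 x * h 2 2 x - h 1 2 x * h 2 1 x)" by (intro continuous_intros hc)
    show "AE x in lborel. x \<in> V \<longrightarrow> h 1 1 x * h 2 2 x - h 1 2 x * h 2 1 x = 1"
      using Heq ma
    proof eventually_elim
      case (elim x)
      show ?case
      proof
        assume x: "x \<in> V"
        then have "h i j x = H x $ i $ j" for i j using elim(1) by (simp add: h_def)
        moreover have "det (H x) = 1" using elim(2) x VS by blast
        ultimately show "h 1 1 x * h 2 2 x - h 1 2 x * h 2 1 x = 1" by (simp add: det_2)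
      qed
    qed
  qed
  have Psym: "Dp (g x) $ 2 $ 1 = Dp (g x) $ 1 $ 2" if "x \<in> V" for x
    using sym[OF that] nz[OF that] by (simp add: h_eq)
  \<comment> \<open>For \<open>P = Dp (g x)\<close> with determinant \<open>D\<close>,
    \<open>det h = 1\<close> reads \<open>(1 - tr P + D) / D = 1\<close>, so the trace is 1.\<close>
  have trace: "Dp (g x) $ 1 $ 1 + Dp (g x) $ 2 $ 2 = 1" if x: "x \<in> V" for x
  proof -
    let ?a = "Dp (g x) $ 1 $ 1" and ?b = "Dp (g x) $ 1 $ 2" and ?c = "Dp (g x) $ 2 $ 2" and ?D = "det (Dp (g x))"
    have D: "?a * ?c - ?b * ?b = ?D" using Psym[OF x] by (simp add: det_2)
    have zf: "z / ?D - 1 = (z - ?D) / ?D" for z using nz[OF x] by (simp add: diff_divide_distrib)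
    have "((?c - ?D) * (?a - ?D) - - ?b * - ?b) / (?D * ?D) = 1"
      using det1[OF x, unfolded h_eq Psym[OF x]]
      unfolding zf times_divide_times_eq diff_divide_distrib[symmetric] .
    then have "(?c - ?D) * (?a - ?D) - ?b * ?b = ?D * ?D" using nz[OF x] by (simp add: divide_eq_eq)
    then have "?D * (1 - (?a + ?c)) = 0" using D by algebra
    then show ?thesis using nz[OF x] by simp
  qed
  \<comment> \<open>The factor \<open>e\<close> keeps the closed ball of radius \<open>d k\<close>
    around each point of \<open>V\<close> in \<open>S\<close>, where the weak derivatives may be
    mollified.\<close>
  define d where "d k = e * eps k" for k
  have e1: "eps k \<le> 1" for k by (simp add: eps_def inverse_le_1_iff)
  have d: "d k > 0" "d k \<le> e" for k using ch(3) eps(1)[of k] e1[of k] by (auto simp: d_def mult_left_le)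
  have d0: "d \<longlonglongrightarrow> 0" unfolding d_def[abs_def] using tendsto_mult_right_zero[OF eps(2)] .
  define U Z where "U j k x = conv (X j) (moll (d k)) x" and "Z j k x = conv (Y j) (moll (d k)) x" for j k x
  have smooth_conv: "continuous_on UNIV (conv f (moll (d k)))" if "integrable lborel f" for f :: "real^2 \<Rightarrow> real" and k
    by (rule smooth_on_continuous[OF conv_smooth[OF that test_function_moll[OF d(1)]]])
  have Uc: "continuous_on UNIV (U j k)" "continuous_on UNIV (Z j k)" for j k
    unfolding U_def[abs_def] Z_def[abs_def] by (intro smooth_conv int)+
  have Um [measurable]: "U j k \<in> borel_measurable borel" "Z j k \<in> borel_measurable borel" for j k
    using Uc by (auto intro: borel_measurable_continuous_onI)
  have hm [measurable]: "(\<lambda>x. indicator V x * h i j x) \<in> borel_measurable borel" for i j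
    using borel_measurable_continuous_on_indicator[OF Vb hc] by simp
  have Dm [measurable]: "(\<lambda>x. indicator V x * Dp (g x) $ i $ j) \<in> borel_measurable borel" for i j
    using borel_measurable_continuous_on_indicator[OF Vb Dc] by simp
  define E1 where "E1 k x = Z 1 k x - (indicator V x * h 1 2 x * U 1 k x - indicator V x * h 1 1 x * U 2 k x)" for k x
  define E2 where "E2 k x = Z 2 k x - (indicator V x * h 2 2 x * U 1 k x - indicator V x * h 1 2 x * U 2 k x)" for k x
  have Em [measurable]: "E1 k \<in> borel_measurable borel" "E2 k \<in> borel_measurable borel" for k
    unfolding E1_def[abs_def] E2_def[abs_def] by measurable
  have nc: "L1_null V (\<lambda>k x. \<bar>conv f (moll (d k)) x - f x\<bar>)" if f: "integrable lborel f" for f :: "real^2 \<Rightarrow> real"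
  proof (rule L1_null_bound[OF L1_null_conv[OF f Vbd Vb d(1) d0] Vb, where B = 1])
    have "f \<in> borel_measurable borel" "conv f (moll (d k)) \<in> borel_measurable borel" for k
      using f borel_measurable_continuous_onI[OF smooth_conv[OF f]] by auto
    then show "(\<lambda>x. \<bar>conv f (moll (d k)) x - f x\<bar>) \<in> borel_measurable borel" for k by simp
  qed simp
  have nE: "L1_null V E1" "L1_null V E2"
  proof -
    have s: "L1_null V (\<lambda>k x. \<bar>Z j k x - Y j x\<bar> + (\<bar>U 1 k x - X 1 x\<bar> + \<bar>U 2 k x - X 2 x\<bar>))" for j
      unfolding U_def Z_def by (intro L1_null_add nc int Vb)
    \<comment> \<open>After subtraction of the exact relation each error carries a coefficient of
      size at most \<open>B\<close>; \<open>B \<ge> 1\<close> also covers the coefficient 1 of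
      \<open>z - y\<close>.\<close>
    have est: "\<bar>z - (a * u1 - b * u2)\<bar> \<le> B * \<bar>\<bar>z - y\<bar> + (\<bar>u1 - x1\<bar> + \<bar>u2 - x2\<bar>)\<bar>"
      if "\<bar>a\<bar> \<le> B" "\<bar>b\<bar> \<le> B" "y = a * x1 - b * x2" for z a b u1 u2 y x1 x2 :: real
    proof -
      have "z - (a * u1 - b * u2) = (z - y) - a * (u1 - x1) + b * (u2 - x2)" using that(3) by (simp add: algebra_simps)
      then have "\<bar>z - (a * u1 - b * u2)\<bar> \<le> \<bar>z - y\<bar> + \<bar>a * (u1 - x1)\<bar> + \<bar>b * (u2 - x2)\<bar>" by linarith
      also have "\<dots> \<le> B * \<bar>z - y\<bar> + B * \<bar>u1 - x1\<bar> + B * \<bar>u2 - x2\<bar>"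
        unfolding abs_mult using that(1,2) B1 mult_right_mono[of 1 B "\<bar>z - y\<bar>"]
        by (intro add_mono mult_right_mono) auto
      finally show ?thesis by (simp add: algebra_simps)
    qed
    show "L1_null V E1"
    proof (rule L1_null_bound[OF s[of 1] Vb Em(1)])
      show "AE x in lborel. x \<in> V \<longrightarrow> \<bar>E1 k x\<bar> \<le> B * \<bar>\<bar>Z 1 k x - Y 1 x\<bar> + (\<bar>U 1 k x - X 1 x\<bar> + \<bar>U 2 k x - X 2 x\<bar>)\<bar>" for k
        using Heq rel
      proof eventually_elim
        case (elim x)
        show ?case
        proof
          assume x: "x \<in> V"
          then have "h i j x = H x $ i $ j" for i j using elim(1) by (simp add: h_def)
          then have "Y 1 x = h 1 2 x * X 1 x - h 1 1 x * X 2 x" using elim(2) x VS by auto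
          from est[OF hb[OF x] hb[OF x] this] x
          show "\<bar>E1 k x\<bar> \<le> B * \<bar>\<bar>Z 1 k x - Y 1 x\<bar> + (\<bar>U 1 k x - X 1 x\<bar> + \<bar>U 2 k x - X 2 x\<bar>)\<bar>"
            by (simp add: E1_def)
        qed
      qed
    qed
    show "L1_null V E2"
    proof (rule L1_null_bound[OF s[of 2] Vb Em(2)])
      show "AE x in lborel. x \<in> V \<longrightarrow> \<bar>E2 k x\<bar> \<le> B * \<bar>\<bar>Z 2 k x - Y 2 x\<bar> + (\<bar>U 1 k x - X 1 x\<bar> + \<bar>U 2 k x - X 2 x\<bar>)\<bar>" for k
        using Heq rel
      proof eventually_elim
        case (elim x)
        show ?case
        proof
          assume x: "x \<in> V"
          then have "h i j x = H x $ i $ j" for i j using elim(1) by (simp add: h_def)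
          then have "Y 2 x = h 2 2 x * X 1 x - h 1 2 x * X 2 x" using elim(2) x VS by auto
          from est[OF hb[OF x] hb[OF x] this] x
          show "\<bar>E2 k x\<bar> \<le> B * \<bar>\<bar>Z 2 k x - Y 2 x\<bar> + (\<bar>U 1 k x - X 1 x\<bar> + \<bar>U 2 k x - X 2 x\<bar>)\<bar>"
            by (simp add: E2_def)
        qed
      qed
    qed
  qed
  have nEa: "L1_null V (\<lambda>k x. \<bar>E1 k x\<bar> + \<bar>E2 k x\<bar>)"
    by (intro L1_null_add L1_null_bound[OF nE(1) Vb, where B = 1] L1_null_bound[OF nE(2) Vb, where B = 1] Vb)
      simp_all
  have nF: "L1_null V (\<lambda>k x. E1 k x * (indicator V x * Dp (g x) $ i $ j) + E2 k x * (indicator V x * Dp (g x) $ i' $ j'))" for i j i' j'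
  proof (rule L1_null_bound[OF nEa Vb, where B = C])
    show "AE x in lborel. x \<in> V \<longrightarrow> \<bar>E1 k x * (indicator V x * Dp (g x) $ i $ j) + E2 k x * (indicator V x * Dp (g x) $ i' $ j')\<bar>
        \<le> C * \<bar>\<bar>E1 k x\<bar> + \<bar>E2 k x\<bar>\<bar>" for k
    proof (intro AE_I2 impI)
      fix x assume x: "x \<in> V"
      have "\<bar>E1 k x * Dp (g x) $ i $ j\<bar> \<le> \<bar>E1 k x\<bar> * C" "\<bar>E2 k x * Dp (g x) $ i' $ j'\<bar> \<le> \<bar>E2 k x\<bar> * C"
        unfolding abs_mult using C(2) g(1)[OF x] by (auto intro: mult_left_mono)
      then show "\<bar>E1 k x * (indicator V x * Dp (g x) $ i $ j) + E2 k x * (indicator V x * Dp (g x) $ i' $ j')\<bar>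
          \<le> C * \<bar>\<bar>E1 k x\<bar> + \<bar>E2 k x\<bar>\<bar>"
        using x abs_triangle_ineq[of "E1 k x * Dp (g x) $ i $ j" "E2 k x * Dp (g x) $ i' $ j'"]
        by (simp add: distrib_left mult.commute)
    qed
  qed measurable
  define a b where "a k y = conv u (moll (d k)) (p y)" and "b k y = conv v (moll (d k)) (p y)" for k y
  define a' b' where "a' k y z = (Dp y *v z) $ 1 * U 1 k (p y) + (Dp y *v z) $ 2 * U 2 k (p y)"
    and "b' k y z = (Dp y *v z) $ 1 * Z 1 k (p y) + (Dp y *v z) $ 2 * Z 2 k (p y)" for k y z
  have der: "((\<lambda>y. conv f (moll (d k)) (p y)) has_derivative (\<lambda>z. (Dp y *v z) $ 1 * conv (G 1) (moll (d k)) (p y)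
        + (Dp y *v z) $ 2 * conv (G 2) (moll (d k)) (p y))) (at y)"
    if f: "integrable lborel f" and G: "\<And>j. weak_deriv S f (axis j 1) (G j)" and y: "y \<in> W"
    for f :: "real^2 \<Rightarrow> real" and G k y
  proof -
    let ?D = "frechet_derivative (conv f (moll (d k))) (at (p y))"
    have fd: "(conv f (moll (d k)) has_derivative ?D) (at (p y))"
      by (rule smooth_on_has_derivative[OF conv_smooth[OF f test_function_moll[OF d(1)]]]) simp
    have lin: "linear ?D" by (rule has_derivative_linear[OF fd])
    have "cball (p y) (d k) \<subseteq> S" using ch(4)[OF p(1)[OF y]] d(2)[of k] by (auto simp: subset_iff)
    then have Dj: "?D (axis j 1) = conv (G j) (moll (d k)) (p y)" for j
      by (rule conv_moll_weak_deriv[OF f G d(1)])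
    have "?D z = z $ 1 * conv (G 1) (moll (d k)) (p y) + z $ 2 * conv (G 2) (moll (d k)) (p y)" for z
    proof -
      have "z = z $ 1 *\<^sub>R axis 1 1 + z $ 2 *\<^sub>R axis 2 1" by (simp add: vec_eq_iff forall_2 axis_def)
      then have "?D z = ?D (z $ 1 *\<^sub>R axis 1 1 + z $ 2 *\<^sub>R axis 2 1)" by simp
      then show ?thesis by (simp add: linear_add[OF lin] linear_scale[OF lin] Dj)
    qed
    then show ?thesis using has_derivative_compose[OF p_der[OF y] fd] by simp
  qed
  have ad: "(a k has_derivative a' k y) (at y)" if "y \<in> W" for k y
    unfolding a_def[abs_def] a'_def[abs_def] U_def by (rule der[OF int(1) w(1) that])
  have bd: "(b k has_derivative b' k y) (at y)" if "y \<in> W" for k y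
    unfolding b_def[abs_def] b'_def[abs_def] Z_def by (rule der[OF int(2) w(2) that])
  have Dpc: "continuous_on W (\<lambda>y. (Dp y *v z) $ i)" for z i
    unfolding matrix_vector_mult_def sum_2
    by (simp, intro continuous_intros smooth_on_continuous[OF Dp_smooth])
  have Upc: "continuous_on W (\<lambda>y. U j k (p y))" "continuous_on W (\<lambda>y. Z j k (p y))" for j k
    using continuous_on_compose2[OF Uc(1) p_cont] continuous_on_compose2[OF Uc(2) p_cont] by auto
  have ac: "continuous_on W (\<lambda>y. a' k y z)" "continuous_on W (\<lambda>y. b' k y z)" for k z
    unfolding a'_def b'_def by (intro continuous_intros Dpc Upc)+
  have en: "(Dp y *v axis j 1) $ i = Dp y $ i $ j" for y i j
    by (simp add: matrix_vector_mult_basis column_def)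
  \<comment> \<open>The exact Cauchy--Riemann part cancels by \<open>cauchy_riemann_algebra\<close>;
    the errors remain, weighted by entries of \<open>Dp\<close>.\<close>
  have alg: "a' k y (axis 1 1) - b' k y (axis 2 1) = - (E1 k (p y) * (indicator V (p y) * Dp (g (p y)) $ 1 $ 2)
        + E2 k (p y) * (indicator V (p y) * Dp (g (p y)) $ 2 $ 2))"
    "a' k y (axis 2 1) + b' k y (axis 1 1) = E1 k (p y) * (indicator V (p y) * Dp (g (p y)) $ 1 $ 1)
        + E2 k (p y) * (indicator V (p y) * Dp (g (p y)) $ 2 $ 1)" if y: "y \<in> W" for k y
  proof -
    have x: "p y \<in> V" and gp: "g (p y) = y" using p y by auto
    have D: "det (Dp y) = Dp y $ 1 $ 1 * Dp y $ 2 $ 2 - Dp y $ 1 $ 2 * Dp y $ 1 $ 2"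
      using Psym[OF x] by (simp add: gp det_2)
    have Dn: "det (Dp y) \<noteq> 0" by (rule det[OF y])
    have t: "Dp y $ 1 $ 1 + Dp y $ 2 $ 2 = 1" using trace[OF x] by (simp add: gp)
    note cr = cauchy_riemann_algebra[OF D Dn t h_eq(1,2,4)[of "p y", unfolded gp], of "U 1 k (p y)" "U 2 k (p y)"]
    have s: "Dp y $ 2 $ 1 = Dp y $ 1 $ 2" using Psym[OF x] by (simp add: gp)
    show "a' k y (axis 1 1) - b' k y (axis 2 1) = - (E1 k (p y) * (indicator V (p y) * Dp (g (p y)) $ 1 $ 2)
        + E2 k (p y) * (indicator V (p y) * Dp (g (p y)) $ 2 $ 2))"
      using cr(1) x by (simp add: a'_def b'_def en gp s E1_def E2_def algebra_simps)
    show "a' k y (axis 2 1) + b' k y (axis 1 1) = E1 k (p y) * (indicator V (p y) * Dp (g (p y)) $ 1 $ 1)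
        + E2 k (p y) * (indicator V (p y) * Dp (g (p y)) $ 2 $ 1)"
      using cr(2) x by (simp add: a'_def b'_def en gp s E1_def E2_def algebra_simps)
  qed
  have alg': "- a' k y (axis 1 1) + b' k y (axis 2 1) = E1 k (p y) * (indicator V (p y) * Dp (g (p y)) $ 1 $ 2)
        + E2 k (p y) * (indicator V (p y) * Dp (g (p y)) $ 2 $ 2)"
    if "y \<in> W" for k y using alg(1)[OF that, of k] by simp
  have nFm: "L1_null V (\<lambda>k x. - (E1 k x * (indicator V x * Dp (g x) $ 1 $ 2) + E2 k x * (indicator V x * Dp (g x) $ 2 $ 2)))"
  proof (rule L1_null_bound[OF nF[of 1 2 2 2] Vb, where B = 1])
    show "AE x in lborel. x \<in> V \<longrightarrow> \<bar>- (E1 k x * (indicator V x * Dp (g x) $ 1 $ 2) + E2 k x * (indicator V x * Dp (g x) $ 2 $ 2))\<bar>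
        \<le> 1 * \<bar>E1 k x * (indicator V x * Dp (g x) $ 1 $ 2) + E2 k x * (indicator V x * Dp (g x) $ 2 $ 2)\<bar>" for k
      unfolding abs_minus_cancel by simp
  qed measurable
  have p1: "set_integrable lborel W (\<lambda>y. a' k y (axis 1 1) - b' k y (axis 2 1))"
    "(\<lambda>k. LINT y|lborel. indicator W y * \<bar>a' k y (axis 1 1) - b' k y (axis 2 1)\<bar>) \<longlonglongrightarrow> 0" for k
    by (rule L1_null_transfer[OF nFm], erule alg(1))+
  have q1: "set_integrable lborel W (\<lambda>y. a' k y (axis 2 1) + b' k y (axis 1 1))"
    "(\<lambda>k. LINT y|lborel. indicator W y * \<bar>a' k y (axis 2 1) + b' k y (axis 1 1)\<bar>) \<longlonglongrightarrow> 0" for k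
    by (rule L1_null_transfer[OF nF], erule alg(2))+
  have sV: "set_integrable lborel V f" if "integrable lborel f" for f :: "real^2 \<Rightarrow> real"
    using integrable_real_mult_indicator[OF _ that, of V] Vb by (simp add: set_integrable_def mult.commute)
  have fm: "f \<in> borel_measurable borel" if "integrable lborel f" for f :: "real^2 \<Rightarrow> real" using that by simp
  have f: "integrable lborel (\<lambda>y. indicator W y * f (p y))" if "integrable lborel f" for f :: "real^2 \<Rightarrow> real"
    using transfer(1)[OF fm[OF that] sV[OF that]] by (simp add: set_integrable_def)
  have l: "set_integrable lborel W (\<lambda>y. conv f (moll (d k)) (p y) - indicator W y * f (p y))"
    "(\<lambda>k. LINT y|lborel. indicator W y * \<bar>conv f (moll (d k)) (p y) - indicator W y * f (p y)\<bar>) \<longlonglongrightarrow> 0"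
    if "integrable lborel f" for f :: "real^2 \<Rightarrow> real" and k
    using L1_null_transfer[OF L1_null_conv[OF that Vbd Vb d(1) d0],
        of "\<lambda>k y. conv f (moll (d k)) (p y) - indicator W y * f (p y)"] by simp_all
  have hu: "weakly_harmonic W (\<lambda>y. indicator W y * u (p y))"
  proof (rule weakly_harmonic_limit[OF Basis_real2 axis_neq W(1), where a = a and a' = a' and b = b and b' = b'])
    show "set_integrable lborel W (\<lambda>y. a k y - indicator W y * u (p y))" for k
      unfolding a_def by (rule l(1)[OF int(1)])
    show "(\<lambda>k. LINT y|lborel. indicator W y * \<bar>a k y - indicator W y * u (p y)\<bar>) \<longlonglongrightarrow> 0"
      unfolding a_def by (rule l(2)[OF int(1)])
  qed (fact ad bd ac f[OF int(1)] p1 q1)+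
  \<comment> \<open>For \<open>v\<close> the conjugate function is minus \<open>u\<close>, and the
    two defects change places up to sign.\<close>
  have hv: "weakly_harmonic W (\<lambda>y. indicator W y * v (p y))"
  proof (rule weakly_harmonic_limit[OF Basis_real2 axis_neq W(1), where a = b and a' = b'
        and b = "\<lambda>k y. - a k y" and b' = "\<lambda>k y z. - a' k y z"])
    show "set_integrable lborel W (\<lambda>y. b k y - indicator W y * v (p y))" for k
      unfolding b_def by (rule l(1)[OF int(2)])
    show "(\<lambda>k. LINT y|lborel. indicator W y * \<bar>b k y - indicator W y * v (p y)\<bar>) \<longlonglongrightarrow> 0"
      unfolding b_def by (rule l(2)[OF int(2)])
    show "((\<lambda>y. - a k y) has_derivative (\<lambda>z. - a' k y z)) (at y)" if "y \<in> W" for k y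
      by (rule has_derivative_minus[OF ad[OF that]])
    show "continuous_on W (\<lambda>y. - a' k y z)" for k z by (rule continuous_on_minus[OF ac(1)])
    show "set_integrable lborel W (\<lambda>y. b' k y (axis 1 1) - - a' k y (axis 2 1))" for k
      using q1(1)[of k] by (simp add: add.commute)
    show "(\<lambda>k. LINT y|lborel. indicator W y * \<bar>b' k y (axis 1 1) - - a' k y (axis 2 1)\<bar>) \<longlonglongrightarrow> 0"
      using q1(2) by (simp add: add.commute)
    show "set_integrable lborel W (\<lambda>y. b' k y (axis 2 1) + - a' k y (axis 1 1))" for k
      using set_integrable_mult_right[of "-1", OF p1(1)[of k]] by simp
    show "(\<lambda>k. LINT y|lborel. indicator W y * \<bar>b' k y (axis 2 1) + - a' k y (axis 1 1)\<bar>) \<longlonglongrightarrow> 0"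
      using p1(2) by (simp add: abs_minus_commute)
  qed (fact bd ac f[OF int(2)])+
  show "\<exists>N w. open N \<and> x0 \<in> N \<and> smooth_on N w \<and> (AE x in lborel. x \<in> N \<longrightarrow> u x = w x)"
    by (rule harmonic_regularity[OF ch(2) fm[OF int(1)] sV[OF int(1)] hu])
  show "\<exists>N w. open N \<and> x0 \<in> N \<and> smooth_on N w \<and> (AE x in lborel. x \<in> N \<longrightarrow> v x = w x)"
    by (rule harmonic_regularity[OF ch(2) fm[OF int(2)] sV[OF int(2)] hv])
qed

end

section \<open>Borel representatives and uniqueness of weak derivatives\<close>

lemma lebesgue_on_measurable_iff:
  fixes f :: "'a::euclidean_space \<Rightarrow> real"
  assumes "open S"
  shows "f \<in> borel_measurable (lebesgue_on S) \<longleftrightarrow> (\<lambda>x. indicator S x *\<^sub>R f x) \<in> borel_measurable lebesgue"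
  using assms by (intro borel_measurable_restrict_space_iff) auto

lemma lebesgue_on_integrable_iff:
  fixes f :: "'a::euclidean_space \<Rightarrow> real"
  assumes "open S"
  shows "integrable (lebesgue_on S) f \<longleftrightarrow> integrable lebesgue (\<lambda>x. indicator S x *\<^sub>R f x)"
  using assms by (intro integrable_restrict_space) auto

text \<open>The convolution arguments use Borel functions and \<open>lborel\<close>, whereas Sobolev
  functions are given up to null sets on \<open>lebesgue_on S\<close>; extension by 0 makes the
  replacement global.\<close>

lemma borel_representative:
  fixes f :: "'a::euclidean_space \<Rightarrow> real"
  assumes S: "open S" and f: "f \<in> borel_measurable (lebesgue_on S)"
  shows "\<exists>f'. f' \<in> borel_measurable borel \<and> (\<forall>x. x \<notin> S \<longrightarrow> f' x = 0) \<and> (AE x in lebesgue. x \<in> S \<longrightarrow> f x = f' x)"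
proof -
  have "(\<lambda>x. indicator S x *\<^sub>R f x) \<in> borel_measurable lebesgue"
    using f by (simp add: lebesgue_on_measurable_iff[OF S])
  then obtain f0 where f0: "f0 \<in> borel_measurable lborel" "AE x in lborel. indicator S x *\<^sub>R f x = f0 x"
    using completion_ex_borel_measurable_real by blast
  have "AE x in lebesgue. indicator S x *\<^sub>R f x = f0 x" using f0(2) by (simp add: AE_completion_iff)
  then have "AE x in lebesgue. x \<in> S \<longrightarrow> f x = indicator S x * f0 x" by eventually_elim auto
  moreover have "(\<lambda>x. indicator S x * f0 x) \<in> borel_measurable borel" using f0(1) S by simp
  ultimately show ?thesis by (intro exI[of _ "\<lambda>x. indicator S x * f0 x"]) auto
qed

lemma representative_integrable:
  fixes f f' :: "'a::euclidean_space \<Rightarrow> real"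
  assumes S: "open S" and f: "integrable (lebesgue_on S) f"
    and f': "f' \<in> borel_measurable borel" "\<And>x. x \<notin> S \<Longrightarrow> f' x = 0" "AE x in lebesgue. x \<in> S \<longrightarrow> f x = f' x"
  shows "integrable lborel f'"
proof -
  have i: "integrable lebesgue (\<lambda>x. indicator S x *\<^sub>R f x)" using f by (simp add: lebesgue_on_integrable_iff[OF S])
  have "AE x in lebesgue. indicator S x *\<^sub>R f x = f' x"
    using f'(3)
  proof eventually_elim
    case (elim x)
    then show ?case using f'(2)[of x] by (cases "x \<in> S") auto
  qed
  moreover have "f' \<in> borel_measurable lebesgue" by (rule measurable_completion) (use f'(1) in simp)
  ultimately have "integrable lebesgue f'"
    using i integrable_cong_AE[of "\<lambda>x. indicator S x *\<^sub>R f x" lebesgue f'] borel_measurable_integrable[OF i] by blast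
  then show ?thesis using f'(1) by (subst (asm) integrable_completion) auto
qed

lemma representative_integral:
  fixes f f' z :: "'a::euclidean_space \<Rightarrow> real"
  assumes S: "open S" and f: "f \<in> borel_measurable (lebesgue_on S)"
    and f': "f' \<in> borel_measurable borel" "\<And>x. x \<notin> S \<Longrightarrow> f' x = 0" "AE x in lebesgue. x \<in> S \<longrightarrow> f x = f' x"
    and z: "z \<in> borel_measurable borel"
  shows "(LINT x|lebesgue_on S. f x * z x) = (LINT x|lborel. f' x * z x)"
proof -
  have "(LINT x|lebesgue_on S. f x * z x) = (LINT x|lebesgue. indicator S x *\<^sub>R (f x * z x))"
    using S by (intro integral_restrict_space) auto
  also have "\<dots> = (LINT x|lebesgue. f' x * z x)"
  proof (rule integral_cong_AE)
    have "(\<lambda>x. indicator S x *\<^sub>R f x) \<in> borel_measurable lebesgue"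
      using f by (simp add: lebesgue_on_measurable_iff[OF S])
    moreover have "z \<in> borel_measurable lebesgue" by (rule measurable_completion) (use z in simp)
    ultimately have "(\<lambda>x. (indicator S x *\<^sub>R f x) * z x) \<in> borel_measurable lebesgue"
      by (rule borel_measurable_times)
    then show "(\<lambda>x. indicator S x *\<^sub>R (f x * z x)) \<in> borel_measurable lebesgue" by (simp add: mult.assoc)
    have "(\<lambda>x. f' x * z x) \<in> borel_measurable lborel" using f'(1) z by simp
    then show "(\<lambda>x. f' x * z x) \<in> borel_measurable lebesgue" by (rule measurable_completion)
    show "AE x in lebesgue. indicator S x *\<^sub>R (f x * z x) = f' x * z x"
      using f'(3)
    proof eventually_elim
      case (elim x)
      then show ?case using f'(2)[of x] by (cases "x \<in> S") auto
    qed
  qed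
  also have "\<dots> = (LINT x|lborel. f' x * z x)"
    using f'(1) z by (intro integral_completion) simp
  finally show ?thesis .
qed

text \<open>The Jacobian in the inclusion is only known to be locally integrable, while
  \<open>W12\<close> supplies a square integrable one; uniqueness transfers the inclusion to the
  latter. As integrability is local, the fundamental lemma is applied on balls.\<close>

lemma weak_jacobian_unique:
  fixes U :: "real^'d \<Rightarrow> real^'m" and G G' :: "real^'d \<Rightarrow> real^'d^'m"
  assumes S: "open S" and G: "has_weak_jacobian S U G" and G': "has_weak_jacobian S U G'"
  shows "AE x in lebesgue. x \<in> S \<longrightarrow> G x = G' x"
proof (rule AE_locally)
  fix x0 assume "x0 \<in> S"
  then obtain r where r: "r > 0" "cball x0 r \<subseteq> S" using S open_contains_cball by blast
  let ?B = "ball x0 r"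
  have BS: "?B \<subseteq> S" using r(2) by (auto simp: subset_iff)
  have comp: "AE z in lebesgue. z \<in> ?B \<longrightarrow> G z $ i $ j = G' z $ i $ j" for i j
  proof -
    define f where "f z = G z $ i $ j - G' z $ i $ j" for z
    have loc: "(\<lambda>z. E z $ i $ j) absolutely_integrable_on K"
      if "has_weak_jacobian S U E" "compact K" "K \<subseteq> S" for E :: "real^'d \<Rightarrow> real^'d^'m" and K
    proof -
      have "set_integrable lebesgue K E" using that by (simp add: has_weak_jacobian_def locally_integrable_on_def)
      then have "integrable lebesgue (\<lambda>z. (indicator K z *\<^sub>R E z) $ i $ j)"
        unfolding set_integrable_def
        by (rule integrable_bounded_linear[OF bounded_linear_compose[OF bounded_linear_vec_nth bounded_linear_vec_nth]])
      then show ?thesis by (simp add: set_integrable_def)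
    qed
    have "f absolutely_integrable_on cball x0 r"
      unfolding f_def[abs_def] using loc[OF G compact_cball r(2)] loc[OF G' compact_cball r(2)]
      by (rule set_integral_diff(1))
    then have fB: "f absolutely_integrable_on ?B" by (rule set_integrable_subset) auto
    then have fi: "integrable (lebesgue_on ?B) f"
      by (simp add: lebesgue_on_integrable_iff[OF open_ball] set_integrable_def)
    then have fm: "f \<in> borel_measurable (lebesgue_on ?B)" by (rule borel_measurable_integrable)
    obtain f' where f': "f' \<in> borel_measurable borel" "\<And>z. z \<notin> ?B \<Longrightarrow> f' z = 0" "AE z in lebesgue. z \<in> ?B \<longrightarrow> f z = f' z"
      using borel_representative[OF open_ball fm] by blast
    have "AE z in lborel. z \<in> ?B \<longrightarrow> f' z = 0"
    proof (rule AE_zero_weak[OF representative_integrable[OF open_ball fi f'] open_ball bounded_ball])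
      fix \<zeta> :: "real^'d \<Rightarrow> real" assume \<zeta>: "test_function ?B \<zeta>"
      obtain K where K: "compact K" "K \<subseteq> ?B" "\<And>x. x \<notin> K \<Longrightarrow> \<zeta> x = 0"
        by (rule test_functionE[OF \<zeta>]) blast
      obtain b where b: "\<And>x. \<bar>\<zeta> x\<bar> \<le> b" "b \<ge> 0" by (rule test_function_bounded[OF \<zeta>]) blast
      have zm: "\<zeta> \<in> borel_measurable lebesgue"
        by (rule measurable_completion) (use test_function_measurable[OF \<zeta>] in simp)
      have int: "integrable (lebesgue_on S) (\<lambda>z. E z $ i $ j * \<zeta> z)" if E: "has_weak_jacobian S U E" for E
      proof -
        have KS: "K \<subseteq> S" using K(2) BS by blast
        have e: "integrable lebesgue (\<lambda>z. indicator K z *\<^sub>R E z $ i $ j)"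
          using loc[OF E K(1) KS] by (simp add: set_integrable_def)
        have eq: "indicator S z *\<^sub>R (E z $ i $ j * \<zeta> z) = (indicator K z *\<^sub>R E z $ i $ j) * \<zeta> z" for z
          using K(3)[of z] KS by (cases "z \<in> K") auto
        show ?thesis
          unfolding lebesgue_on_integrable_iff[OF S] eq
        proof (rule Bochner_Integration.integrable_bound)
          show "integrable lebesgue (\<lambda>z. b * (indicator K z *\<^sub>R E z $ i $ j))" using e by simp
          show "(\<lambda>z. (indicator K z *\<^sub>R E z $ i $ j) * \<zeta> z) \<in> borel_measurable lebesgue"
            by (rule borel_measurable_times[OF borel_measurable_integrable[OF e] zm])
          show "AE z in lebesgue. norm ((indicator K z *\<^sub>R E z $ i $ j) * \<zeta> z) \<le> norm (b * (indicator K z *\<^sub>R E z $ i $ j))"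
            using b by (intro AE_I2) (simp add: abs_mult mult.commute[of b] mult_left_mono)
        qed
      qed
      have \<zeta>S: "test_function S \<zeta>" by (rule test_function_subset[OF \<zeta> BS])
      have "(LINT z|lebesgue_on S. U z $ i * frechet_derivative \<zeta> (at z) (axis j 1)) = - (LINT z|lebesgue_on S. E z $ i $ j * \<zeta> z)"
        if "has_weak_jacobian S U E" for E
        using that \<zeta>S unfolding has_weak_jacobian_def by blast
      from this[OF G] this[OF G']
      have "(LINT z|lebesgue_on S. G z $ i $ j * \<zeta> z) = (LINT z|lebesgue_on S. G' z $ i $ j * \<zeta> z)" by linarith
      then have 0: "(LINT z|lebesgue_on S. G z $ i $ j * \<zeta> z - G' z $ i $ j * \<zeta> z) = 0"
        using int[OF G] int[OF G'] by simp
      have "(LINT z|lborel. f' z * \<zeta> z) = (LINT z|lebesgue_on ?B. f z * \<zeta> z)"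
        by (rule representative_integral[OF open_ball fm f' test_function_measurable[OF \<zeta>], symmetric])
      also have "\<dots> = (LINT z|lebesgue. indicator ?B z *\<^sub>R (f z * \<zeta> z))"
        by (intro integral_restrict_space) auto
      also have "\<dots> = (LINT z|lebesgue. indicator S z *\<^sub>R (G z $ i $ j * \<zeta> z - G' z $ i $ j * \<zeta> z))"
      proof (intro Bochner_Integration.integral_cong refl)
        fix z
        show "indicator ?B z *\<^sub>R (f z * \<zeta> z) = indicator S z *\<^sub>R (G z $ i $ j * \<zeta> z - G' z $ i $ j * \<zeta> z)"
          using K(2) K(3)[of z] BS by (cases "z \<in> K") (auto simp: f_def left_diff_distrib indicator_def)
      qed
      also have "\<dots> = 0" unfolding 0[symmetric] using S by (intro integral_restrict_space[symmetric]) auto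
      finally show "(LINT z|lborel. f' z * \<zeta> z) = 0" .
    qed
    then have "AE z in lebesgue. z \<in> ?B \<longrightarrow> f' z = 0" by (simp add: AE_completion_iff)
    with f'(3) show ?thesis by eventually_elim (auto simp: f_def)
  qed
  have "AE z in lebesgue. \<forall>i\<in>UNIV. \<forall>j\<in>UNIV. z \<in> ?B \<longrightarrow> G z $ i $ j = G' z $ i $ j"
    by (intro AE_finite_allI finite comp)
  then have "AE z in lebesgue. z \<in> ?B \<longrightarrow> z \<in> S \<longrightarrow> G z = G' z"
    by eventually_elim (auto simp: vec_eq_iff)
  then show "\<exists>N. open N \<and> x0 \<in> N \<and> (AE z in lebesgue. z \<in> N \<longrightarrow> z \<in> S \<longrightarrow> G z = G' z)"
    using r(1) by (intro exI[of _ ?B]) auto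
qed

lemma integrable_componentwise:
  fixes f :: "'a \<Rightarrow> 'b::euclidean_space"
  assumes "\<And>b. b \<in> Basis \<Longrightarrow> integrable M (\<lambda>x. f x \<bullet> b)"
  shows "integrable M f"
proof -
  have "integrable M (\<lambda>x. \<Sum>b\<in>Basis. (f x \<bullet> b) *\<^sub>R b)"
    by (intro Bochner_Integration.integrable_sum integrable_scaleR_left assms)
  then show ?thesis by (simp add: euclidean_representation)
qed

lemma weak_deriv_uminus:
  "weak_deriv S f b g \<Longrightarrow> weak_deriv S (\<lambda>x. - f x) b (\<lambda>x. - g x)"
  by (simp add: weak_deriv_def)

text \<open>Integrability follows from boundedness of \<open>S\<close> and
  \<open>\<bar>t\<bar> \<le> 1 + t\<^sup>2\<close>.\<close>

lemma square_integrable_representative: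
  fixes f :: "'a::euclidean_space \<Rightarrow> real"
  assumes S: "open S" "bounded S" and f: "f \<in> borel_measurable (lebesgue_on S)" "integrable (lebesgue_on S) (\<lambda>x. (f x)\<^sup>2)"
  shows "\<exists>f'. f' \<in> borel_measurable borel \<and> (\<forall>x. x \<notin> S \<longrightarrow> f' x = 0) \<and> (AE x in lebesgue. x \<in> S \<longrightarrow> f x = f' x) \<and>
    integrable lborel f' \<and> integrable lborel (\<lambda>x. (f' x)\<^sup>2)"
proof -
  obtain f' where f': "f' \<in> borel_measurable borel" "\<And>x. x \<notin> S \<Longrightarrow> f' x = 0" "AE x in lebesgue. x \<in> S \<longrightarrow> f x = f' x"
    using borel_representative[OF S(1) f(1)] by blast
  have i2: "integrable lborel (\<lambda>x. (f' x)\<^sup>2)"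
  proof (rule representative_integrable[OF S(1) f(2)])
    show "AE x in lebesgue. x \<in> S \<longrightarrow> (f x)\<^sup>2 = (f' x)\<^sup>2" using f'(3) by eventually_elim auto
  qed (use f' in auto)
  have iS: "integrable lborel (indicator S :: 'a \<Rightarrow> real)"
    using emeasure_bounded_finite[OF S(2)] S(1) by (intro integrable_real_indicator) auto
  have "integrable lborel f'"
  proof (rule Bochner_Integration.integrable_bound)
    show "integrable lborel (\<lambda>x. indicator S x + (f' x)\<^sup>2)" using iS i2 by (rule Bochner_Integration.integrable_add)
    show "f' \<in> borel_measurable lborel" using f'(1) by simp
    show "AE x in lborel. norm (f' x) \<le> norm (indicator S x + (f' x)\<^sup>2)"
    proof (rule AE_I2)
      fix x
      have "\<bar>f' x\<bar> \<le> 1 + (f' x)\<^sup>2"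
        using zero_le_power2[of "\<bar>f' x\<bar> - 1"] zero_le_power2[of "f' x"] by (simp add: power2_diff)
      then show "norm (f' x) \<le> norm (indicator S x + (f' x)\<^sup>2)"
        using f'(2)[of x] by (cases "x \<in> S") auto
    qed
  qed
  with f' i2 show ?thesis by blast
qed

lemma square_integrable_component:
  assumes S: "open S" and f: "square_integrable_on f S" and L: "bounded_linear L" "\<And>x. \<bar>L x\<bar> \<le> norm x"
  shows "(\<lambda>x. L (f x) :: real) \<in> borel_measurable (lebesgue_on S)" "integrable (lebesgue_on S) (\<lambda>x. (L (f x))\<^sup>2)"
proof -
  have fm: "f \<in> borel_measurable (lebesgue_on S)" using f by (simp add: square_integrable_on_def)
  have "continuous_on UNIV L" by (rule linear_continuous_on[OF L(1)])
  then show Lm: "(\<lambda>x. L (f x)) \<in> borel_measurable (lebesgue_on S)"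
    using measurable_compose[OF fm borel_measurable_continuous_onI] by blast
  show "integrable (lebesgue_on S) (\<lambda>x. (L (f x))\<^sup>2)"
  proof (rule Bochner_Integration.integrable_bound)
    show "integrable (lebesgue_on S) (\<lambda>x. (norm (f x))\<^sup>2)" using f by (simp add: square_integrable_on_def)
    show "(\<lambda>x. (L (f x))\<^sup>2) \<in> borel_measurable (lebesgue_on S)" using Lm by simp
    show "AE x in lebesgue_on S. norm ((L (f x))\<^sup>2) \<le> norm ((norm (f x))\<^sup>2)"
    proof (rule AE_I2)
      fix x
      have "\<bar>L (f x)\<bar>\<^sup>2 \<le> (norm (f x))\<^sup>2" by (rule power_mono[OF L(2)]) simp
      then show "norm ((L (f x))\<^sup>2) \<le> norm ((norm (f x))\<^sup>2)" by simp
    qed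
  qed
qed

section \<open>Assembly: reading the stacked inclusion as one Monge--Ampere map with conjugate
  pairs\<close>

theorem proposition4p3:
  fixes \<Omega> :: "(real^2) set"
    and U :: "real^2 \<Rightarrow> real^('n::{finite,linorder} + 'n + 2)"
    and DU :: "real^2 \<Rightarrow> real^2^('n + 'n + 2)"
  assumes "open \<Omega>" and "convex \<Omega>" and "bounded \<Omega>"
    and "U \<in> W12 \<Omega>"
    and "has_weak_jacobian \<Omega> U DU"
    and "AE x in lebesgue_on \<Omega>. DU x \<in> C_area"
  shows "\<exists>V :: real^2 \<Rightarrow> real^('n + 'n + 2).
           smooth_on \<Omega> V \<and> (AE x in lebesgue_on \<Omega>. U x = V x)"
proof -
  note op = assms(1) and bd = assms(3)
  have \<Omega>m: "\<Omega> \<in> sets lebesgue" using op by auto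
  obtain G where U2: "square_integrable_on U \<Omega>" and G: "has_weak_jacobian \<Omega> U G" and G2: "square_integrable_on G \<Omega>"
    using assms(4) by (auto simp: W12_def)
  have "AE x in lebesgue. x \<in> \<Omega> \<longrightarrow> DU x \<in> C_area"
    using assms(6) \<Omega>m by (simp add: AE_restrict_space_iff)
  then have inC: "AE x in lebesgue. x \<in> \<Omega> \<longrightarrow> G x \<in> C_area"
    using weak_jacobian_unique[OF op assms(5) G] by eventually_elim auto
  define rep where "rep f f' \<longleftrightarrow> f' \<in> borel_measurable borel \<and> (\<forall>x. x \<notin> \<Omega> \<longrightarrow> f' x = 0) \<and>
    (AE x in lebesgue. x \<in> \<Omega> \<longrightarrow> f x = f' x) \<and> integrable lborel f' \<and> integrable lborel (\<lambda>x. (f' x)\<^sup>2)"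
    for f f' :: "real^2 \<Rightarrow> real"
  have "\<exists>f'. rep (\<lambda>x. U x $ i) f'" for i
    unfolding rep_def
    by (rule square_integrable_representative[OF op bd square_integrable_component[OF op U2 bounded_linear_vec_nth component_le_norm_cart]])
  then obtain u where "\<And>i. rep (\<lambda>x. U x $ i) (u i)" by metis
  then have u: "\<And>i. u i \<in> borel_measurable borel" "\<And>i x. x \<notin> \<Omega> \<Longrightarrow> u i x = 0"
      "\<And>i. AE x in lebesgue. x \<in> \<Omega> \<longrightarrow> U x $ i = u i x" "\<And>i. integrable lborel (u i)"
    by (simp_all add: rep_def)
  have cn: "\<bar>A $ i $ j\<bar> \<le> norm A" for A :: "real^2^('n + 'n + 2)" and i j
    using component_le_norm_cart[of "A $ i" j] Finite_Cartesian_Product.norm_nth_le[of A i] by linarith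
  have "\<exists>f'. rep (\<lambda>x. G x $ i $ j) f'" for i j
    unfolding rep_def
    by (rule square_integrable_representative[OF op bd square_integrable_component[OF op G2
          bounded_linear_compose[OF bounded_linear_vec_nth bounded_linear_vec_nth] cn]])
  then obtain g where "\<And>i j. rep (\<lambda>x. G x $ i $ j) (g i j)" by metis
  then have g: "\<And>i j. g i j \<in> borel_measurable borel" "\<And>i j x. x \<notin> \<Omega> \<Longrightarrow> g i j x = 0"
      "\<And>i j. AE x in lebesgue. x \<in> \<Omega> \<longrightarrow> G x $ i $ j = g i j x" "\<And>i j. integrable lborel (g i j)"
      "\<And>i j. integrable lborel (\<lambda>x. (g i j x)\<^sup>2)"
    by (simp_all add: rep_def)
  have wd: "weak_deriv \<Omega> (u i) (axis j 1) (g i j)" for i j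
    unfolding weak_deriv_def
  proof (intro allI impI)
    fix \<zeta> :: "real^2 \<Rightarrow> real" assume \<zeta>: "test_function \<Omega> \<zeta>"
    have "(LINT x|lborel. u i x * frechet_derivative \<zeta> (at x) (axis j 1)) =
        (LINT x|lebesgue_on \<Omega>. U x $ i * frechet_derivative \<zeta> (at x) (axis j 1))"
      by (rule representative_integral[OF op square_integrable_component(1)[OF op U2 bounded_linear_vec_nth component_le_norm_cart]
            u(1-3) test_function_measurable[OF test_function_derivative[OF \<zeta>]], symmetric])
    also have "\<dots> = - (LINT x|lebesgue_on \<Omega>. G x $ i $ j * \<zeta> x)"
      using G \<zeta> by (simp add: has_weak_jacobian_def)
    also have "(LINT x|lebesgue_on \<Omega>. G x $ i $ j * \<zeta> x) = (LINT x|lborel. g i j x * \<zeta> x)"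
      by (rule representative_integral[OF op square_integrable_component(1)[OF op G2
            bounded_linear_compose[OF bounded_linear_vec_nth bounded_linear_vec_nth] cn]
            g(1-3) test_function_measurable[OF \<zeta>]])
    finally show "(LINT x|lborel. u i x * frechet_derivative \<zeta> (at x) (axis j 1)) = - (LINT x|lborel. g i j x * \<zeta> x)" .
  qed
  let ?ua = "\<lambda>a :: 'n. Inl a :: 'n + 'n + 2" and ?va = "\<lambda>a :: 'n. Inr (Inl a) :: 'n + 'n + 2"
    and ?w = "\<lambda>r :: 2. Inr (Inr r) :: 'n + 'n + 2"
  have "AE x in lebesgue. \<forall>i\<in>UNIV. \<forall>j\<in>UNIV. x \<in> \<Omega> \<longrightarrow> G x $ i $ j = g i j x"
    by (intro AE_finite_allI finite g(3))
  with inC have "AE x in lebesgue. x \<in> \<Omega> \<longrightarrow> (\<exists>X. \<forall>i j. g i j x = stack3 X (A_map X) (B_map X) $ i $ j)"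
  proof eventually_elim
    case (elim x)
    show ?case
    proof
      assume x: "x \<in> \<Omega>"
      with elim(1) obtain X where "G x = stack3 X (A_map X) (B_map X)" by (auto simp: C_area_def)
      then have "\<forall>i j. g i j x = stack3 X (A_map X) (B_map X) $ i $ j" using elim(2) x by simp
      then show "\<exists>X. \<forall>i j. g i j x = stack3 X (A_map X) (B_map X) $ i $ j" by blast
    qed
  qed
  then have "AE x in lborel. x \<in> \<Omega> \<longrightarrow> (\<exists>X. \<forall>i j. g i j x = stack3 X (A_map X) (B_map X) $ i $ j)"
    by (simp add: AE_completion_iff)
  \<comment> \<open>The matrix parameter is eliminated: its entries are the derivatives of the first
    block, and those of \<open>h\<close> are read off from the last block. The resulting relations
    involve components of one weak Jacobian only.\<close>
  then have str: "AE x in lborel. x \<in> \<Omega> \<longrightarrow> (- g (?w 1) 1 x = g (?w 2) 2 x \<and> g (?w 2) 1 x > 0 \<and>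
      g (?w 2) 1 x * - g (?w 1) 2 x - g (?w 2) 2 x * g (?w 2) 2 x = 1 \<and>
      (\<forall>a. g (?va a) 1 x = g (?w 2) 2 x * g (?ua a) 1 x - g (?w 2) 1 x * g (?ua a) 2 x \<and>
        g (?va a) 2 x = - g (?w 1) 2 x * g (?ua a) 1 x - g (?w 2) 2 x * g (?ua a) 2 x))"
  proof eventually_elim
    case (elim x)
    show ?case
    proof
      assume "x \<in> \<Omega>"
      with elim obtain X where X: "\<And>i j. g i j x = stack3 X (A_map X) (B_map X) $ i $ j" by blast
      show "- g (?w 1) 1 x = g (?w 2) 2 x \<and> g (?w 2) 1 x > 0 \<and>
        g (?w 2) 1 x * - g (?w 1) 2 x - g (?w 2) 2 x * g (?w 2) 2 x = 1 \<and>
        (\<forall>a. g (?va a) 1 x = g (?w 2) 2 x * g (?ua a) 1 x - g (?w 2) 1 x * g (?ua a) 2 x \<and>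
          g (?va a) 2 x = - g (?w 1) 2 x * g (?ua a) 1 x - g (?w 2) 2 x * g (?ua a) 2 x)"
        using inclusion_structure[of X] by (simp add: X stack3_def)
    qed
  qed
  \<comment> \<open>Row 2 of \<open>B\<close> is the first row of \<open>h\<close>, and minus row 1
    is the second. Rearranging the last two components of \<open>U\<close> in the same way makes
    \<open>h\<close> a weak Jacobian.\<close>
  define \<phi> :: "real^2 \<Rightarrow> real^2" where "\<phi> x = vector [u (?w 2) x, - u (?w 1) x]" for x
  define H :: "real^2 \<Rightarrow> real^2^2" where
    "H x = vector [vector [g (?w 2) 1 x, g (?w 2) 2 x], vector [- g (?w 1) 1 x, - g (?w 1) 2 x]]" for x
  have H_nth: "H x $ 1 $ 1 = g (?w 2) 1 x" "H x $ 1 $ 2 = g (?w 2) 2 x" "H x $ 2 $ 1 = - g (?w 1) 1 x"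
      "H x $ 2 $ 2 = - g (?w 1) 2 x" for x
    by (simp_all add: H_def)
  have H_int: "integrable lborel (\<lambda>x. H x $ i $ j)" "integrable lborel (\<lambda>x. (H x $ i $ j)\<^sup>2)" for i j
    using exhaust_2[of i] exhaust_2[of j] by (elim disjE; simp add: H_nth g)+
  interpret ma: monge_ampere \<Omega> \<phi> H
  proof
    show "open \<Omega>" "bounded \<Omega>" by (fact op bd)+
    show "integrable lborel \<phi>"
      by (rule integrable_componentwise) (auto simp: Basis_real2 inner_axis \<phi>_def u)
    show "integrable lborel H"
    proof (rule integrable_componentwise)
      fix b :: "real^2^2" assume "b \<in> Basis"
      then obtain i j where "b = axis i (axis j 1)" by (auto simp: Basis_vec_def)
      then show "integrable lborel (\<lambda>x. H x \<bullet> b)" using H_int(1) by (simp add: inner_axis)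
    qed
    have "(norm (H x))\<^sup>2 = (H x $ 1 $ 1)\<^sup>2 + (H x $ 1 $ 2)\<^sup>2 + ((H x $ 2 $ 1)\<^sup>2 + (H x $ 2 $ 2)\<^sup>2)" for x
      unfolding power2_norm_eq_inner by (simp add: inner_vec_def sum_2 power2_eq_square)
    then show "integrable lborel (\<lambda>x. (norm (H x))\<^sup>2)" using H_int(2) by simp
    show "weak_deriv \<Omega> (\<lambda>x. \<phi> x $ i) (axis j 1) (\<lambda>x. H x $ i $ j)" for i j
      using exhaust_2[of i] exhaust_2[of j] wd weak_deriv_uminus[OF wd]
      by (elim disjE) (simp_all add: H_nth \<phi>_def)
    show "AE x in lborel. x \<in> \<Omega> \<longrightarrow> H x $ 1 $ 2 = H x $ 2 $ 1 \<and> H x $ 1 $ 1 > 0 \<and> det (H x) = 1"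
      using str by eventually_elim (auto simp: H_nth det_2)
    show "H x = 0" if "x \<notin> \<Omega>" for x
      using g(2)[OF that] by (simp add: vec_eq_iff forall_2 H_nth)
  qed
  have "\<exists>w. smooth_on \<Omega> w \<and> (AE x in lebesgue. x \<in> \<Omega> \<longrightarrow> u i x = w x)" for i
  proof (rule smooth_glue[OF op])
    fix x0 assume x0: "x0 \<in> \<Omega>"
    have cr: "\<exists>N w. open N \<and> x0 \<in> N \<and> smooth_on N w \<and> (AE z in lborel. z \<in> N \<longrightarrow> u (?ua a) z = w z)"
      "\<exists>N w. open N \<and> x0 \<in> N \<and> smooth_on N w \<and> (AE z in lborel. z \<in> N \<longrightarrow> u (?va a) z = w z)" for a
    proof -
      have rel: "AE x in lborel. x \<in> \<Omega> \<longrightarrow> g (?va a) 1 x = H x $ 1 $ 2 * g (?ua a) 1 x - H x $ 1 $ 1 * g (?ua a) 2 x \<and>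
          g (?va a) 2 x = H x $ 2 $ 2 * g (?ua a) 1 x - H x $ 1 $ 2 * g (?ua a) 2 x"
        using str by eventually_elim (auto simp: H_nth)
      note reg = ma.cauchy_riemann_regularity[OF x0 u(4) u(4) g(4) g(4) wd wd rel]
      show "\<exists>N w. open N \<and> x0 \<in> N \<and> smooth_on N w \<and> (AE z in lborel. z \<in> N \<longrightarrow> u (?ua a) z = w z)"
        by (rule reg(1))
      show "\<exists>N w. open N \<and> x0 \<in> N \<and> smooth_on N w \<and> (AE z in lborel. z \<in> N \<longrightarrow> u (?va a) z = w z)"
        by (rule reg(2))
    qed
    consider a where "i = ?ua a" | a where "i = ?va a" | "i = ?w 1" | "i = ?w 2"
    proof (cases i)
      case (Inr j)
      then show ?thesis using that exhaust_2 by (cases j) blast+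
    qed (use that in blast)
    then show "\<exists>N w. open N \<and> x0 \<in> N \<and> smooth_on N w \<and> (AE z in lborel. z \<in> N \<longrightarrow> u i z = w z)"
    proof cases
      case 3
      obtain N w where N: "open N" "x0 \<in> N" "smooth_on N w" "AE z in lborel. z \<in> N \<longrightarrow> \<phi> z $ 2 = w z"
        using ma.map_regularity[OF x0] by blast
      have "AE z in lborel. z \<in> N \<longrightarrow> u i z = - w z" using N(4) by eventually_elim (auto simp: \<phi>_def 3)
      with N smooth_on_minus[OF N(1,3)] show ?thesis by blast
    next
      case 4
      obtain N w where N: "open N" "x0 \<in> N" "smooth_on N w" "AE z in lborel. z \<in> N \<longrightarrow> \<phi> z $ 1 = w z"
        using ma.map_regularity[OF x0] by blast
      have "AE z in lborel. z \<in> N \<longrightarrow> u i z = w z" using N(4) by eventually_elim (auto simp: \<phi>_def 4)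
      with N show ?thesis by blast
    qed (use cr in auto)
  qed
  then obtain w where w: "\<And>i. smooth_on \<Omega> (w i)" "\<And>i. AE x in lebesgue. x \<in> \<Omega> \<longrightarrow> u i x = w i x" by metis
  let ?V = "\<lambda>x. \<chi> i. w i x"
  have "smooth_on \<Omega> ?V" by (rule smooth_on_vec[OF op]) (simp add: w)
  moreover have "AE x in lebesgue. x \<in> \<Omega> \<longrightarrow> U x $ i = w i x" for i
    using u(3)[of i] w(2)[of i] by eventually_elim auto
  then have "AE x in lebesgue. \<forall>i\<in>UNIV. x \<in> \<Omega> \<longrightarrow> U x $ i = w i x" by (intro AE_finite_allI finite)
  then have "AE x in lebesgue. x \<in> \<Omega> \<longrightarrow> U x = ?V x" by eventually_elim (auto simp: vec_eq_iff)
  then have "AE x in lebesgue_on \<Omega>. U x = ?V x" using \<Omega>m by (simp add: AE_restrict_space_iff)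
  ultimately show ?thesis by blast
qed

end
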